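(* Let $\mathcal{S}$ be a proper partial geometry $pg(s,t,\alpha)$ with $\alpha\ge 2$ that admits an abelian Singer group $G$ such that the pair $(\mathcal{S},G)$ is of rigid type. If $\mathcal{S}$ has fewer than $1000000$ points, then either $\mathcal{S}$ is (isomorphic to) the Van Lint–Schrijver partial geometry, or the number of points of $\mathcal{S}$ is $1024$, $4096$ or $194481$.
   Context: A proper partial geometry $pg(s,t,\alpha)$ is a finite point-line geometry such that each line contains $s+1$ points, each point is on $t+1$ lines, each pair of distinct lines intersects in at most one point, and, for every point $x$ and every line $L$ not containing $x$, there are exactly $\alpha$ lines through $x$ that intersect $L$, where $0<\alpha<\min(s,t)$. An abelian Singer group of $\mathcal{S}$ is an abelian group $G$ of automorphisms of $\mathcal{S}$ acting sharply transitively (regularly) on the points of $\mathcal{S}$. The pair $(\mathcal{S},G)$ is of rigid type if every line of $\mathcal{S}$ has trivial (setwise) stabilizer in $G$. The Van Lint–Schrijver partial geometry is the following $pg(5,5,2)$: let $\gamma$ be a primitive fifth root of unity in the finite field $\mathbb{F}_{81}$; the points are the elements of $\mathbb{F}_{81}$ and the lines are the $81$ sets $\{b,\,b+1,\,b+\gamma,\,b+\gamma^2,\,b+\gamma^3,\,b+\gamma^4\}$ with $b\in\mathbb{F}_{81}$. *)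

theory Defs
  imports "HOL-Algebra.Group_Action" "HOL-Algebra.Multiplicative_Group"
begin

text \<open>
  A geometry is a set of points together with a set of lines, a line being identified with
  the set of points on it. This loses nothing for the geometries considered here: lines have
  at least two points and distinct lines share at most one.
\<close>

locale partial_geometry =
  fixes P :: "'a set" and L :: "'a set set" and s t \<alpha> :: nat
  assumes finite_points: "finite P"
    \<comment> \<open>Without this the empty geometry would be a partial geometry for all parameters.\<close>
    and points_nonempty: "P \<noteq> {}"
    and lines_subset: "\<And>M. M \<in> L \<Longrightarrow> M \<subseteq> P"
    and points_on_line: "\<And>M. M \<in> L \<Longrightarrow> card M = s + 1"
    and lines_on_point: "\<And>x. x \<in> P \<Longrightarrow> card {M \<in> L. x \<in> M} = t + 1"
    and lines_meet: "\<And>M N. \<lbrakk>M \<in> L; N \<in> L; M \<noteq> N\<rbrakk> \<Longrightarrow> card (M \<inter> N) \<le> 1"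
    and antiflag: "\<And>x M. \<lbrakk>x \<in> P; M \<in> L; x \<notin> M\<rbrakk> \<Longrightarrow>
      card {N \<in> L. x \<in> N \<and> N \<inter> M \<noteq> {}} = \<alpha>"

locale proper_partial_geometry = partial_geometry +
  assumes alpha_pos: "0 < \<alpha>"
    and alpha_less: "\<alpha> < min s t"

definition geometry_iso ::
    "'a set \<Rightarrow> 'a set set \<Rightarrow> 'b set \<Rightarrow> 'b set set \<Rightarrow> ('a \<Rightarrow> 'b) set" where
  "geometry_iso P L P' L' = {f. bij_betw f P P' \<and> (\<lambda>M. f ` M) ` L = L'}"

text \<open>As in \<^const>\<open>auto\<close>, automorphisms are required to be extensional, so that each one is
  represented by a single function.\<close>

definition geometry_auto :: "'a set \<Rightarrow> 'a set set \<Rightarrow> ('a \<Rightarrow> 'a) set" where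
  "geometry_auto P L = geometry_iso P L P L \<inter> Bij P"

definition geometry_AutoGroup :: "'a set \<Rightarrow> 'a set set \<Rightarrow> ('a \<Rightarrow> 'a) monoid" where
  "geometry_AutoGroup P L = BijGroup P \<lparr>carrier := geometry_auto P L\<rparr>"

locale abelian_singer_group =
  fixes P :: "'a set" and L :: "'a set set" and G :: "('a \<Rightarrow> 'a) set"
  assumes automorphisms: "subgroup G (geometry_AutoGroup P L)"
    and abelian: "comm_group (geometry_AutoGroup P L \<lparr>carrier := G\<rparr>)"
    and sharply_transitive: "\<And>x y. \<lbrakk>x \<in> P; y \<in> P\<rbrakk> \<Longrightarrow> \<exists>!g. g \<in> G \<and> g x = y"

definition rigid_type :: "'a set \<Rightarrow> 'a set set \<Rightarrow> ('a \<Rightarrow> 'a) set \<Rightarrow> bool" where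
  "rigid_type P L G \<longleftrightarrow>
    (\<forall>M\<in>L. stabilizer (geometry_AutoGroup P L \<lparr>carrier := G\<rparr>) (\<lambda>g N. g ` N) M
      = {\<one>\<^bsub>geometry_AutoGroup P L\<^esub>})"

definition primitive_fifth_root :: "('f, 'm) ring_scheme \<Rightarrow> 'f \<Rightarrow> bool" where
  "primitive_fifth_root F \<gamma> \<longleftrightarrow> \<gamma> \<in> carrier (mult_of F) \<and> group.ord (mult_of F) \<gamma> = 5"

definition vLS_line :: "('f, 'm) ring_scheme \<Rightarrow> 'f \<Rightarrow> 'f \<Rightarrow> 'f set" where
  "vLS_line F \<gamma> b =
    {b, b \<oplus>\<^bsub>F\<^esub> \<one>\<^bsub>F\<^esub>, b \<oplus>\<^bsub>F\<^esub> \<gamma>, b \<oplus>\<^bsub>F\<^esub> \<gamma> [^]\<^bsub>F\<^esub> (2::nat),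
     b \<oplus>\<^bsub>F\<^esub> \<gamma> [^]\<^bsub>F\<^esub> (3::nat), b \<oplus>\<^bsub>F\<^esub> \<gamma> [^]\<^bsub>F\<^esub> (4::nat)}"

definition vLS_lines :: "('f, 'm) ring_scheme \<Rightarrow> 'f \<Rightarrow> 'f set set" where
  "vLS_lines F \<gamma> = vLS_line F \<gamma> ` carrier F"

text \<open>
  The field with 81 elements is unique up to isomorphism, and every primitive fifth root of
  unity in it gives the same lines, because the other ones are powers of it. So it does not
  matter which field on natural numbers and which root are chosen below.
\<close>

definition is_van_lint_schrijver :: "'a set \<Rightarrow> 'a set set \<Rightarrow> bool" where
  "is_van_lint_schrijver P L \<longleftrightarrow>
    (\<exists>(F :: nat ring) \<gamma>. field F \<and> order F = 81 \<and> primitive_fifth_root F \<gamma> \<and>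
      geometry_iso P L (carrier F) (vLS_lines F \<gamma>) \<noteq> {})"

end

theory Submission
  imports Defs "HOL-Number_Theory.Number_Theory" "HOL-Algebra.Sylow"
    "Jordan_Normal_Form.Schur_Decomposition"
begin

text \<open>
  Fix a point \<open>o'\<close> and let \<open>T g\<close> be the number of lines through \<open>o'\<close> and \<open>g o'\<close>, for \<open>g\<close> in the
  Singer group. As an element of the integral group ring, \<open>T\<close> is the adjacency operator of the
  collinearity graph plus \<open>t + 1\<close>; counting pairs of intersecting lines shows that it is
  quadratic, \<open>T * T = \<Delta> T + c\<close> with \<open>\<Delta> = s + t + 1 - \<alpha>\<close> and \<open>c = \<alpha> (t + 1)\<close>, where \<open>c\<close> stands for \<open>c\<close>
  times the sum of all group elements. The theorem comes out of this equation as follows.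

  The main tool is the Frobenius congruence: modulo a prime \<open>p\<close>, the \<open>p\<close>-th power of an element
  of a commutative group ring is its image under \<open>x \<mapsto> x ^ p\<close> (\<open>conv_power_prime_cong\<close>). If \<open>p\<close> does
  not divide the group order, that map is a permutation, so the group ring modulo \<open>p\<close> has no
  nilpotents, and a solution of the quadratic equation with \<open>p ^ a\<close> dividing \<open>\<Delta>\<close> is constant modulo
  \<open>p ^ a\<close> (\<open>conv_quadratic_cong\<close>). If \<open>p\<close> divides the group order, the map is not onto, and the equation
  forces \<open>p\<close> to divide \<open>\<Delta>\<close> (\<open>prime_dvd_order_imp_dvd\<close>). Hence the number of points \<open>v\<close> and \<open>\<Delta>\<close> have the same
  prime divisors. Moreover \<open>T\<close> minus a constant is a multiple of an idempotent, whose trace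
  is an integer (\<open>idempotent_trace_dvd\<close>).

  Rigidity says that all orbits on lines have length \<open>v\<close>, so \<open>t + 1 = n (s + 1)\<close> for some \<open>n\<close>. With
  \<open>u = s + 1\<close> and \<open>w = s - \<alpha>\<close>, equality of the prime divisors and integrality of the trace give
  \<open>\<Delta> = n u + w\<close> dividing \<open>u w\<close>. Writing out the common factors turns this into a parametrisation
  with so few values below the bound that they can be checked one by one; twelve triples
  \<open>(u, w, n)\<close> are left (\<open>possible_parameters\<close>).

  Eight of them are excluded by dividing out a Sylow subgroup for a suitable prime \<open>q\<close>: the image of
  \<open>T\<close> is congruent to a constant modulo the \<open>q\<close>-part of \<open>\<Delta>\<close>, while its sum and the sum of its
  squares are known, and these requirements contradict each other (\<open>sylow_quotient_inequality\<close>).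
  Of the four others, three have the numbers of points named in the theorem.

  The last one is \<open>pg(5,5,2)\<close> on 81 points. Here the lines are the translates of one set \<open>D\<close> of six group
  elements. Since 2 does not divide 81, \<open>T\<close> is invariant under squaring, which forces \<open>b ^ 3 d ^ (-2)\<close> into
  \<open>D\<close> for \<open>b\<close>, \<open>d\<close> in \<open>D\<close>, and then the group to have exponent 3. As an affine subset of the
  4-dimensional space over the field with three elements, \<open>D\<close> satisfies just one affine
  relation, and the condition \<open>\<alpha> = 2\<close> rules out everything but the vanishing of the sum of its
  elements (\<open>exponents_all_congruent\<close>). The set consisting of 0 and the fifth roots of unity
  in the field with 81 elements satisfies that relation too, so an affine map identifies the two.
\<close>

hide_const (open) Polynomial.order
hide_fact (open) Polynomial.order_def

section \<open>Powers in the group ring modulo a prime\<close>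

lemma funpow_period:
  assumes "(r ^^ q) x = x" shows "(r ^^ (q * k)) x = x"
  using assms by (induction k) (auto simp: funpow_add)

lemma funpow_coprime_fixed:
  assumes "(r ^^ a) x = x" "(r ^^ b) x = x" "coprime a b"
  shows "r x = x"
proof (cases "a = 0")
  case True
  with assms show ?thesis by simp
next
  case False
  obtain i j where "a * i = b * j + 1"
    using bezout_nat[OF False, of b] assms(3) by auto
  then have "(r ^^ (a * i)) x = r ((r ^^ (b * j)) x)"
    by simp
  then show ?thesis
    using funpow_period[OF assms(1)] funpow_period[OF assms(2)] by metis
qed

text \<open>An orbit of a map of prime order \<open>q\<close> is a fixed point or has \<open>q\<close> elements, and in the latter case it contributes a
  multiple of \<open>q\<close>.\<close>
lemma sum_invariant_cong_fixed_points:
  fixes w :: "'b \<Rightarrow> int"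
  assumes "finite X" "prime q" "\<And>x. x \<in> X \<Longrightarrow> r x \<in> X"
    and "\<And>x. x \<in> X \<Longrightarrow> (r ^^ q) x = x" "\<And>x. x \<in> X \<Longrightarrow> w (r x) = w x"
  shows "[sum w X = sum w {x\<in>X. r x = x}] (mod int q)"
  using assms
proof (induction "card X" arbitrary: X rule: less_induct)
  case less
  show ?case
  proof (cases "\<forall>x\<in>X. r x = x")
    case True
    then have "{x\<in>X. r x = x} = X" by auto
    then show ?thesis by simp
  next
    case False
    then obtain x where x: "x \<in> X" "r x \<noteq> x" by blast
    have q0: "q > 0" using less.prems prime_gt_0_nat by blast
    define O' where "O' = (\<lambda>i. (r ^^ i) x) ` {..<q}"
    have comp: "(r ^^ i) ((r ^^ j) y) = (r ^^ (i + j)) y" for i j y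
      by (simp add: funpow_add)
    have powX: "(r ^^ i) x \<in> X" for i
      by (induction i) (auto simp: x less.prems)
    have mod: "(r ^^ i) x = (r ^^ (i mod q)) x" for i
    proof -
      have "(r ^^ i) x = (r ^^ (i mod q + q * (i div q))) x" by simp
      also have "\<dots> = (r ^^ (i mod q)) ((r ^^ (q * (i div q))) x)" by (simp only: funpow_add o_apply)
      finally show ?thesis using funpow_period[OF less.prems(4)[OF x(1)]] by simp
    qed
    have inO: "(r ^^ i) x \<in> O'" for i
      using mod[of i] q0 unfolding O'_def by auto
    have inj: "inj_on (\<lambda>i. (r ^^ i) x) {..<q}"
    proof (rule linorder_inj_onI)
      fix i j assume ij: "i < j" "i \<in> {..<q}" "j \<in> {..<q}"
      show "(r ^^ i) x \<noteq> (r ^^ j) x"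
      proof
        assume "(r ^^ i) x = (r ^^ j) x"
        then have "(r ^^ (q - i)) ((r ^^ i) x) = (r ^^ (q - i)) ((r ^^ j) x)" by simp
        moreover have "q - i + j = j - i + q" using ij by auto
        ultimately have "(r ^^ q) x = (r ^^ (j - i + q)) x"
          using ij by (simp add: comp)
        then have "x = (r ^^ (j - i)) x"
          using less.prems(4)[OF x(1)] by (simp flip: comp)
        moreover have "coprime (j - i) q"
        proof -
          have "\<not> q dvd j - i" using ij by (auto dest!: dvd_imp_le)
          then show ?thesis using less.prems(2) prime_imp_coprime coprime_commute by blast
        qed
        ultimately show False
          using funpow_coprime_fixed[of "j - i" r x q] less.prems(4)[OF x(1)] x(2) by simp
      qed
    qed auto
    have OX: "O' \<subseteq> X" using powX by (auto simp: O'_def)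
    have wO: "w y = w x" if "y \<in> O'" for y
    proof -
      have "w ((r ^^ i) x) = w x" for i
        by (induction i) (auto simp: less.prems(5)[OF powX])
      then show ?thesis using that by (auto simp: O'_def)
    qed
    have nofix: "r y \<noteq> y" if y: "y \<in> O'" for y
    proof
      assume fx: "r y = y"
      obtain i where i: "i < q" "y = (r ^^ i) x" using y by (auto simp: O'_def)
      have "(r ^^ k) y = y" for k by (induction k) (auto simp: fx)
      then have "y = (r ^^ (q - i)) ((r ^^ i) x)" using i by simp
      also have "\<dots> = (r ^^ q) x" using i by (simp add: comp)
      finally show False using fx less.prems(4)[OF x(1)] x(2) by simp
    qed
    have pre: "y \<in> O'" if yX: "y \<in> X" and ry: "r y \<in> O'" for y
    proof -
      obtain i where i: "r y = (r ^^ i) x" using ry by (auto simp: O'_def)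
      have "y = (r ^^ (q - 1)) (r y)"
        using less.prems(4)[OF yX] q0 comp[of "q - 1" 1 y] by simp
      also have "\<dots> = (r ^^ (q - 1 + i)) x" by (simp add: i comp)
      finally show ?thesis using inO by simp
    qed
    define X' where "X' = X - O'"
    have fX: "finite X" by (fact less.prems)
    have "card X' < card X"
      using x inO[of 0] fX by (intro psubset_card_mono) (auto simp: X'_def)
    then have IH: "[sum w X' = sum w {x\<in>X'. r x = x}] (mod int q)"
      by (rule less.hyps) (use less.prems pre in \<open>auto simp: X'_def\<close>)
    have "sum w X = sum w X' + sum w O'"
      using OX fX by (metis X'_def sum.subset_diff)
    moreover have "sum w O' = int q * w x"
      using wO inj by (simp add: O'_def card_image)
    moreover have "{x\<in>X'. r x = x} = {x\<in>X. r x = x}"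
      using nofix by (auto simp: X'_def)
    ultimately show ?thesis
      using IH by (simp add: cong_def)
  qed
qed

text \<open>Elements of the integral group ring are represented by their coefficient functions; only the values on the
  carrier matter.\<close>
definition (in group) conv :: "('a \<Rightarrow> int) \<Rightarrow> ('a \<Rightarrow> int) \<Rightarrow> 'a \<Rightarrow> int" where
  "conv F H z = (\<Sum>x\<in>carrier G. F x * H (inv x \<otimes> z))"

definition (in monoid) lprod :: "'a list \<Rightarrow> 'a" where
  "lprod xs = foldr (\<otimes>) xs \<one>"

definition (in group) lists_with_product :: "nat \<Rightarrow> 'a \<Rightarrow> 'a list set" where
  "lists_with_product n z = {xs. set xs \<subseteq> carrier G \<and> length xs = n \<and> lprod xs = z}"

text \<open>The coefficients of the \<open>n\<close>-th power in the group ring, written out as a sum over lists so that the cyclic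
  rotation of factors can act on them.\<close>
definition (in group) conv_power :: "('a \<Rightarrow> int) \<Rightarrow> nat \<Rightarrow> 'a \<Rightarrow> int" where
  "conv_power F n z = (\<Sum>xs\<in>lists_with_product n z. prod_list (map F xs))"

context group begin

lemma lprod_simps [simp]: "lprod [] = \<one>" "lprod (x # xs) = x \<otimes> lprod xs"
  by (simp_all add: lprod_def)

lemma lprod_closed [simp, intro]: "set xs \<subseteq> carrier G \<Longrightarrow> lprod xs \<in> carrier G"
  by (induction xs) auto

lemma lprod_append:
  "set xs \<subseteq> carrier G \<Longrightarrow> set ys \<subseteq> carrier G \<Longrightarrow> lprod (xs @ ys) = lprod xs \<otimes> lprod ys"
  by (induction xs) (auto simp: m_assoc)

lemma lprod_replicate: "x \<in> carrier G \<Longrightarrow> lprod (replicate n x) = x [^] n"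
  by (induction n) (simp_all add: nat_pow_Suc2[symmetric] del: nat_pow_Suc)

lemma finite_lists_with_product: "finite (carrier G) \<Longrightarrow> finite (lists_with_product n z)"
  unfolding lists_with_product_def
  by (rule finite_subset[OF _ finite_lists_length_eq[of "carrier G" n]]) auto

lemma conv_power_1: "z \<in> carrier G \<Longrightarrow> conv_power F (Suc 0) z = F z"
proof -
  assume z: "z \<in> carrier G"
  have "lists_with_product (Suc 0) z = {[z]}"
    using z by (auto simp: lists_with_product_def length_Suc_conv)
  then show ?thesis by (simp add: conv_power_def)
qed

lemma conv_power_Suc:
  assumes "finite (carrier G)" "z \<in> carrier G"
  shows "conv_power F (Suc n) z = conv F (conv_power F n) z"
proof -
  have eq: "lists_with_product (Suc n) z =
      (\<lambda>(x, xs). x # xs) ` (SIGMA x:carrier G. lists_with_product n (inv x \<otimes> z))"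
    (is "?A = ?f ` ?B")
  proof
    show "?f ` ?B \<subseteq> ?A"
      using assms by (auto simp: lists_with_product_def m_assoc[symmetric])
    show "?A \<subseteq> ?f ` ?B"
    proof
      fix xs assume "xs \<in> ?A"
      then obtain y ys where y: "xs = y # ys" "y \<in> carrier G" "set ys \<subseteq> carrier G" "length ys = n"
        "y \<otimes> lprod ys = z"
        by (auto simp: lists_with_product_def length_Suc_conv)
      then have "lprod ys = inv y \<otimes> z"
        using assms by (auto simp: m_assoc[symmetric])
      then show "xs \<in> ?f ` ?B" using y
        by (auto simp: lists_with_product_def intro!: image_eqI[of _ _ "(y, ys)"])
    qed
  qed
  have "conv_power F (Suc n) z = (\<Sum>(x, xs)\<in>?B. F x * prod_list (map F xs))"
    unfolding conv_power_def eq
    by (subst sum.reindex) (auto simp: inj_on_def case_prod_unfold intro!: sum.cong)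
  also have "\<dots> = conv F (conv_power F n) z"
    using assms finite_lists_with_product
    by (subst sum.Sigma[symmetric]) (auto simp: conv_def conv_power_def sum_distrib_left)
  finally show ?thesis .
qed

end

lemma int_fermat:
  assumes "prime p" shows "[(a::int) ^ p = a] (mod int p)"
proof (cases "int p dvd a")
  case True
  moreover have "int p dvd a ^ p" using True assms
    by (meson dvd_power dvd_trans prime_gt_0_nat)
  ultimately show ?thesis by (simp add: cong_iff_dvd_diff)
next
  case False
  have p0: "p > 0" using assms prime_gt_0_nat by blast
  define b where "b = nat (a mod int p)"
  have b: "[a = int b] (mod int p)" using p0 by (simp add: b_def cong_def)
  have "\<not> p dvd b" using False b
    by (metis cong_dvd_iff int_dvd_int_iff)
  then have "[b ^ (p - 1) = 1] (mod p)" using fermat_theorem assms by blast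
  then have "[b ^ (p - 1) * b = 1 * b] (mod p)" by (rule cong_scalar_right)
  then have "[b ^ p = b] (mod p)"
    using p0 by (simp add: power_eq_if mult.commute)
  then have "[int b ^ p = int b] (mod int p)"
    by (metis cong_int_iff of_nat_power)
  then show ?thesis using b
    by (meson cong_pow cong_sym cong_trans)
qed

context comm_group begin

text \<open>The Frobenius congruence. Rotating a list does not change its product in a commutative group, so modulo \<open>p\<close> only the
  constant lists count; the exponents on the coefficients disappear by Fermat's little theorem.\<close>
lemma conv_power_prime_cong:
  assumes fin: "finite (carrier G)" and p: "prime p" and z: "z \<in> carrier G"
  shows "[conv_power F p z = (\<Sum>x | x \<in> carrier G \<and> x [^] p = z. F x)] (mod int p)"
proof -
  let ?X = "lists_with_product p z"
  have p0: "p > 0" using p prime_gt_0_nat by blast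
  have rot: "rotate1 xs \<in> ?X" if "xs \<in> ?X" for xs
  proof (cases xs)
    case (Cons y ys)
    then show ?thesis using that
      by (auto simp: lists_with_product_def lprod_append m_comm)
  qed (use that in simp)
  have "[conv_power F p z = (\<Sum>xs\<in>{xs\<in>?X. rotate1 xs = xs}. prod_list (map F xs))] (mod int p)"
    unfolding conv_power_def
  proof (rule sum_invariant_cong_fixed_points)
    show "(rotate1 ^^ p) x = x" if "x \<in> ?X" for x
      using that rotate_id[of p x] by (auto simp: lists_with_product_def rotate_def)
    show "prod_list (map F (rotate1 x)) = prod_list (map F x)" for x
      by (cases x) simp_all
  qed (use fin p rot finite_lists_with_product in auto)
  also have "{xs\<in>?X. rotate1 xs = xs} = replicate p ` {x \<in> carrier G. x [^] p = z}"
  proof (intro equalityI subsetI)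
    fix xs assume xs: "xs \<in> {xs\<in>?X. rotate1 xs = xs}"
    then have "xs \<noteq> []" using p0 by (auto simp: lists_with_product_def)
    then have "card (set xs) = 1" using xs rotate1_fixpoint_card by auto
    then obtain x where "set xs = {x}" by (auto simp: card_1_singleton_iff)
    then have "xs = replicate p x" "x \<in> carrier G" using xs
      using replicate_length_same[of xs x]
      by (auto simp: lists_with_product_def)
    then show "xs \<in> replicate p ` {x \<in> carrier G. x [^] p = z}"
      using xs by (auto simp: lists_with_product_def lprod_replicate)
  next
    fix xs assume "xs \<in> replicate p ` {x \<in> carrier G. x [^] p = z}"
    then show "xs \<in> {xs\<in>?X. rotate1 xs = xs}"
      by (cases p) (auto simp: lists_with_product_def lprod_replicate replicate_append_same m_comm)
  qed
  also have "(\<Sum>xs\<in>replicate p ` {x \<in> carrier G. x [^] p = z}. prod_list (map F xs))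
      = (\<Sum>x | x \<in> carrier G \<and> x [^] p = z. F x ^ p)"
    using p0 by (subst sum.reindex) (auto simp: inj_on_def)
  also have "[\<dots> = (\<Sum>x | x \<in> carrier G \<and> x [^] p = z. F x)] (mod int p)"
    by (intro cong_sum int_fermat p)
  finally show ?thesis .
qed

end

section \<open>Quadratic elements of the group ring\<close>

locale finite_comm_group = comm_group +
  assumes fin [simp, intro]: "finite (carrier G)"
begin

lemma order_gt_0' [simp]: "order G > 0"
  using fin by (simp add: order_gt_0_iff_finite)

lemma inv_cancel:
  assumes "a \<in> carrier G" "b \<in> carrier G"
  shows "a \<otimes> (inv a \<otimes> b) = b" "inv a \<otimes> (a \<otimes> b) = b"
  using assms by (simp_all add: m_assoc[symmetric])

lemma sum_translate:
  assumes "a \<in> carrier G"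
  shows "(\<Sum>z\<in>carrier G. f (a \<otimes> z)) = (\<Sum>z\<in>carrier G. f z)"
proof (rule sum.reindex_bij_betw)
  show "bij_betw (\<lambda>z. a \<otimes> z) (carrier G) (carrier G)"
    using assms
    by (intro bij_betwI[where g = "\<lambda>z. inv a \<otimes> z"]) (auto simp: m_assoc[symmetric])
qed

lemma sum_conv: "(\<Sum>z\<in>carrier G. conv F H z) = sum F (carrier G) * sum H (carrier G)"
proof -
  have "(\<Sum>z\<in>carrier G. conv F H z) = (\<Sum>x\<in>carrier G. \<Sum>z\<in>carrier G. F x * H (inv x \<otimes> z))"
    unfolding conv_def by (rule sum.swap)
  also have "\<dots> = (\<Sum>x\<in>carrier G. F x * sum H (carrier G))"
    by (intro sum.cong refl) (simp add: sum_distrib_left[symmetric] sum_translate)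
  finally show ?thesis by (simp add: sum_distrib_right)
qed

lemma conv_cong:
  assumes "\<And>x. x \<in> carrier G \<Longrightarrow> F x = F' x" "\<And>x. x \<in> carrier G \<Longrightarrow> H x = H' x" "z \<in> carrier G"
  shows "conv F H z = conv F' H' z"
  unfolding conv_def using assms by (intro sum.cong) auto

lemma conv_affine_right:
  assumes "z \<in> carrier G"
  shows "conv F (\<lambda>x. a * H x + b) z = a * conv F H z + b * sum F (carrier G)"
  by (simp add: conv_def algebra_simps sum.distrib sum_distrib_left)

lemma conv_affine:
  assumes "z \<in> carrier G"
  shows "conv (\<lambda>x. a * F x + b) (\<lambda>x. a * F x + b) z
    = a\<^sup>2 * conv F F z + 2 * a * b * sum F (carrier G) + int (order G) * b\<^sup>2"
proof -
  have "(\<Sum>x\<in>carrier G. F (inv x \<otimes> z)) = sum F (carrier G)"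
  proof (rule sum.reindex_bij_betw)
    show "bij_betw (\<lambda>x. inv x \<otimes> z) (carrier G) (carrier G)"
      using assms
      by (intro bij_betwI[where g = "\<lambda>y. z \<otimes> inv y"])
         (auto simp: inv_mult_group m_assoc inv_cancel)
  qed
  then show ?thesis
    by (simp add: conv_def algebra_simps sum.distrib sum_distrib_left[symmetric] order_def
        power2_eq_square)
qed

lemma conv_power_quadratic:
  assumes "\<And>z. z \<in> carrier G \<Longrightarrow> conv F F z = m * F z + c"
  obtains d where "\<And>z. z \<in> carrier G \<Longrightarrow> conv_power F (Suc n) z = m ^ n * F z + d"
    and "c = 0 \<Longrightarrow> d = 0"
proof -
  have "\<exists>d. (\<forall>z\<in>carrier G. conv_power F (Suc n) z = m ^ n * F z + d) \<and> (c = 0 \<longrightarrow> d = 0)"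
  proof (induction n)
    case 0
    then show ?case by (intro exI[of _ 0]) (auto simp: conv_power_1)
  next
    case (Suc n)
    then obtain d where d: "\<And>z. z \<in> carrier G \<Longrightarrow> conv_power F (Suc n) z = m ^ n * F z + d"
      and d0: "c = 0 \<Longrightarrow> d = 0" by auto
    have "conv_power F (Suc (Suc n)) z = m ^ Suc n * F z + (m ^ n * c + d * sum F (carrier G))"
      if z: "z \<in> carrier G" for z
    proof -
      have "conv_power F (Suc (Suc n)) z = conv F (\<lambda>x. m ^ n * F x + d) z"
        unfolding conv_power_Suc[OF fin z] by (rule conv_cong) (use d z in auto)
      then show ?thesis
        unfolding conv_affine_right[OF z] assms[OF z] by (simp add: algebra_simps)
    qed
    then show ?case using d0 by auto
  qed
  then show ?thesis using that by blast
qed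

lemma pow_inj_on_coprime:
  assumes "coprime q (order G)"
  shows "inj_on (\<lambda>x. x [^] (q::nat)) (carrier G)"
proof (rule inj_onI)
  fix x y assume xy: "x \<in> carrier G" "y \<in> carrier G" "x [^] q = y [^] q"
  then have "(x \<otimes> inv y) [^] q = \<one>"
    by (simp add: nat_pow_distrib nat_pow_inv)
  then have "ord (x \<otimes> inv y) dvd q" using xy by (simp add: pow_eq_id)
  moreover have "ord (x \<otimes> inv y) dvd order G" using xy by (simp add: ord_dvd_group_order)
  ultimately have "ord (x \<otimes> inv y) = 1" using assms
    by (meson coprime_def nat_dvd_1_iff_1 coprime_common_divisor_nat)
  then have "x \<otimes> inv y = \<one>" using xy pow_ord_eq_1[of "x \<otimes> inv y"] by simp
  then show "x = y" using xy by (metis inv_closed inv_equality inv_inv)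
qed

text \<open>The group ring modulo \<open>q\<close> is reduced, because raising to the power \<open>q\<close> permutes the group: from \<open>F * F = m F\<close> with
  \<open>q\<close> dividing \<open>m\<close> the Frobenius congruence gives that \<open>q\<close> divides \<open>F\<close>. Dividing \<open>F\<close> and \<open>m\<close> by \<open>q\<close> preserves the
  equation, so the argument can be repeated.\<close>
lemma conv_idempotent_dvd:
  assumes q: "prime q" "\<not> q dvd order G" and m: "int q ^ a dvd m"
    and F: "\<And>z. z \<in> carrier G \<Longrightarrow> conv F F z = m * F z" and z: "z \<in> carrier G"
  shows "int q ^ a dvd F z"
  using m F z
proof (induction a arbitrary: F m z)
  case 0
  then show ?case by simp
next
  case (Suc a)
  have q1: "q > 1" using q prime_gt_1_nat by blast
  have qm: "int q dvd m" using Suc.prems(1) by (metis dvd_trans dvd_triv_left power_Suc)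
  have dvd: "int q dvd F z" if z: "z \<in> carrier G" for z
  proof -
    obtain d where d: "\<And>z. z \<in> carrier G \<Longrightarrow> conv_power F (Suc (q - 1)) z = m ^ (q - 1) * F z + d"
      "(0::int) = 0 \<Longrightarrow> d = 0"
      using conv_power_quadratic[of F m 0 "q - 1"] Suc.prems(2) by auto
    have "conv_power F q (z [^] q) = m ^ (q - 1) * F (z [^] q)"
      using d z q1 by simp
    moreover have "int q dvd m ^ (q - 1)"
      using qm q1 by (meson dvd_power dvd_trans zero_less_diff)
    ultimately have "int q dvd conv_power F q (z [^] q)" by simp
    moreover have "[conv_power F q (z [^] q) = (\<Sum>x | x \<in> carrier G \<and> x [^] q = z [^] q. F x)] (mod int q)"
      using conv_power_prime_cong q z by simp
    moreover have "{x. x \<in> carrier G \<and> x [^] q = z [^] q} = {z}"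
      using z pow_inj_on_coprime[of q] q prime_imp_coprime by (auto simp: inj_on_def)
    ultimately show ?thesis by (simp add: cong_dvd_iff)
  qed
  define F1 where "F1 x = F x div int q" for x
  have F1: "F x = int q * F1 x" if "x \<in> carrier G" for x
    using dvd[OF that] by (simp add: F1_def)
  obtain m' where m': "m = int q * m'" using qm by blast
  have "conv F1 F1 x = m' * F1 x" if x: "x \<in> carrier G" for x
  proof -
    have "(int q)\<^sup>2 * conv F1 F1 x = conv F F x"
      using conv_affine[OF x, of "int q" F1 0] conv_cong[of F "\<lambda>x. int q * F1 x + 0" F _ x] F1 x
      by simp
    also have "\<dots> = (int q)\<^sup>2 * (m' * F1 x)"
      using Suc.prems(2)[OF x] F1[OF x] m' by (simp add: power2_eq_square)
    finally show ?thesis using q1 by simp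
  qed
  moreover have "int q ^ a dvd m'" using Suc.prems(1) m' q1 by simp
  ultimately have "int q ^ a dvd F1 z" using Suc.IH Suc.prems(3) by blast
  then show ?case using F1[OF Suc.prems(3)] by simp
qed

lemma conv_quadratic_sum:
  assumes "\<And>z. z \<in> carrier G \<Longrightarrow> conv F F z = m * F z + c"
  shows "(sum F (carrier G))\<^sup>2 = m * sum F (carrier G) + int (order G) * c"
proof -
  have "(sum F (carrier G))\<^sup>2 = (\<Sum>z\<in>carrier G. m * F z + c)"
    using sum_conv[of F F] assms by (simp add: power2_eq_square)
  then show ?thesis by (simp add: sum.distrib sum_distrib_left order_def)
qed

text \<open>A solution of the quadratic equation becomes a multiple of an idempotent when its component along the sum of all
  group elements is removed; the factor \<open>order G\<close> keeps the coefficients integral.\<close>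
lemma conv_sum_zero_part:
  fixes F :: "'a \<Rightarrow> int"
  assumes F: "\<And>z. z \<in> carrier G \<Longrightarrow> conv F F z = m * F z + c" and z: "z \<in> carrier G"
  defines "E \<equiv> (\<lambda>x. int (order G) * F x - sum F (carrier G))"
  shows "conv E E z = (int (order G) * m) * E z"
proof -
  let ?v = "int (order G)" and ?s = "sum F (carrier G)"
  have "conv E E z = ?v\<^sup>2 * conv F F z + 2 * ?v * (- ?s) * ?s + ?v * (- ?s)\<^sup>2"
    using conv_affine[OF z, of ?v F "- ?s"] by (simp add: E_def)
  also have "\<dots> = ?v\<^sup>2 * m * F z + ?v * (?v * c) - ?v * ?s\<^sup>2"
    by (simp add: F[OF z] algebra_simps power2_eq_square)
  also have "\<dots> = ?v * m * E z"
    using conv_quadratic_sum[OF F] by (simp add: E_def algebra_simps power2_eq_square)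
  finally show ?thesis .
qed

lemma conv_quadratic_cong:
  assumes q: "prime q" "\<not> q dvd order G" and m: "int q ^ a dvd m"
    and F: "\<And>z. z \<in> carrier G \<Longrightarrow> conv F F z = m * F z + c"
    and x: "x \<in> carrier G" and y: "y \<in> carrier G"
  shows "int q ^ a dvd F x - F y"
proof -
  let ?v = "int (order G)" and ?s = "sum F (carrier G)"
  have *: "int q ^ a dvd ?v * F z - ?s" if z: "z \<in> carrier G" for z
    by (rule conv_idempotent_dvd[OF q, where m = "?v * m"])
       (use m z conv_sum_zero_part[OF F] in auto)
  have "int q ^ a dvd (?v * F x - ?s) - (?v * F y - ?s)"
    by (intro dvd_diff * x y)
  then have "int q ^ a dvd ?v * (F x - F y)" by (simp add: algebra_simps)
  moreover have "coprime (int q ^ a) ?v"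
    using q by (simp add: prime_imp_coprime)
  ultimately show ?thesis by (simp add: coprime_dvd_mult_right_iff)
qed

lemma exists_prime_order:
  assumes "prime p" "p dvd order G"
  shows "\<exists>x\<in>carrier G. x \<noteq> \<one> \<and> x [^] p = \<one>"
proof -
  obtain k where "order G = p ^ 1 * k" using assms by auto
  then obtain H where H: "subgroup H G" "card H = p"
    using sylow_thm[OF assms(1) is_group, of 1 k] fin by auto
  have "p > 1" using assms prime_gt_1_nat by blast
  then obtain x where x: "x \<in> H" "x \<noteq> \<one>"
  proof -
    have "H \<noteq> {\<one>}" using H \<open>p > 1\<close> by auto
    then show ?thesis using that subgroup.one_closed[OF H(1)] by blast
  qed
  interpret K: group "G\<lparr>carrier := H\<rparr>" using H by (simp add: subgroup.subgroup_is_group)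
  have "x [^]\<^bsub>G\<lparr>carrier := H\<rparr>\<^esub> order (G\<lparr>carrier := H\<rparr>) = \<one>"
    using K.pow_order_eq_1[of x] x by simp
  then have "x [^] p = \<one>"
    using H by (simp add: order_def nat_pow_consistent[symmetric])
  moreover have "x \<in> carrier G" using subgroup.subset[OF H(1)] x by blast
  ultimately show ?thesis using x by blast
qed

abbreviation pow_image :: "nat \<Rightarrow> 'a set" where
  "pow_image m \<equiv> (\<lambda>x. x [^] m) ` carrier G"

lemma subgroup_pow_image: "subgroup (pow_image m) G"
proof (unfold_locales)
  fix x y assume "x \<in> pow_image m" "y \<in> pow_image m"
  then show "x \<otimes> y \<in> pow_image m"
    by (auto simp: nat_pow_distrib[symmetric])
next
  show "\<one> \<in> pow_image m" by (auto intro!: image_eqI[of _ _ \<one>])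
next
  fix x assume "x \<in> pow_image m"
  then obtain y where y: "y \<in> carrier G" "x = y [^] m" by blast
  then have "inv x = inv y [^] m" by (simp add: nat_pow_inv)
  then show "inv x \<in> pow_image m" using y by blast
qed auto

lemma conv_supported_subgroup:
  assumes H: "subgroup H G" and z: "z \<in> carrier G" "z \<notin> H"
    and F: "\<And>x. x \<in> carrier G \<Longrightarrow> x \<notin> H \<Longrightarrow> F x = 0"
  shows "conv F F z = 0"
  unfolding conv_def
proof (rule sum.neutral, rule ballI)
  fix x assume x: "x \<in> carrier G"
  show "F x * F (inv x \<otimes> z) = 0"
  proof (cases "x \<in> H")
    case True
    have "inv x \<otimes> z \<notin> H"
    proof
      assume "inv x \<otimes> z \<in> H"
      then have "x \<otimes> (inv x \<otimes> z) \<in> H" using True H by (simp add: subgroup.m_closed)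
      then show False using x z by (simp add: m_assoc[symmetric])
    qed
    then show ?thesis using F x z by simp
  qed (use F x in simp)
qed

text \<open>If \<open>p\<close> did not divide \<open>m\<close>, the Frobenius congruence would make \<open>F\<close> constant, equal to 0 or 1, outside the proper subgroup
  of \<open>p\<close>-th powers. Then \<open>F\<close> or \<open>1 - F\<close> would be supported on that subgroup, and so would its square. But both satisfy
  a quadratic equation with a nonzero constant term; for \<open>1 - F\<close> this term is the second constant assumed not to vanish.\<close>
lemma prime_dvd_order_imp_dvd:
  assumes p: "prime p" "p dvd order G"
    and F: "\<And>z. z \<in> carrier G \<Longrightarrow> conv F F z = m * F z + c"
    and F01: "\<And>z. z \<in> carrier G \<Longrightarrow> z \<noteq> \<one> \<Longrightarrow> F z \<in> {0, 1}"
    and c: "c \<noteq> 0" "int (order G) - 2 * sum F (carrier G) + c + m \<noteq> 0"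
  shows "int p dvd m"
proof (rule ccontr)
  assume npm: "\<not> int p dvd m"
  let ?H = "pow_image p"
  have p1: "p > 1" using p prime_gt_1_nat by blast
  have one_H: "\<one> \<in> ?H" by (rule subgroup.one_closed[OF subgroup_pow_image])
  obtain x where x: "x \<in> carrier G" "x \<noteq> \<one>" "x [^] p = \<one>"
    using exists_prime_order p by blast
  have "\<not> inj_on (\<lambda>x. x [^] p) (carrier G)"
    using x inj_onD[of "\<lambda>x. x [^] p" "carrier G" x \<one>] by auto
  then have "?H \<noteq> carrier G" using fin eq_card_imp_inj_on by metis
  then obtain z0 where z0: "z0 \<in> carrier G" "z0 \<notin> ?H" by auto
  obtain d where d: "\<And>z. z \<in> carrier G \<Longrightarrow> conv_power F (Suc (p - 1)) z = m ^ (p - 1) * F z + d"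
    using conv_power_quadratic[OF F] by metis
  have off: "int p dvd m ^ (p - 1) * F z + d" if z: "z \<in> carrier G" "z \<notin> ?H" for z
  proof -
    have "{x. x \<in> carrier G \<and> x [^] p = z} = {}" using z by auto
    then have "(\<Sum>x | x \<in> carrier G \<and> x [^] p = z. F x) = 0" by (metis sum.empty)
    then have "[conv_power F p z = 0] (mod int p)"
      using conv_power_prime_cong[OF fin p(1) z(1), of F] by simp
    then show ?thesis using d[OF z(1)] p1 by (simp add: cong_0_iff)
  qed
  have const: "F z = F z0" if z: "z \<in> carrier G" "z \<notin> ?H" for z
  proof -
    have "int p dvd (m ^ (p - 1) * F z + d) - (m ^ (p - 1) * F z0 + d)"
      by (intro dvd_diff off z z0)
    then have "int p dvd m ^ (p - 1) * (F z - F z0)" by (simp add: algebra_simps)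
    moreover have "coprime (int p) (m ^ (p - 1))"
      using npm p by (simp add: prime_imp_coprime)
    ultimately have "int p dvd F z - F z0" by (simp add: coprime_dvd_mult_right_iff)
    moreover have "F z \<in> {0, 1}" "F z0 \<in> {0, 1}"
      using z z0 F01 one_H by blast+
    ultimately show ?thesis using p1 by (auto simp: zdvd_not_zless)
  qed
  have "F z0 \<in> {0, 1}"
    using z0 F01 one_H by blast
  then show False
  proof (elim insertE emptyE)
    assume "F z0 = 0"
    then have "conv F F z0 = 0"
      using conv_supported_subgroup[OF subgroup_pow_image z0, of F] const by simp
    with \<open>F z0 = 0\<close> show False using F[OF z0(1)] c by simp
  next
    assume 1: "F z0 = 1"
    have "conv (\<lambda>x. (-1) * F x + 1) (\<lambda>x. (-1) * F x + 1) z0 = 0"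
      by (rule conv_supported_subgroup[OF subgroup_pow_image z0]) (use const 1 in simp)
    then show False
      unfolding conv_affine[OF z0(1)] using F[OF z0(1)] c 1 by simp
  qed
qed

end

section \<open>Quotients by Sylow subgroups\<close>

context finite_comm_group begin

text \<open>The image under the group endomorphism \<open>x \<mapsto> x ^ m\<close>. Power maps serve as quotient maps: when \<open>m\<close> is the full power of \<open>q\<close>
  dividing the order, the kernel is the Sylow subgroup for \<open>q\<close> and the image is isomorphic to the quotient by it.\<close>
definition push :: "nat \<Rightarrow> ('a \<Rightarrow> int) \<Rightarrow> 'a \<Rightarrow> int" where
  "push m F h = (\<Sum>x | x \<in> carrier G \<and> x [^] m = h. F x)"

abbreviation pow_group :: "nat \<Rightarrow> ('a, 'b) monoid_scheme" where
  "pow_group m \<equiv> G\<lparr>carrier := pow_image m\<rparr>"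

lemma finite_comm_group_subgroup:
  assumes "subgroup H G"
  shows "finite_comm_group (G\<lparr>carrier := H\<rparr>)"
proof -
  interpret H: group "G\<lparr>carrier := H\<rparr>" using assms by (rule subgroup_imp_group)
  have "H \<subseteq> carrier G" using assms by (rule subgroup.subset)
  then have "comm_group (G\<lparr>carrier := H\<rparr>)"
    by (intro H.group_comm_groupI) (auto intro!: m_comm)
  then show ?thesis using finite_subset[OF \<open>H \<subseteq> carrier G\<close>]
    by (simp add: finite_comm_group_def finite_comm_group_axioms_def)
qed

lemma finite_comm_group_pow_group: "finite_comm_group (pow_group m)"
  by (rule finite_comm_group_subgroup[OF subgroup_pow_image])

lemma sum_push: "sum (push m F) (pow_image m) = sum F (carrier G)"
  unfolding push_def using sum.image_gen[OF fin, of F "\<lambda>x. x [^] m"] by simp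

lemma push_conv:
  assumes h: "h \<in> pow_image m"
  shows "group.conv (pow_group m) (push m F) (push m H) h = push m (conv F H) h"
proof -
  interpret K: finite_comm_group "pow_group m" by (rule finite_comm_group_pow_group)
  have hG: "h \<in> carrier G" using h by auto
  have inv: "inv\<^bsub>pow_group m\<^esub> y = inv y" if "y \<in> pow_image m" for y
    using m_inv_consistent[OF subgroup_pow_image that] by simp
  have "push m (conv F H) h
      = (\<Sum>x\<in>carrier G. \<Sum>z | z \<in> carrier G \<and> z [^] m = h. F x * H (inv x \<otimes> z))"
    unfolding push_def conv_def by (rule sum.swap)
  also have "\<dots> = (\<Sum>x\<in>carrier G. F x * push m H (inv (x [^] m) \<otimes> h))"
  proof (rule sum.cong[OF refl])
    fix x assume x: "x \<in> carrier G"
    have "(\<Sum>z | z \<in> carrier G \<and> z [^] m = h. H (inv x \<otimes> z)) = push m H (inv (x [^] m) \<otimes> h)"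
      unfolding push_def
      by (rule sum.reindex_bij_witness[where i = "\<lambda>y. x \<otimes> y" and j = "\<lambda>z. inv x \<otimes> z"])
         (use x hG in \<open>auto simp: inv_cancel nat_pow_distrib nat_pow_inv\<close>)
    then show "(\<Sum>z | z \<in> carrier G \<and> z [^] m = h. F x * H (inv x \<otimes> z))
        = F x * push m H (inv (x [^] m) \<otimes> h)"
      by (simp add: sum_distrib_left[symmetric])
  qed
  also have "\<dots> = (\<Sum>y\<in>pow_image m. \<Sum>x | x \<in> carrier G \<and> x [^] m = y. F x * push m H (inv (x [^] m) \<otimes> h))"
    by (rule sum.image_gen) simp
  also have "\<dots> = (\<Sum>y\<in>pow_image m. push m F y * push m H (inv y \<otimes> h))"
    by (intro sum.cong refl) (auto simp: push_def sum_distrib_right)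
  also have "\<dots> = group.conv (pow_group m) (push m F) (push m H) h"
    unfolding K.conv_def by (intro sum.cong) (auto simp: inv)
  finally show ?thesis by simp
qed

lemma card_pow_fibre:
  assumes "h \<in> pow_image m"
  shows "card {x \<in> carrier G. x [^] m = h} = card {x \<in> carrier G. x [^] m = \<one>}"
proof -
  obtain a where a: "a \<in> carrier G" "h = a [^] m" using assms by auto
  have "bij_betw (\<lambda>x. a \<otimes> x) {x \<in> carrier G. x [^] m = \<one>} {x \<in> carrier G. x [^] m = h}"
    by (rule bij_betwI[where g = "\<lambda>x. inv a \<otimes> x"])
       (use a in \<open>auto simp: inv_cancel nat_pow_distrib nat_pow_inv\<close>)
  from bij_betw_same_card[OF this] show ?thesis by simp
qed

lemma card_pow_image_kernel:
  "order G = card (pow_image m) * card {x \<in> carrier G. x [^] m = \<one>}"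
proof -
  have "order G = (\<Sum>y\<in>pow_image m. card {x \<in> carrier G. x [^] m = y})"
    unfolding order_def card_eq_sum by (rule sum.image_gen) simp
  also have "\<dots> = (\<Sum>y\<in>pow_image m. card {x \<in> carrier G. x [^] m = \<one>})"
    by (rule sum.cong) (auto simp: card_pow_fibre)
  finally show ?thesis by simp
qed

lemma sylow_power_map:
  assumes q: "prime q" "\<not> q dvd k" and ord: "order G = q ^ e * k"
  shows "card (pow_image (q ^ e)) = k"
    and "card {x \<in> carrier G. x [^] (q ^ e) = \<one>} = q ^ e"
proof -
  let ?I = "pow_image (q ^ e)" and ?K = "{x \<in> carrier G. x [^] (q ^ e) = \<one>}"
  have k0: "k > 0" using q by (cases k) auto
  interpret I: finite_comm_group "pow_group (q ^ e)" by (rule finite_comm_group_pow_group)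
  have prod: "card ?I * card ?K = q ^ e * k" using card_pow_image_kernel ord by simp
  have pw: "x [^]\<^bsub>pow_group (q ^ e)\<^esub> n = x [^] n" for x and n :: nat
    by (simp add: nat_pow_consistent[symmetric])
  have K: "subgroup ?K G"
    by unfold_locales (auto simp: nat_pow_distrib nat_pow_inv)
  interpret K: finite_comm_group "G\<lparr>carrier := ?K\<rparr>"
    by (rule finite_comm_group_subgroup[OF K])
  have "\<not> q dvd card ?I"
  proof
    assume "q dvd card ?I"
    then obtain h where h: "h \<in> ?I" "h \<noteq> \<one>" "h [^] q = \<one>"
      using I.exists_prime_order[OF q(1)] by (auto simp: pw order_def)
    obtain x where x: "x \<in> carrier G" "h = x [^] (q ^ e)" using h by auto
    have "ord x dvd q ^ Suc e"
      using x h by (simp add: pow_eq_id[symmetric] nat_pow_pow mult.commute)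
    moreover have "ord x dvd q ^ e * k" using ord_dvd_group_order[OF x(1)] ord by simp
    ultimately have "ord x dvd gcd (q ^ e * q) (q ^ e * k)" by (simp add: mult.commute)
    also have "gcd (q ^ e * q) (q ^ e * k) = q ^ e * gcd q k"
      by (rule gcd_mult_distrib_nat[symmetric])
    also have "gcd q k = 1" using q prime_imp_coprime coprime_iff_gcd_eq_1 by blast
    also have "q ^ e * 1 = q ^ e" by simp
    finally show False using x h by (simp add: pow_eq_id)
  qed
  then have "coprime (card ?I) (q ^ e)"
    using prime_imp_coprime[OF q(1)] coprime_commute by auto
  moreover have "card ?I dvd q ^ e * k" unfolding prod[symmetric] by (rule dvd_triv_left)
  ultimately have Ik: "card ?I dvd k" by (simp add: coprime_dvd_mult_right_iff)
  then obtain j where j: "k = card ?I * j" by blast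
  have I0: "card ?I > 0" using k0 j by (cases "card ?I") auto
  have Kj: "card ?K = q ^ e * j"
  proof -
    have "card ?I * card ?K = card ?I * (q ^ e * j)" using prod j by (simp add: ac_simps)
    with I0 show ?thesis by (simp only: nat_mult_eq_cancel1)
  qed
  have "j = 1"
  proof (rule ccontr)
    assume "j \<noteq> 1"
    then obtain r where r: "prime r" "r dvd j" using prime_factor_nat by blast
    then have "r dvd order (G\<lparr>carrier := ?K\<rparr>)" using Kj by (simp add: order_def)
    then obtain x where x: "x \<in> ?K" "x \<noteq> \<one>" "x [^] r = \<one>"
      using K.exists_prime_order[OF r(1)] by (auto simp: nat_pow_consistent[symmetric])
    have "ord x dvd q ^ e" "ord x dvd r" using x pow_eq_id[of x "q ^ e"] pow_eq_id[of x r] by auto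
    moreover have "coprime (q ^ e) r"
    proof -
      have "\<not> q dvd r" using q r j by (metis dvd_mult dvd_trans)
      then show ?thesis using prime_imp_coprime[OF q(1)] by simp
    qed
    ultimately have "ord x = 1" using coprime_common_divisor_nat by blast
    then show False using x pow_ord_eq_1[of x] by simp
  qed
  then show "card ?I = k" "card ?K = q ^ e" using j Kj by auto
qed

text \<open>Let \<open>N\<close> be the coefficient at the identity of the image of \<open>T\<close> in the quotient by the Sylow subgroup for \<open>q\<close>. The order of
  the quotient is prime to \<open>q\<close>, so all coefficients there are congruent to \<open>N\<close> modulo \<open>q ^ a\<close>. Since no integer lies
  strictly between two consecutive multiples of \<open>q ^ a\<close>, \<open>(x - l) (x - l - q ^ a)\<close> is nonnegative for every coefficient
  \<open>x\<close> whenever \<open>l\<close> is in the same class. Summing over all coefficients but \<open>N\<close> gives a statement about their sum and the sum of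
  their squares, which the equation for \<open>T\<close> determines.\<close>
lemma sylow_quotient_inequality:
  fixes T :: "'a \<Rightarrow> int" and \<tau> \<Delta> c :: int
  assumes q: "prime q" "\<not> q dvd k" and ord: "order G = q ^ e * k" and a: "int q ^ a dvd \<Delta>"
    and T: "\<And>z. z \<in> carrier G \<Longrightarrow> conv T T z = \<Delta> * T z + c"
    and T01: "\<And>z. z \<in> carrier G \<Longrightarrow> z \<noteq> \<one> \<Longrightarrow> T z \<in> {0, 1}" and T1: "T \<one> = \<tau>"
    and Tinv: "\<And>z. z \<in> carrier G \<Longrightarrow> T (inv z) = T z"
  obtains N where "\<tau> \<le> N" "N < \<tau> + int q ^ e" "int q ^ a dvd int k * N - sum T (carrier G)"
    "\<And>l. int q ^ a dvd N - l \<Longrightarrow>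
       0 \<le> \<Delta> * N + c * int q ^ e - N\<^sup>2 - (2 * l + int q ^ a) * (sum T (carrier G) - N)
         + (int k - 1) * (l * (l + int q ^ a))"
proof -
  let ?m = "q ^ e" and ?M = "int q ^ a" and ?s = "sum T (carrier G)"
  let ?I = "pow_image ?m" and ?K = "{x \<in> carrier G. x [^] ?m = \<one>}"
  interpret I: finite_comm_group "pow_group ?m" by (rule finite_comm_group_pow_group)
  define U where "U = push ?m T"
  note card = sylow_power_map[OF q ord]
  have U2: "I.conv U U h = \<Delta> * U h + c * int ?m" if h: "h \<in> ?I" for h
  proof -
    have "I.conv U U h = push ?m (conv T T) h" unfolding U_def by (rule push_conv[OF h])
    also have "\<dots> = (\<Sum>x | x \<in> carrier G \<and> x [^] ?m = h. \<Delta> * T x + c)"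
      unfolding push_def by (rule sum.cong) (auto simp: T)
    also have "\<dots> = \<Delta> * U h + c * int (card {x \<in> carrier G. x [^] ?m = h})"
      by (simp add: U_def push_def sum.distrib sum_distrib_left)
    finally show ?thesis using card_pow_fibre[OF h] card(2) by simp
  qed
  have cong: "?M dvd U x - U y" if "x \<in> ?I" "y \<in> ?I" for x y
    by (rule I.conv_quadratic_cong[OF q(1) _ a, where F = U and c = "c * int ?m"])
       (use card q that U2 in \<open>auto simp: order_def\<close>)
  have one: "\<one> \<in> ?I" by (rule subgroup.one_closed[OF subgroup_pow_image])
  have sumU: "sum U ?I = ?s" unfolding U_def by (rule sum_push)
  have Uinv: "U (inv h) = U h" if "h \<in> ?I" for h
    unfolding U_def push_def
    by (rule sum.reindex_bij_witness[where i = "\<lambda>x. inv x" and j = "\<lambda>x. inv x"])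
       (use that Tinv in \<open>auto simp: nat_pow_inv\<close>)
  have sq: "(\<Sum>h\<in>?I. (U h)\<^sup>2) = \<Delta> * U \<one> + c * int ?m"
  proof -
    have "I.conv U U \<one> = (\<Sum>h\<in>?I. U h * U (inv h))"
      unfolding I.conv_def
      by (rule sum.cong) (auto simp: m_inv_consistent[OF subgroup_pow_image])
    also have "\<dots> = (\<Sum>h\<in>?I. (U h)\<^sup>2)"
      by (intro sum.cong refl) (simp only: Uinv power2_eq_square)
    finally show ?thesis using U2[OF one] by simp
  qed
  have split: "U \<one> = \<tau> + sum T (?K - {\<one>})"
    unfolding U_def push_def by (subst sum.remove[of _ \<one>]) (auto simp: T1)
  have lb: "\<tau> \<le> U \<one>"
    unfolding split using T01 by (auto intro!: sum_nonneg) fastforce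
  have "sum T (?K - {\<one>}) \<le> (\<Sum>x\<in>?K - {\<one>}. 1)"
    by (rule sum_mono) (use T01 in fastforce)
  also have "\<dots> = int ?m - 1"
  proof -
    have "card (?K - {\<one>}) = ?m - 1" using card(2) by (subst card_Diff_singleton) auto
    moreover have "?m \<ge> 1" using q prime_gt_0_nat[of q] by simp
    ultimately show ?thesis by (simp del: One_nat_def add: of_nat_diff)
  qed
  finally have ub: "U \<one> < \<tau> + int q ^ e" unfolding split by simp
  have dvd: "?M dvd int k * U \<one> - ?s"
  proof -
    have "int k * U \<one> - ?s = (\<Sum>h\<in>?I. U \<one> - U h)"
      by (simp add: sum_subtractf card sumU)
    also have "?M dvd \<dots>" by (intro dvd_sum cong one)
    finally show ?thesis .
  qed
  show thesis
  proof (rule that[OF lb ub dvd])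
    fix l assume l: "?M dvd U \<one> - l"
    have "0 \<le> (\<Sum>h\<in>?I - {\<one>}. (U h - l) * (U h - l - ?M))"
    proof (rule sum_nonneg)
      fix h assume h: "h \<in> ?I - {\<one>}"
      then have "?M dvd (U h - U \<one>) + (U \<one> - l)" by (intro dvd_add cong l) (auto intro: one)
      then obtain y where y: "U h - l = ?M * y" by auto
      have "(U h - l) * (U h - l - ?M) = ?M\<^sup>2 * (y * (y - 1))"
        unfolding y by (simp add: algebra_simps power2_eq_square)
      moreover have "y * (y - 1) \<ge> 0"
        by (cases "y \<le> 0") (auto intro: mult_nonpos_nonpos mult_nonneg_nonneg)
      ultimately show "0 \<le> (U h - l) * (U h - l - ?M)" by simp
    qed
    also have "\<dots> = (\<Sum>h\<in>?I - {\<one>}. (U h)\<^sup>2) - (2 * l + ?M) * sum U (?I - {\<one>})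
        + int (card (?I - {\<one>})) * (l * (l + ?M))"
      by (simp add: algebra_simps power2_eq_square sum.distrib sum_subtractf sum_distrib_left)
    also have "(\<Sum>h\<in>?I - {\<one>}. (U h)\<^sup>2) = \<Delta> * U \<one> + c * int q ^ e - (U \<one>)\<^sup>2"
      using sq one sum.remove[of ?I \<one> "\<lambda>h. (U h)\<^sup>2"] by simp
    also have "sum U (?I - {\<one>}) = ?s - U \<one>"
      using sumU one sum.remove[of ?I \<one> U] by simp
    also have "int (card (?I - {\<one>})) = int k - 1"
    proof -
      have "card (?I - {\<one>}) = k - 1" using card(1) one by (subst card_Diff_singleton) auto
      moreover have "k > 0" using q by (cases k) auto
      ultimately show ?thesis by (simp add: of_nat_diff)
    qed
    finally show "0 \<le> \<Delta> * U \<one> + c * int q ^ e - (U \<one>)\<^sup>2 - (2 * l + ?M) * (?s - U \<one>)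
         + (int k - 1) * (l * (l + ?M))" .
  qed
qed

end

section \<open>Traces of idempotents\<close>

lemma trace_mult_commute:
  fixes A B :: "'a :: comm_ring_1 mat"
  assumes "A \<in> carrier_mat n n" "B \<in> carrier_mat n n"
  shows "(\<Sum>i<n. (A * B) $$ (i, i)) = (\<Sum>i<n. (B * A) $$ (i, i))"
proof -
  have "(\<Sum>i<n. (A * B) $$ (i, i)) = (\<Sum>i<n. \<Sum>j<n. A $$ (i, j) * B $$ (j, i))"
    using assms by (intro sum.cong) (auto simp: scalar_prod_def atLeast0LessThan)
  also have "\<dots> = (\<Sum>j<n. \<Sum>i<n. A $$ (i, j) * B $$ (j, i))" by (rule sum.swap)
  also have "\<dots> = (\<Sum>i<n. (B * A) $$ (i, i))"
    using assms by (intro sum.cong) (auto simp: scalar_prod_def atLeast0LessThan mult.commute)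
  finally show ?thesis .
qed

text \<open>Being triangularisable over the complex numbers, an idempotent matrix is similar to an upper triangular idempotent
  matrix; the diagonal entries of that one are idempotent numbers.\<close>
lemma trace_idempotent_mat:
  fixes A :: "complex mat"
  assumes A: "A \<in> carrier_mat n n" and idem: "A * A = A"
  obtains k :: nat where "(\<Sum>i<n. A $$ (i, i)) = of_nat k"
proof -
  obtain es where "char_poly A = (\<Prod>e\<leftarrow>es. [:- e, 1:])"
    using char_poly_factorized[OF A] by auto
  then obtain B where B: "B \<in> carrier_mat n n" "upper_triangular B" "similar_mat A B"
    using schur_decomposition_exists[OF A] by blast
  then obtain P Q where "similar_mat_wit A B P Q" by (auto simp: similar_mat_def)
  then have PQ: "P \<in> carrier_mat n n" "Q \<in> carrier_mat n n" "P * Q = 1\<^sub>m n" "Q * P = 1\<^sub>m n"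
    "A = P * B * Q"
    using A by (auto simp: similar_mat_wit_def Let_def)
  have PB: "P * B \<in> carrier_mat n n" using PQ B by simp
  have tr: "(\<Sum>i<n. A $$ (i, i)) = (\<Sum>i<n. B $$ (i, i))"
  proof -
    have "(\<Sum>i<n. A $$ (i, i)) = (\<Sum>i<n. (Q * (P * B)) $$ (i, i))"
      unfolding PQ(5) by (rule trace_mult_commute[OF PB PQ(2)])
    also have "Q * (P * B) = (Q * P) * B"
      by (rule assoc_mult_mat[OF PQ(2,1) B(1), symmetric])
    also have "\<dots> = B" unfolding PQ(4) using B by simp
    finally show ?thesis .
  qed
  have QPB: "Q * (P * X) = X" if X: "X \<in> carrier_mat n n" for X
    using assoc_mult_mat[OF PQ(2,1) X] PQ(4) X by simp
  have AP: "A * P = P * B"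
    unfolding PQ(5) using assoc_mult_mat[OF PB PQ(2,1)] PQ(4) right_mult_one_mat[OF PB] by simp
  have "P * (B * B) = (P * B) * B" by (rule assoc_mult_mat[OF PQ(1) B(1) B(1), symmetric])
  also have "(P * B) * B = A * P * B" by (simp only: AP)
  also have "\<dots> = A * (P * B)" by (rule assoc_mult_mat[OF A PQ(1) B(1)])
  also have "\<dots> = A * (A * P)" by (simp only: AP)
  also have "\<dots> = (A * A) * P" by (rule assoc_mult_mat[OF A A PQ(1), symmetric])
  also have "\<dots> = P * B" using idem AP by simp
  finally have "Q * (P * (B * B)) = Q * (P * B)" by simp
  then have BB: "B * B = B" using QPB[of "B * B"] QPB[of B] B(1) by simp
  have "B $$ (i, i) \<in> {0, 1}" if i: "i < n" for i
  proof -
    have "B $$ (i, i) = (\<Sum>j<n. B $$ (i, j) * B $$ (j, i))"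
      using B i by (subst BB[symmetric]) (auto simp: scalar_prod_def atLeast0LessThan)
    also have "\<dots> = (\<Sum>j<n. if j = i then B $$ (i, i) * B $$ (i, i) else 0)"
    proof (intro sum.cong refl)
      fix j assume j: "j \<in> {..<n}"
      show "B $$ (i, j) * B $$ (j, i) = (if j = i then B $$ (i, i) * B $$ (i, i) else 0)"
        using upper_triangularD[OF B(2)] B(1) i j by (cases i j rule: linorder_cases) auto
    qed
    also have "\<dots> = B $$ (i, i) * B $$ (i, i)" using i by simp
    finally show ?thesis by auto
  qed
  then have "(\<Sum>i<n. B $$ (i, i)) = (\<Sum>i<n. if B $$ (i, i) = 1 then 1 else 0)"
    by (intro sum.cong) auto
  also have "\<dots> = of_nat (card {i\<in>{..<n}. B $$ (i, i) = 1})"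
    by (simp add: sum.If_cases Int_def)
  finally show ?thesis using tr that by simp
qed

lemma idempotent_trace_dvd:
  fixes F :: "'b \<Rightarrow> 'b \<Rightarrow> int"
  assumes S: "finite S" and m: "m \<noteq> 0"
    and F: "\<And>x y. x \<in> S \<Longrightarrow> y \<in> S \<Longrightarrow> (\<Sum>z\<in>S. F x z * F z y) = m * F x y"
  shows "m dvd (\<Sum>x\<in>S. F x x)"
proof -
  define n where "n = card S"
  obtain f where f: "bij_betw f {..<n} S"
    using ex_bij_betw_nat_finite[OF S] by (auto simp: n_def atLeast0LessThan)
  have fS: "f i \<in> S" if "i < n" for i using f that by (auto simp: bij_betw_def)
  define A :: "complex mat" where "A = mat n n (\<lambda>(i, j). of_int (F (f i) (f j)) / of_int m)"
  have A: "A \<in> carrier_mat n n" by (simp add: A_def)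
  have "A * A = A"
  proof (rule eq_matI)
    fix i j assume "i < dim_row A" "j < dim_col A"
    then have ij: "i < n" "j < n" by (auto simp: A_def)
    have "(A * A) $$ (i, j) = of_int (\<Sum>k<n. F (f i) (f k) * F (f k) (f j)) / (of_int m * of_int m)"
      using ij by (simp add: A_def scalar_prod_def atLeast0LessThan sum_divide_distrib)
    also have "(\<Sum>k<n. F (f i) (f k) * F (f k) (f j)) = (\<Sum>z\<in>S. F (f i) z * F z (f j))"
      by (rule sum.reindex_bij_betw[OF f])
    also have "\<dots> = m * F (f i) (f j)" using F fS ij by simp
    finally show "(A * A) $$ (i, j) = A $$ (i, j)" using ij m by (simp add: A_def)
  qed (auto simp: A_def)
  then obtain k where k: "(\<Sum>i<n. A $$ (i, i)) = of_nat k"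
    using trace_idempotent_mat A by metis
  have "(\<Sum>i<n. A $$ (i, i)) = of_int (\<Sum>i<n. F (f i) (f i)) / of_int m"
    by (simp add: A_def sum_divide_distrib)
  also have "(\<Sum>i<n. F (f i) (f i)) = (\<Sum>x\<in>S. F x x)"
    by (rule sum.reindex_bij_betw[OF f])
  finally have "(of_int (\<Sum>x\<in>S. F x x) :: complex) = of_int (m * int k)"
    using k m by (simp add: field_simps)
  then have "(\<Sum>x\<in>S. F x x) = m * int k" by (simp only: of_int_eq_iff)
  then show ?thesis by simp
qed

context finite_comm_group begin

text \<open>The matrix with entries \<open>E (x ^ (-1) y)\<close>, where \<open>E\<close> is the part of \<open>F\<close> of coefficient sum zero, is \<open>order G * m\<close> times an idempotent,
  and its trace is \<open>order G * E \<one>\<close>.\<close>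
lemma conv_quadratic_trace_dvd:
  assumes F: "\<And>z. z \<in> carrier G \<Longrightarrow> conv F F z = m * F z + c" and m: "m \<noteq> 0"
  shows "m dvd int (order G) * F \<one> - sum F (carrier G)"
proof -
  define E where "E x = int (order G) * F x - sum F (carrier G)" for x
  have E: "conv E E z = (int (order G) * m) * E z" if "z \<in> carrier G" for z
    unfolding E_def using conv_sum_zero_part[OF F that] by simp
  have v: "int (order G) \<noteq> 0" using order_gt_0' by simp
  have "int (order G) * m dvd (\<Sum>x\<in>carrier G. E (inv x \<otimes> x))"
  proof (rule idempotent_trace_dvd[of "carrier G" _ "\<lambda>x y. E (inv x \<otimes> y)", OF fin])
    show "int (order G) * m \<noteq> 0" using v m by simp
    fix x y assume xy: "x \<in> carrier G" "y \<in> carrier G"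
    have "(\<Sum>z\<in>carrier G. E (inv x \<otimes> z) * E (inv z \<otimes> y))
        = (\<Sum>z\<in>carrier G. E (inv x \<otimes> (x \<otimes> z)) * E (inv (x \<otimes> z) \<otimes> y))"
      by (rule sum_translate[OF xy(1), symmetric])
    also have "\<dots> = conv E E (inv x \<otimes> y)"
      unfolding conv_def
      by (intro sum.cong refl) (use xy in \<open>simp add: inv_cancel inv_mult m_assoc m_lcomm\<close>)
    finally show "(\<Sum>z\<in>carrier G. E (inv x \<otimes> z) * E (inv z \<otimes> y))
        = int (order G) * m * E (inv x \<otimes> y)"
      using E xy by simp
  qed
  also have "(\<Sum>x\<in>carrier G. E (inv x \<otimes> x)) = int (order G) * E \<one>"
    by (simp add: order_def)
  finally show ?thesis using v by (simp add: E_def)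
qed

end

section \<open>The Diophantine conditions\<close>

text \<open>\<open>L f k\<close> runs a loop that starts at \<open>k\<close> and makes at most \<open>f\<close> steps while \<open>C\<close> holds, testing \<open>P\<close> each time. When it succeeds, \<open>P\<close> has
  been verified for the whole range, provided that the range \<open>C\<close> is an initial segment.\<close>
lemma bounded_loopD:
  fixes L :: "nat \<Rightarrow> int \<Rightarrow> bool"
  assumes L0: "\<And>k. L 0 k \<longleftrightarrow> \<not> C k"
    and LSuc: "\<And>f k. L (Suc f) k \<longleftrightarrow> \<not> C k \<or> (P k \<and> L f (k + 1))"
    and L: "L f k0"
    and C: "\<And>k. k0 \<le> k \<Longrightarrow> C (k + 1) \<Longrightarrow> C k" and k: "k0 \<le> k" "C k"
  shows "P k"
  using L C k
proof (induction f arbitrary: k0)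
  case (0 k0)
  have "C k \<Longrightarrow> C k0" using 0(3)
  proof (induction k rule: int_ge_induct)
    case (step i)
    then show ?case using 0(2)[of i] by blast
  qed
  with 0 show ?case using L0 by blast
next
  case (Suc f k0)
  have "C k \<Longrightarrow> C k0" using Suc.prems(3)
  proof (induction k rule: int_ge_induct)
    case (step i)
    then show ?case using Suc.prems(2)[of i] by blast
  qed
  then have *: "P k0" "L f (k0 + 1)" using Suc.prems LSuc by blast+
  show ?case
  proof (cases "k = k0")
    case False
    show ?thesis
    proof (rule Suc.IH[OF *(2)])
      show "C i" if "k0 + 1 \<le> i" "C (i + 1)" for i
        using Suc.prems(2)[of i] that by simp
    qed (use False Suc.prems in auto)
  qed (use * in simp)
qed

text \<open>The triples \<open>(u, w, n)\<close> with \<open>u = s + 1\<close>, \<open>w = s - \<alpha>\<close> and \<open>t + 1 = n (s + 1)\<close>.\<close>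
definition possible_params :: "(int \<times> int \<times> int) list" where
  "possible_params = [(6, 3, 1), (12, 8, 2), (20, 15, 3), (30, 24, 4), (40, 24, 1), (42, 35, 5),
     (56, 48, 6), (72, 63, 7), (90, 80, 8), (165, 120, 2), (273, 168, 1), (374, 220, 2)]"

definition sq :: "int \<Rightarrow> int" where "sq x = x * x"

text \<open>That \<open>v\<close> divides \<open>w ^ 20\<close> expresses, for \<open>v < 2 ^ 20\<close>, that all primes dividing \<open>v\<close> divide \<open>w\<close>.\<close>
definition smooth_test :: "int \<Rightarrow> int \<Rightarrow> bool" where
  "smooth_test v w = (sq (sq (sq (sq w))) * sq (sq w) mod v = 0)"

text \<open>Here \<open>a\<close> stands for \<open>\<alpha>\<close> and \<open>R\<close> for \<open>\<alpha>\<close> times the number of points, while \<open>n u + w\<close> is \<open>\<Delta>\<close>. This test and the loops below are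
  combined by disjunction and conjunction rather than by conditionals, so that rewriting from left to right leaves
  irrelevant parts unevaluated.\<close>
definition value_test :: "int \<Rightarrow> int \<Rightarrow> int \<Rightarrow> int \<Rightarrow> int \<Rightarrow> bool" where
  "value_test a R u w n \<longleftrightarrow> a < 2 \<or> 1000000 * a \<le> R \<or> R mod a \<noteq> 0 \<or>
     \<not> smooth_test (R div a) (n * u + w) \<or> (u, w, n) \<in> set possible_params"

definition param_test :: "int \<Rightarrow> int \<Rightarrow> int \<Rightarrow> bool" where
  "param_test u w n = value_test (u - 1 - w) (u * ((u - 1) * n * u - w)) u w n"

text \<open>Implied by the bound on the number of points, and inherited by smaller arguments, so that each loop can stop at the first
  value outside the range.\<close>
definition in_range :: "int \<Rightarrow> int \<Rightarrow> bool" where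
  "in_range n u = (n * u * (u - 2) < 1000000)"

text \<open>The five loops run over the parameters \<open>k\<close>, \<open>h\<close>, \<open>w\<close>, \<open>n\<close>, \<open>U\<close> of the parametrisation
  \<open>u = k U (n U + w)\<close>, \<open>w' = k h w (n U + w)\<close>, \<open>n' = h n\<close> of the triples \<open>(u, w', n')\<close> to be tested. The last
  arguments of the inner loops are values that stay fixed in the loop.\<close>
fun loop_k :: "nat \<Rightarrow> int \<Rightarrow> int \<Rightarrow> int \<Rightarrow> int \<Rightarrow> bool" where
  "loop_k 0 k n b c = (\<not> in_range n (k * b))"
| "loop_k (Suc f) k n b c = (\<not> in_range n (k * b) \<or>
     (param_test (k * b) (k * c) n \<and> loop_k f (k + 1) n b c))"

fun loop_h :: "nat \<Rightarrow> int \<Rightarrow> int \<Rightarrow> int \<Rightarrow> int \<Rightarrow> int \<Rightarrow> bool" where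
  "loop_h 0 h U n w d = (\<not> (h * w < U \<and> in_range (h * n) (U * d)))"
| "loop_h (Suc f) h U n w d = (\<not> (h * w < U \<and> in_range (h * n) (U * d)) \<or>
     (loop_k 200 1 (h * n) (U * d) (h * w * d) \<and> loop_h f (h + 1) U n w d))"

fun loop_w :: "nat \<Rightarrow> int \<Rightarrow> int \<Rightarrow> int \<Rightarrow> bool" where
  "loop_w 0 w U n = (\<not> (w < U \<and> in_range n (U * (n * U + w))))"
| "loop_w (Suc f) w U n = (\<not> (w < U \<and> in_range n (U * (n * U + w))) \<or>
     (loop_h 40 1 U n w (n * U + w) \<and> loop_w f (w + 1) U n))"

fun loop_n :: "nat \<Rightarrow> int \<Rightarrow> int \<Rightarrow> bool" where
  "loop_n 0 n U = (\<not> in_range n (U * (n * U + 1)))"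
| "loop_n (Suc f) n U = (\<not> in_range n (U * (n * U + 1)) \<or>
     (loop_w 40 1 U n \<and> loop_n f (n + 1) U))"

fun loop_U :: "nat \<Rightarrow> int \<Rightarrow> bool" where
  "loop_U 0 U = (\<not> in_range 1 (U * (U + 1)))"
| "loop_U (Suc f) U = (\<not> in_range 1 (U * (U + 1)) \<or> (loop_n 40 1 U \<and> loop_U f (U + 1)))"

lemma loop_U: "loop_U 40 2"
  by code_simp

lemma prime_power_dvd_imp_dvd:
  fixes a b :: int
  assumes "a > 0" "b > 0" "\<And>p k. prime p \<Longrightarrow> p ^ Suc k dvd a \<Longrightarrow> p ^ Suc k dvd b"
  shows "a dvd b"
proof (rule multiplicity_le_imp_dvd)
  fix p :: int assume p: "prime p"
  show "multiplicity p a \<le> multiplicity p b"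
  proof (cases "multiplicity p a")
    case (Suc k)
    have "p ^ multiplicity p a dvd a" by (rule multiplicity_dvd)
    then have "p ^ Suc k dvd a" unfolding Suc .
    then have "p ^ Suc k dvd b" by (rule assms(3)[OF p])
    then show ?thesis unfolding Suc
      using assms(2) p by (intro multiplicity_geI) auto
  qed simp
qed (use assms in simp)

lemma smooth_testI:
  assumes v: "v \<ge> 1" "v < 1000000" and w: "w > 0"
    and primes: "\<And>p. prime p \<Longrightarrow> p dvd v \<Longrightarrow> p dvd w"
  shows "smooth_test v w"
proof -
  have "v dvd w ^ 20"
  proof (rule prime_power_dvd_imp_dvd)
    fix p k assume p: "prime p" "p ^ Suc k dvd v"
    have "2 ^ Suc k \<le> p ^ Suc k" using prime_ge_2_int[OF p(1)] by (intro power_mono) auto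
    also have "\<dots> \<le> v" using p v by (intro zdvd_imp_le) auto
    also have "\<dots> < 2 ^ 20" using v by simp
    finally have "Suc k < 20" by (rule power_less_imp_less_exp[rotated]) simp
    then have "w ^ Suc k dvd w ^ 20" by (intro le_imp_power_dvd) simp
    moreover have "p dvd v" using dvd_trans[OF _ p(2), of p] by simp
    then have "p ^ Suc k dvd w ^ Suc k" using primes p(1) dvd_power_same by blast
    ultimately show "p ^ Suc k dvd w ^ 20" by (rule dvd_trans[rotated])
  qed (use v w in auto)
  moreover have "sq (sq (sq (sq w))) * sq (sq w) = w ^ 20"
    by (simp add: sq_def power2_eq_square eval_nat_numeral)
  ultimately show ?thesis by (simp add: smooth_test_def mod_eq_0_iff_dvd)
qed

lemma in_range_antimono:
  assumes "in_range n u" "0 \<le> n'" "n' \<le> n" "2 \<le> u'" "u' \<le> u"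
  shows "in_range n' u'"
proof -
  have "n' * u' * (u' - 2) \<le> n * u * (u - 2)"
    using assms by (intro mult_mono) auto
  then show ?thesis using assms(1) by (simp add: in_range_def)
qed

lemma check_params_sound:
  fixes U n w h k :: int
  assumes pos: "U \<ge> 2" "n \<ge> 1" "w \<ge> 1" "h \<ge> 1" "k \<ge> 1" and hw: "h * w < U"
    and range: "in_range (h * n) (k * (U * (n * U + w)))"
  shows "param_test (k * (U * (n * U + w))) (k * (h * w * (n * U + w))) (h * n)"
proof -
  have "1 * w \<le> h * w" using pos by (intro mult_right_mono) auto
  then have wU: "w < U" using hw by simp
  have U2: "2 \<le> U * (n' * U + w')" if "U \<ge> 2" "n' \<ge> 1" "w' \<ge> 1" for U n' w' :: int
  proof -
    have "0 \<le> n' * U" using that by simp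
    then have "1 \<le> n' * U + w'" using that by linarith
    then have "2 * 1 \<le> U * (n' * U + w')" using that by (intro mult_mono) auto
    then show ?thesis by simp
  qed
  have mon: "U' * (n' * U' + w') \<le> U'' * (n'' * U'' + w'')"
    if "2 \<le> U'" "U' \<le> U''" "1 \<le> n'" "n' \<le> n''" "1 \<le> w'" "w' \<le> w''" for U' U'' n' n'' w' w'' :: int
    using that by (intro mult_mono add_mono) auto
  have r4: "in_range (h * n) (U * (n * U + w))"
    using range
  proof (rule in_range_antimono)
    show "U * (n * U + w) \<le> k * (U * (n * U + w))"
      using pos U2[OF pos(1-3)] by (simp add: mult_le_cancel_right1)
  qed (use pos U2[OF pos(1-3)] in auto)
  have r3: "in_range n (U * (n * U + w))"
    by (rule in_range_antimono[OF r4]) (use pos U2[OF pos(1-3)] in \<open>auto simp: mult_le_cancel_right1\<close>)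
  have r2: "in_range n (U * (n * U + 1))"
    by (rule in_range_antimono[OF r3]) (use pos U2[OF pos(1,2), of 1] mon[of U U n n 1 w] in auto)
  have r1: "in_range 1 (U * (U + 1))"
    by (rule in_range_antimono[OF r2]) (use pos U2[OF pos(1), of 1 1] mon[of U U 1 n 1 1] in auto)
  have U_next: "in_range 1 (U' * (U' + 1))" if "2 \<le> U'" "in_range 1 ((U' + 1) * (U' + 1 + 1))" for U'
    by (rule in_range_antimono[OF that(2)])
       (use that U2[of U' 1 1] mon[of U' "U' + 1" 1 1 1 1] in auto)
  have n_next: "in_range n' (U * (n' * U + 1))"
    if "1 \<le> n'" "in_range (n' + 1) (U * ((n' + 1) * U + 1))" for n'
    by (rule in_range_antimono[OF that(2)])
       (use that pos U2[of U n' 1] mon[of U U n' "n' + 1" 1 1] in auto)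
  have w_next: "w' < U \<and> in_range n (U * (n * U + w'))"
    if w': "1 \<le> w'" "w' + 1 < U \<and> in_range n (U * (n * U + (w' + 1)))" for w'
    using in_range_antimono[of n "U * (n * U + (w' + 1))" n "U * (n * U + w')"]
      w' pos U2[of U n w'] mon[of U U n n w' "w' + 1"] by auto
  have h_next: "h' * w < U \<and> in_range (h' * n) (U * (n * U + w))"
    if h': "1 \<le> h'" "(h' + 1) * w < U \<and> in_range ((h' + 1) * n) (U * (n * U + w))" for h'
  proof -
    have "h' * w \<le> (h' + 1) * w" "h' * n \<le> (h' + 1) * n"
      using pos h' by (auto intro: mult_right_mono)
    moreover have "0 \<le> h' * n" using pos h' by simp
    ultimately show ?thesis
      using in_range_antimono[of "(h' + 1) * n" "U * (n * U + w)" "h' * n" "U * (n * U + w)"]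
        h' U2[of U n w] pos by linarith
  qed
  have k_next: "in_range (h * n) (k' * (U * (n * U + w)))"
    if "1 \<le> k'" "in_range (h * n) ((k' + 1) * (U * (n * U + w)))" for k'
  proof (rule in_range_antimono[OF that(2)])
    have "1 * 2 \<le> k' * (U * (n * U + w))"
      using that pos U2[of U n w] by (intro mult_mono) auto
    then show "2 \<le> k' * (U * (n * U + w))" by simp
    show "k' * (U * (n * U + w)) \<le> (k' + 1) * (U * (n * U + w))"
      using that pos U2[of U n w] by (intro mult_right_mono) auto
  qed (use pos in auto)
  have "loop_n 40 1 U"
    by (rule bounded_loopD[where L = loop_U, OF _ _ loop_U U_next]) (use pos r1 in auto)
  then have "loop_w 40 1 U n"
    by (rule bounded_loopD[where L = "\<lambda>f n. loop_n f n U", rotated 2, OF _ n_next]) (use pos r2 in auto)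
  then have "loop_h 40 1 U n w (n * U + w)"
    by (rule bounded_loopD[where L = "\<lambda>f w. loop_w f w U n", rotated 2, OF _ w_next]) (use pos r3 wU in auto)
  then have "loop_k 200 1 (h * n) (U * (n * U + w)) (h * w * (n * U + w))"
    by (rule bounded_loopD[where L = "\<lambda>f h. loop_h f h U n w (n * U + w)", rotated 2, OF _ h_next])
       (use pos r4 hw in auto)
  then show ?thesis
    by (rule bounded_loopD[where L = "\<lambda>f k. loop_k f k (h * n) (U * (n * U + w)) (h * w * (n * U + w))",
          rotated 2, OF _ k_next])
       (use pos range in auto)
qed

text \<open>Let \<open>\<Delta> = n u + w\<close> and \<open>\<alpha> = u - 1 - w\<close>. A prime dividing \<open>\<Delta>\<close> divides \<open>v\<close>, hence \<open>u u w\<close>, since \<open>\<alpha> v\<close> is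
  \<open>- u u w\<close> modulo \<open>\<Delta>\<close>, and therefore \<open>w\<close>, since \<open>\<Delta> = n u + w\<close>. As \<open>n u\<close> is \<open>- w\<close> modulo \<open>\<Delta>\<close>, the trace condition says that \<open>\<Delta>\<close> divides \<open>w (v - u)\<close>. A prime \<open>p\<close> dividing \<open>\<Delta>\<close> but not \<open>u\<close>
  does not divide \<open>v - u\<close>; if \<open>p\<close> divides \<open>u\<close>, then it divides \<open>v\<close> more often than \<open>u\<close>, hence \<open>v - u\<close> exactly as often
  as \<open>u\<close>. Either way the full power of \<open>p\<close> in \<open>\<Delta>\<close> divides \<open>u w\<close>.

  Now put \<open>u = g U\<close>, \<open>w = g h w1\<close>, \<open>n = h n1\<close> with \<open>U\<close> prime to \<open>h w1\<close> and \<open>n1\<close> prime to \<open>w1\<close>. Then \<open>\<Delta> = g h (n1 U + w1)\<close>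
  divides \<open>g g h U w1\<close>, and \<open>n1 U + w1\<close> is prime to \<open>U\<close> and to \<open>w1\<close>, so that it divides \<open>g\<close>. This leaves a short list.\<close>
lemma possible_parameters:
  fixes u w n v :: int
  assumes pos: "w \<ge> 1" "n \<ge> 1" "u - 1 - w \<ge> 2"
    and v: "(u - 1 - w) * v = u * ((u - 1) * n * u - w)" and small: "v < 1000000"
    and primes: "\<And>p. prime p \<Longrightarrow> p dvd v \<longleftrightarrow> p dvd n * u + w"
    and trace: "n * u + w dvd n * u * (v - u)"
  shows "(u, w, n) \<in> set possible_params"
proof -
  define \<Delta> where "\<Delta> = n * u + w"
  define \<alpha> where "\<alpha> = u - 1 - w"
  have u4: "u \<ge> 4" using pos by simp
  have \<Delta>0: "\<Delta> > 0" unfolding \<Delta>_def using pos u4 by (intro add_pos_pos mult_pos_pos) auto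
  have \<alpha>2: "\<alpha> \<ge> 2" using pos by (simp add: \<alpha>_def)
  have v': "\<alpha> * v = u * ((u - 1) * \<Delta> - u * w)"
    using v by (simp add: \<alpha>_def \<Delta>_def algebra_simps)
  have nu: "n * u \<ge> u" using pos u4 by (simp add: mult_le_cancel_right1)
  have X: "(u - 1) * n * u - w > 0"
  proof -
    have "1 * u \<le> (u - 1) * (n * u)" using nu u4 by (intro mult_mono) auto
    moreover have "(u - 1) * (n * u) = (u - 1) * n * u" by simp
    ultimately show ?thesis using pos by linarith
  qed
  have v1: "v \<ge> 1"
  proof -
    have "\<alpha> * v > 0" using v X u4 by (simp add: \<alpha>_def)
    then show ?thesis using \<alpha>2 by (simp add: zero_less_mult_iff)
  qed
  have pw: "p dvd w" if p: "prime p" "p dvd \<Delta>" for p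
  proof -
    have "p dvd \<alpha> * v" using primes p by (simp add: \<Delta>_def)
    then have "p dvd u * (u - 1) * \<Delta> - \<alpha> * v" by (rule dvd_diff[OF dvd_mult[OF p(2)]])
    also have "u * (u - 1) * \<Delta> - \<alpha> * v = u * u * w" unfolding v' by (simp add: algebra_simps)
    finally have "p dvd u \<or> p dvd w" using p(1) by (simp add: prime_dvd_mult_iff)
    then show ?thesis
    proof
      assume "p dvd u"
      then have "p dvd \<Delta> - n * u" using p by (intro dvd_diff) auto
      then show ?thesis by (simp add: \<Delta>_def)
    qed
  qed
  have \<Delta>wv: "\<Delta> dvd w * (v - u)"
  proof -
    have "\<Delta> dvd \<Delta> * (v - u) - n * u * (v - u)" using trace by (simp add: \<Delta>_def)
    also have "\<Delta> * (v - u) - n * u * (v - u) = w * (v - u)" by (simp add: \<Delta>_def algebra_simps)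
    finally show ?thesis .
  qed
  \<comment> \<open>The comparison of prime powers: \<open>w * (v - u)\<close> has just as many factors \<open>p\<close> as \<open>w\<close> or as \<open>u * w\<close>.\<close>
  have "\<Delta> dvd u * w"
  proof (rule prime_power_dvd_imp_dvd)
    show "u * w > 0" using pos u4 by simp
    fix p k assume p: "prime p" "p ^ Suc k dvd \<Delta>"
    then have p\<Delta>: "p dvd \<Delta>" using dvd_trans[OF _ p(2), of p] by simp
    have pv: "p dvd v" using primes p(1) p\<Delta> by (simp add: \<Delta>_def)
    have pdvd: "p ^ Suc k dvd w * (v - u)" using p(2) \<Delta>wv by (rule dvd_trans)
    show "p ^ Suc k dvd u * w"
    proof (cases "p dvd u")
      case False
      have "\<not> p dvd v - u"
      proof
        assume "p dvd v - u"
        then have "p dvd v - (v - u)" by (rule dvd_diff[OF pv])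
        then show False using False by simp
      qed
      then have "coprime (p ^ Suc k) (v - u)"
        using prime_imp_coprime[OF p(1)] by simp
      then have "p ^ Suc k dvd w" using pdvd by (simp only: coprime_dvd_mult_left_iff)
      then show ?thesis by (rule dvd_mult)
    next
      case True
      have u0: "u \<noteq> 0" using u4 by simp
      obtain y where y: "u = p ^ multiplicity p u * y" "\<not> p dvd y"
        using multiplicity_decompose'[OF u0] p(1) not_prime_unit by blast
      let ?i = "multiplicity p u"
      have pw': "p dvd w" by (rule pw[OF p(1) p\<Delta>])
      have "\<not> p dvd \<alpha>"
      proof
        assume "p dvd \<alpha>"
        then have "p dvd u - w - \<alpha>" by (rule dvd_diff[OF dvd_diff[OF True pw']])
        moreover have "u - w - \<alpha> = 1" by (simp add: \<alpha>_def)
        ultimately have "is_unit p" by (simp only:)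
        then show False using p(1) not_prime_unit by blast
      qed
      then have cop: "coprime (p ^ Suc ?i) \<alpha>"
        using prime_imp_coprime[OF p(1)] by simp
      have "p dvd (u - 1) * \<Delta> - u * w" using p\<Delta> pw' by (intro dvd_diff dvd_mult)
      then have "p ^ ?i * p dvd u * ((u - 1) * \<Delta> - u * w)"
        by (intro mult_dvd_mono multiplicity_dvd)
      then have "p ^ Suc ?i dvd \<alpha> * v" unfolding v' by (simp add: mult.commute)
      then have "p ^ Suc ?i dvd v" using cop by (simp only: coprime_dvd_mult_right_iff)
      then obtain x where x: "v = p ^ Suc ?i * x" by blast
      have eq: "w * (v - u) = (w * p ^ ?i) * (p * x - y)"
        using x y(1) by (simp add: algebra_simps)
      have "\<not> p dvd p * x - y"
      proof
        assume "p dvd p * x - y"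
        then have "p dvd p * x - (p * x - y)" by (rule dvd_diff[OF dvd_triv_left])
        then show False using y(2) by simp
      qed
      then have "coprime (p ^ Suc k) (p * x - y)"
        using prime_imp_coprime[OF p(1)] by simp
      then have "p ^ Suc k dvd w * p ^ ?i"
        using pdvd unfolding eq by (simp only: coprime_dvd_mult_left_iff)
      also have "w * p ^ ?i dvd w * u" by (intro mult_dvd_mono multiplicity_dvd) simp
      finally show ?thesis by (simp add: mult.commute)
    qed
  qed (fact \<Delta>0)
  define g where "g = gcd u w"
  have g0: "g > 0" unfolding g_def using u4 by (simp add: gcd_pos_int)
  obtain U W where UW: "u = g * U" "w = g * W" "coprime U W"
    using gcd_coprime_exists[of u w] g0 that by (auto simp flip: g_def simp: mult.commute)
  have "g * U > 0" "g * W > 0" using UW u4 pos by simp_all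
  then have UW0: "U > 0" "W > 0" using g0 by (simp_all add: zero_less_mult_iff)
  define h where "h = gcd n W"
  have h0: "h > 0" unfolding h_def using UW0 by (simp add: gcd_pos_int)
  obtain n1 w1 where nw: "n = h * n1" "W = h * w1" "coprime n1 w1"
    using gcd_coprime_exists[of n W] h0 that by (auto simp flip: h_def simp: mult.commute)
  have "h * n1 > 0" "h * w1 > 0" using nw pos UW0 by simp_all
  then have nw0: "n1 > 0" "w1 > 0" using h0 by (simp_all add: zero_less_mult_iff)
  define \<delta> where "\<delta> = n1 * U + w1"
  have \<Delta>eq: "\<Delta> = g * h * \<delta>" by (simp add: \<Delta>_def \<delta>_def UW nw algebra_simps)
  have copUw: "coprime U w1" using UW(3) nw(2) by simp
  have "\<delta> dvd g"
  proof -
    have "g * h * \<delta> dvd g * h * (U * (g * w1))"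
      using \<open>\<Delta> dvd u * w\<close> \<Delta>eq UW nw by (simp add: ac_simps)
    then have "\<delta> dvd U * (g * w1)" using g0 h0 by simp
    moreover have "coprime \<delta> U"
    proof -
      have "gcd U (n1 * U + w1) = gcd U w1" by (rule gcd_add_mult)
      then show ?thesis using copUw unfolding \<delta>_def by (simp add: coprime_iff_gcd_eq_1 gcd.commute)
    qed
    ultimately have "\<delta> dvd g * w1" by (simp add: coprime_dvd_mult_right_iff)
    moreover have "coprime \<delta> w1"
    proof -
      have "coprime (n1 * U) w1" using nw(3) copUw by simp
      then show ?thesis unfolding \<delta>_def by (simp add: coprime_iff_gcd_eq_1)
    qed
    ultimately show ?thesis by (simp add: coprime_dvd_mult_left_iff)
  qed
  then obtain k where k: "g = \<delta> * k" by blast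
  have \<delta>0: "\<delta> > 0" unfolding \<delta>_def using nw0 UW0 by (intro add_pos_pos mult_pos_pos)
  have k0: "k > 0" using k g0 \<delta>0 by (simp add: zero_less_mult_iff)
  have hw: "h * w1 < U"
  proof -
    have "g * (h * w1) < g * U" using UW nw pos by simp
    then show ?thesis using g0 by simp
  qed
  have U2: "U \<ge> 2"
  proof -
    have "h * w1 > 0" using h0 nw0 by simp
    then show ?thesis using hw by simp
  qed
  have ueq: "u = k * (U * (n1 * U + w1))" and weq: "w = k * (h * w1 * (n1 * U + w1))"
    using UW nw k by (simp_all add: \<delta>_def ac_simps)
  have range: "in_range n u"
  proof -
    let ?X = "(u - 1) * n * u - w"
    have "?X < v"
    proof (rule ccontr)
      assume "\<not> ?X < v"
      then have "\<alpha> * v \<le> \<alpha> * ?X" using \<alpha>2 by (intro mult_left_mono) auto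
      also have "\<dots> < u * ?X" using X pos by (intro mult_strict_right_mono) (auto simp: \<alpha>_def)
      finally show False using v by (simp add: \<alpha>_def)
    qed
    moreover have "n * u * (u - 2) = ?X - (n * u - w)" by (simp add: algebra_simps)
    ultimately have "n * u * (u - 2) < 1000000" using small nu pos by linarith
    then show ?thesis by (simp add: in_range_def)
  qed
  have "param_test u w n"
    unfolding ueq weq nw(1)
    by (rule check_params_sound) (use U2 nw0 h0 k0 hw range ueq nw(1) in auto)
  moreover have "u * ((u - 1) * n * u - w) mod \<alpha> = 0" "u * ((u - 1) * n * u - w) div \<alpha> = v"
    using v \<alpha>2 by (simp_all add: \<alpha>_def[symmetric] flip: v)
  moreover have "smooth_test v (n * u + w)"
    by (rule smooth_testI[OF v1 small]) (use \<Delta>0 primes in \<open>auto simp: \<Delta>_def\<close>)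
  moreover have "u * ((u - 1) * n * u - w) < 1000000 * \<alpha>"
  proof -
    have "\<alpha> * v < \<alpha> * 1000000" using small \<alpha>2 by (intro mult_strict_left_mono) auto
    then show ?thesis using v by (simp add: \<alpha>_def mult.commute)
  qed
  ultimately show ?thesis
    using \<alpha>2 unfolding param_test_def value_test_def \<alpha>_def[symmetric] by auto
qed

section \<open>The group ring element of a partial geometry\<close>

context partial_geometry begin

text \<open>The incidence matrix times its transpose.\<close>
definition joining :: "'a \<Rightarrow> 'a \<Rightarrow> int" where
  "joining x y = int (card {M \<in> L. x \<in> M \<and> y \<in> M})"

abbreviation eig :: int where
  "eig \<equiv> int s + int t + 1 - int \<alpha>"

lemma finite_lines [simp]: "finite L"
  by (rule finite_subset[of _ "Pow P"]) (use lines_subset finite_points in auto)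

lemma finite_line: "M \<in> L \<Longrightarrow> finite M"
  using lines_subset finite_points finite_subset by blast

lemma joining_sum: "joining x y = (\<Sum>M\<in>{M\<in>L. x \<in> M}. if y \<in> M then 1 else 0)"
  by (simp add: joining_def sum.If_cases Int_def conj_ac)

lemma joining_self: "x \<in> P \<Longrightarrow> joining x x = int t + 1"
  using lines_on_point by (simp add: joining_def)

lemma joining_le_1:
  assumes "x \<noteq> y"
  shows "joining x y \<in> {0, 1}"
proof -
  have "M = N" if "M \<in> L" "N \<in> L" "{x, y} \<subseteq> M \<inter> N" for M N
  proof (rule ccontr)
    assume "M \<noteq> N"
    have "card {x, y} \<le> card (M \<inter> N)" using that finite_line by (intro card_mono) auto
    then show False using lines_meet[OF that(1,2) \<open>M \<noteq> N\<close>] assms by simp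
  qed
  then have "card {M \<in> L. x \<in> M \<and> y \<in> M} \<le> Suc 0"
    by (subst card_le_Suc0_iff_eq) auto
  then show ?thesis by (auto simp: joining_def le_Suc_eq)
qed

lemma sum_joining_line:
  assumes M: "M \<in> L" and z: "z \<in> P"
  shows "(\<Sum>y\<in>M. joining z y) = (if z \<in> M then int s + int t + 1 else int \<alpha>)"
proof -
  let ?Z = "{N\<in>L. z \<in> N}"
  have cap: "card (N \<inter> M) \<le> 1" if "N \<in> L" "N \<noteq> M" for N
    using lines_meet that M by blast
  have "(\<Sum>y\<in>M. joining z y) = (\<Sum>N\<in>?Z. \<Sum>y\<in>M. if y \<in> N then 1 else 0)"
    unfolding joining_sum by (rule sum.swap)
  also have "\<dots> = (\<Sum>N\<in>?Z. int (card (N \<inter> M)))"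
    using finite_line[OF M] by (intro sum.cong) (auto simp: sum.If_cases Int_def conj_ac)
  also have "\<dots> = (if z \<in> M then int s + int t + 1 else int \<alpha>)"
  proof (cases "z \<in> M")
    case True
    have one: "int (card (N \<inter> M)) = 1" if N: "N \<in> ?Z - {M}" for N
    proof -
      have "card {z} \<le> card (N \<inter> M)"
        using N True finite_line[OF M] by (intro card_mono) auto
      then show ?thesis using cap[of N] N by simp
    qed
    have "(\<Sum>N\<in>?Z. int (card (N \<inter> M))) = int (card (M \<inter> M)) + (\<Sum>N\<in>?Z - {M}. int (card (N \<inter> M)))"
      using True M by (intro sum.remove) auto
    also have "(\<Sum>N\<in>?Z - {M}. int (card (N \<inter> M))) = (\<Sum>N\<in>?Z - {M}. 1)"
      using one by (intro sum.cong) auto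
    also have "\<dots> = int t"
      using True M lines_on_point[OF z] by (simp add: card_Diff_singleton)
    finally show ?thesis using True points_on_line[OF M] by simp
  next
    case False
    have "(\<Sum>N\<in>?Z. int (card (N \<inter> M))) = (\<Sum>N\<in>?Z. if N \<inter> M \<noteq> {} then 1 else 0)"
    proof (rule sum.cong[OF refl])
      fix N assume N: "N \<in> ?Z"
      then have "card (N \<inter> M) \<le> 1" using cap False by auto
      moreover have "card (N \<inter> M) = 0 \<longleftrightarrow> N \<inter> M = {}" using finite_line[OF M] by simp
      ultimately show "int (card (N \<inter> M)) = (if N \<inter> M \<noteq> {} then 1 else 0)" by auto
    qed
    also have "\<dots> = int (card {N \<in> L. z \<in> N \<and> N \<inter> M \<noteq> {}})"
      by (simp add: sum.If_cases Int_def conj_ac)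
    finally show ?thesis using antiflag[OF z M False] False by simp
  qed
  finally show ?thesis .
qed

lemma joining_sym: "joining x y = joining y x"
  by (simp add: joining_def conj_ac)

lemma sum_joining_indicator:
  assumes "x \<in> P"
  shows "(\<Sum>y\<in>P. joining x y * f y) = (\<Sum>M\<in>{M\<in>L. x \<in> M}. sum f M)"
proof -
  have "(\<Sum>y\<in>P. joining x y * f y) = (\<Sum>M\<in>{M\<in>L. x \<in> M}. \<Sum>y\<in>P. if y \<in> M then f y else 0)"
    unfolding joining_sum sum_distrib_right by (subst sum.swap) (intro sum.cong refl, simp)
  also have "\<dots> = (\<Sum>M\<in>{M\<in>L. x \<in> M}. sum f M)"
  proof (rule sum.cong[OF refl])
    fix M assume "M \<in> {M\<in>L. x \<in> M}"
    then have "P \<inter> M = M" using lines_subset by auto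
    then show "(\<Sum>y\<in>P. if y \<in> M then f y else 0) = sum f M"
      using finite_points by (simp add: sum.inter_restrict[symmetric])
  qed
  finally show ?thesis .
qed

lemma sum_joining:
  assumes "x \<in> P"
  shows "(\<Sum>y\<in>P. joining x y) = (int s + 1) * (int t + 1)"
proof -
  have "(\<Sum>y\<in>P. joining x y) = (\<Sum>M\<in>{M\<in>L. x \<in> M}. int s + 1)"
    using sum_joining_indicator[OF assms, of "\<lambda>_. 1"] points_on_line by simp
  then show ?thesis using lines_on_point[OF assms] by simp
qed

text \<open>Summing over the lines \<open>M\<close> on \<open>x\<close> and the points \<open>y\<close> on \<open>M\<close> leaves the number of joining lines from \<open>z\<close> to the points of \<open>M\<close>, which is
  \<open>\<alpha>\<close> if \<open>z\<close> is not on \<open>M\<close> and exceeds \<open>\<alpha>\<close> by the eigenvalue otherwise.\<close>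
lemma joining_quadratic:
  assumes x: "x \<in> P" and z: "z \<in> P"
  shows "(\<Sum>y\<in>P. joining x y * joining y z) = eig * joining x z + int \<alpha> * (int t + 1)"
proof -
  have "(\<Sum>y\<in>P. joining x y * joining y z)
      = (\<Sum>M\<in>{M\<in>L. x \<in> M}. if z \<in> M then int s + int t + 1 else int \<alpha>)"
    unfolding sum_joining_indicator[OF x] joining_sym[of _ z]
    by (intro sum.cong refl) (use sum_joining_line z in auto)
  also have "\<dots> = (\<Sum>M\<in>{M\<in>L. x \<in> M}. eig * (if z \<in> M then 1 else 0) + int \<alpha>)"
    by (intro sum.cong) auto
  also have "\<dots> = eig * joining x z + int \<alpha> * (int t + 1)"
    unfolding sum.distrib sum_distrib_left[symmetric] joining_sum
    using lines_on_point[OF x] by (simp add: mult.commute)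
  finally show ?thesis .
qed

lemma flag_count: "card L * (s + 1) = card P * (t + 1)"
proof -
  have "card L * (s + 1) = (\<Sum>M\<in>L. \<Sum>x\<in>P. if x \<in> M then 1 else 0)"
  proof -
    have "(\<Sum>x\<in>P. if x \<in> M then 1 else 0) = s + 1" if "M \<in> L" for M
    proof -
      have "P \<inter> M = M" using lines_subset[OF that] by auto
      then show ?thesis using finite_points points_on_line[OF that]
        by (simp add: sum.If_cases)
    qed
    then show ?thesis by simp
  qed
  also have "\<dots> = (\<Sum>x\<in>P. \<Sum>M\<in>L. if x \<in> M then 1 else 0)" by (rule sum.swap)
  also have "\<dots> = (\<Sum>x\<in>P. t + 1)"
    by (intro sum.cong refl) (use lines_on_point in \<open>simp add: sum.If_cases Int_def\<close>)
  finally show ?thesis by simp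
qed

end

locale singer_geometry = proper_partial_geometry P L s t \<alpha> + abelian_singer_group P L G
  for P :: "'a set" and L s t \<alpha> G +
  fixes o' :: 'a
  assumes base_point: "o' \<in> P"
begin

definition \<Gamma> :: "('a \<Rightarrow> 'a) monoid" where
  "\<Gamma> = geometry_AutoGroup P L\<lparr>carrier := G\<rparr>"

lemma carrier_\<Gamma> [simp]: "carrier \<Gamma> = G"
  by (simp add: \<Gamma>_def)

lemma G_auto: "g \<in> G \<Longrightarrow> g \<in> geometry_auto P L"
  using subgroup.subset[OF automorphisms] by (auto simp: geometry_AutoGroup_def)

lemma G_Bij: "g \<in> G \<Longrightarrow> g \<in> Bij P"
  using G_auto by (auto simp: geometry_auto_def)

lemma G_bij: "g \<in> G \<Longrightarrow> bij_betw g P P"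
  using G_Bij by (auto simp: Bij_def)

lemma G_lines: "g \<in> G \<Longrightarrow> (\<lambda>M. g ` M) ` L = L"
  using G_auto by (auto simp: geometry_auto_def geometry_iso_def)

lemma G_line: "g \<in> G \<Longrightarrow> M \<in> L \<Longrightarrow> g ` M \<in> L"
  using G_lines by blast

lemma G_point: "g \<in> G \<Longrightarrow> x \<in> P \<Longrightarrow> g x \<in> P"
  using G_bij bij_betwE by blast

lemma mult_apply: "g \<in> G \<Longrightarrow> h \<in> G \<Longrightarrow> x \<in> P \<Longrightarrow> (g \<otimes>\<^bsub>\<Gamma>\<^esub> h) x = g (h x)"
  using G_Bij by (simp add: \<Gamma>_def geometry_AutoGroup_def BijGroup_def compose_def)

lemma one_apply: "x \<in> P \<Longrightarrow> \<one>\<^bsub>\<Gamma>\<^esub> x = x"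
  by (simp add: \<Gamma>_def geometry_AutoGroup_def BijGroup_def)

lemma orbit_bij: "bij_betw (\<lambda>g. g o') G P"
proof (rule bij_betwI')
  fix g h assume "g \<in> G" "h \<in> G"
  then show "g o' = h o' \<longleftrightarrow> g = h"
    using sharply_transitive[OF base_point, of "g o'"] G_point base_point by auto
next
  fix y assume "y \<in> P"
  then show "\<exists>g\<in>G. y = g o'" using sharply_transitive[OF base_point] by blast
qed (use G_point base_point in auto)

lemma finite_G: "finite G"
  using orbit_bij finite_points bij_betw_finite by blast

sublocale \<Gamma>: finite_comm_group \<Gamma>
  using abelian finite_G by (simp add: \<Gamma>_def finite_comm_group_def finite_comm_group_axioms_def)

lemma G_closed: "\<one>\<^bsub>\<Gamma>\<^esub> \<in> G" "g \<in> G \<Longrightarrow> inv\<^bsub>\<Gamma>\<^esub> g \<in> G"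
    "g \<in> G \<Longrightarrow> h \<in> G \<Longrightarrow> g \<otimes>\<^bsub>\<Gamma>\<^esub> h \<in> G"
  using \<Gamma>.one_closed \<Gamma>.inv_closed[of g] \<Gamma>.m_closed[of g h] by simp_all

lemma order_\<Gamma>: "Coset.order \<Gamma> = card P"
  using bij_betw_same_card[OF orbit_bij] by (simp add: Coset.order_def)

lemma inv_apply: "g \<in> G \<Longrightarrow> x \<in> P \<Longrightarrow> (inv\<^bsub>\<Gamma>\<^esub> g) (g x) = x" "g \<in> G \<Longrightarrow> x \<in> P \<Longrightarrow> g ((inv\<^bsub>\<Gamma>\<^esub> g) x) = x"
  using mult_apply[of "inv\<^bsub>\<Gamma>\<^esub> g" g x] mult_apply[of g "inv\<^bsub>\<Gamma>\<^esub> g" x] \<Gamma>.inv_closed[of g]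
    \<Gamma>.l_inv[of g] \<Gamma>.r_inv[of g] one_apply[of x] by auto

lemma joining_invariant:
  assumes g: "g \<in> G" and xy: "x \<in> P" "y \<in> P"
  shows "joining (g x) (g y) = joining x y"
proof -
  have mem: "g z \<in> g ` M \<longleftrightarrow> z \<in> M" if "M \<in> L" "z \<in> P" for M z
    using G_bij[OF g] lines_subset[OF that(1)] that(2) by (auto simp: bij_betw_def inj_on_def)
  have inj: "inj_on (\<lambda>M. g ` M) L"
    using G_bij[OF g] lines_subset by (auto simp: inj_on_def bij_betw_def inj_on_image_eq_iff)
  have "{N \<in> L. g x \<in> N \<and> g y \<in> N} = (\<lambda>M. g ` M) ` {M \<in> L. x \<in> M \<and> y \<in> M}"
  proof (intro equalityI subsetI)
    fix N assume N: "N \<in> {N \<in> L. g x \<in> N \<and> g y \<in> N}"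
    then obtain M where "M \<in> L" "N = g ` M" using G_lines[OF g] by blast
    then show "N \<in> (\<lambda>M. g ` M) ` {M \<in> L. x \<in> M \<and> y \<in> M}" using N mem xy by blast
  qed (use G_line[OF g] in auto)
  then show ?thesis
    using inj by (simp add: joining_def card_image[OF inj_on_subset[OF inj]])
qed

definition T :: "('a \<Rightarrow> 'a) \<Rightarrow> int" where
  "T g = joining o' (g o')"

lemma T_one: "T \<one>\<^bsub>\<Gamma>\<^esub> = int t + 1"
  using base_point by (simp add: T_def one_apply joining_self)

lemma T_01: "g \<in> G \<Longrightarrow> g \<noteq> \<one>\<^bsub>\<Gamma>\<^esub> \<Longrightarrow> T g \<in> {0, 1}"
proof -
  assume g: "g \<in> G" "g \<noteq> \<one>\<^bsub>\<Gamma>\<^esub>"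
  then have "g o' \<noteq> \<one>\<^bsub>\<Gamma>\<^esub> o'"
    using orbit_bij \<Gamma>.one_closed by (auto simp: bij_betw_def inj_on_def)
  then show ?thesis unfolding T_def using base_point by (intro joining_le_1) (simp add: one_apply)
qed

lemma T_translate:
  assumes "g \<in> G" "h \<in> G"
  shows "T (inv\<^bsub>\<Gamma>\<^esub> g \<otimes>\<^bsub>\<Gamma>\<^esub> h) = joining (g o') (h o')"
proof -
  have i: "inv\<^bsub>\<Gamma>\<^esub> g \<in> G" using assms \<Gamma>.inv_closed by simp
  have "T (inv\<^bsub>\<Gamma>\<^esub> g \<otimes>\<^bsub>\<Gamma>\<^esub> h) = joining (g o') (g ((inv\<^bsub>\<Gamma>\<^esub> g) (h o')))"
    unfolding T_def mult_apply[OF i assms(2) base_point]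
    using joining_invariant[OF assms(1)] base_point G_point i assms by simp
  then show ?thesis by (simp add: inv_apply(2)[OF assms(1) G_point[OF assms(2) base_point]])
qed

lemma T_inv: "g \<in> G \<Longrightarrow> T (inv\<^bsub>\<Gamma>\<^esub> g) = T g"
  using T_translate[of g "\<one>\<^bsub>\<Gamma>\<^esub>"] \<Gamma>.one_closed \<Gamma>.inv_closed[of g] base_point
  by (simp add: one_apply T_def joining_sym)

lemma sum_T: "sum T G = (int s + 1) * (int t + 1)"
  using sum.reindex_bij_betw[OF orbit_bij, of "joining o'"] sum_joining[OF base_point]
  by (simp add: T_def)

lemma T_quadratic:
  assumes z: "z \<in> G"
  shows "\<Gamma>.conv T T z = eig * T z + int \<alpha> * (int t + 1)"
proof -
  have "\<Gamma>.conv T T z = (\<Sum>g\<in>G. joining o' (g o') * joining (g o') (z o'))"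
    unfolding \<Gamma>.conv_def carrier_\<Gamma>
    by (intro sum.cong refl) (simp add: T_translate z, simp add: T_def)
  also have "\<dots> = (\<Sum>y\<in>P. joining o' y * joining y (z o'))"
    by (rule sum.reindex_bij_betw[OF orbit_bij])
  finally show ?thesis
    using joining_quadratic[OF base_point, of "z o'"] z base_point G_point by (simp add: T_def)
qed

lemma point_count: "int \<alpha> * int (card P) = (int s + 1) * (int s * int t + int \<alpha>)"
proof -
  have "((int s + 1) * (int t + 1))\<^sup>2
      = eig * ((int s + 1) * (int t + 1)) + int (card P) * (int \<alpha> * (int t + 1))"
    using \<Gamma>.conv_quadratic_sum[of T eig "int \<alpha> * (int t + 1)"] T_quadratic sum_T order_\<Gamma> by simp
  then have "(int t + 1) * (int \<alpha> * int (card P))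
      = (int t + 1) * ((int s + 1) * (int s * int t + int \<alpha>))"
    by (simp add: algebra_simps power2_eq_square)
  then show ?thesis by simp
qed

lemma alpha_bounds: "1 \<le> int \<alpha>" "int \<alpha> < int s" "int \<alpha> < int t"
  using alpha_pos alpha_less by auto

text \<open>The left-hand side is the number of points collinear with neither of two given collinear points, which is positive; \<open>\<alpha>\<close>
  times it is \<open>t (s + 1 - \<alpha>) (s - \<alpha>)\<close>.\<close>
lemma complement_constant:
  "int (card P) - 2 * sum T G + int \<alpha> * (int t + 1) + eig \<noteq> 0"
proof
  assume "int (card P) - 2 * sum T G + int \<alpha> * (int t + 1) + eig = 0"
  then have "0 = int \<alpha> * (int (card P) - 2 * sum T G + int \<alpha> * (int t + 1) + eig)" by simp
  also have "\<dots> = int \<alpha> * int (card P) + int \<alpha> * (int \<alpha> * (int t + 1) + eig - 2 * sum T G)"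
    by (simp add: algebra_simps)
  also have "\<dots> = int t * ((int s + 1 - int \<alpha>) * (int s - int \<alpha>))"
    unfolding point_count sum_T by (simp add: algebra_simps)
  finally show False using alpha_bounds by simp
qed

text \<open>A prime dividing the eigenvalue difference but not the group order would make \<open>T\<close> constant modulo that prime, although
  both 0 and 1 occur as values.\<close>
lemma prime_dvd_card_iff:
  assumes p: "prime p"
  shows "p dvd card P \<longleftrightarrow> int p dvd eig"
proof
  assume "p dvd card P"
  then show "int p dvd eig"
    using \<Gamma>.prime_dvd_order_imp_dvd[OF p, of T eig "int \<alpha> * (int t + 1)"]
      T_quadratic T_01 complement_constant order_\<Gamma> alpha_bounds by simp
next
  assume d: "int p dvd eig"
  show "p dvd card P"
  proof (rule ccontr)
    assume "\<not> p dvd card P"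
    then have *: "int p dvd T x - T y" if "x \<in> G" "y \<in> G" for x y
      using \<Gamma>.conv_quadratic_cong[OF p, of 1 eig T "int \<alpha> * (int t + 1)" x y] that d T_quadratic
      by (simp add: order_\<Gamma>)
    have "\<exists>x\<in>G. x \<noteq> \<one>\<^bsub>\<Gamma>\<^esub> \<and> T x = i" if i: "i \<in> {0, 1}" for i
    proof (rule ccontr)
      assume "\<not> ?thesis"
      then have eq: "T x = 1 - i" if "x \<in> G - {\<one>\<^bsub>\<Gamma>\<^esub>}" for x using T_01[of x] that i by auto
      have "sum T G = T \<one>\<^bsub>\<Gamma>\<^esub> + (\<Sum>x\<in>G - {\<one>\<^bsub>\<Gamma>\<^esub>}. T x)"
        using finite_G \<Gamma>.one_closed by (intro sum.remove) auto
      also have "(\<Sum>x\<in>G - {\<one>\<^bsub>\<Gamma>\<^esub>}. T x) = int (card (G - {\<one>\<^bsub>\<Gamma>\<^esub>})) * (1 - i)"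
        using eq by simp
      finally have K: "int s * (int t + 1) = (int (card P) - 1) * (1 - i)"
        using sum_T T_one \<Gamma>.one_closed finite_G order_\<Gamma> \<Gamma>.order_gt_0'
        by (simp add: card_Diff_singleton Coset.order_def algebra_simps of_nat_diff)
      show False
      proof (cases "i = 1")
        case True
        then show False using K alpha_bounds by simp
      next
        case False
        then have "int (card P) = int s * (int t + 1) + 1" using K i by simp
        then have "int \<alpha> * (int s * (int t + 1) + 1) = (int s + 1) * (int s * int t + int \<alpha>)"
          using point_count by simp
        then have "int s * int t * (int s + 1 - int \<alpha>) = 0" by (simp add: algebra_simps)
        then show False using alpha_bounds by simp
      qed
    qed
    from this[of 0] this[of 1] obtain x y where "x \<in> G" "y \<in> G" "T x = 1" "T y = 0" by auto
    then have "int p dvd 1" using *[of x y] by simp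
    then show False using p not_prime_unit by simp
  qed
qed

lemma trace_condition: "eig dvd int (card P) * (int t + 1) - (int s + 1) * (int t + 1)"
  using \<Gamma>.conv_quadratic_trace_dvd[of T eig "int \<alpha> * (int t + 1)"] T_quadratic T_one sum_T order_\<Gamma>
    alpha_bounds by simp

end

locale rigid_singer_geometry = singer_geometry +
  assumes rigid: "rigid_type P L G"
begin

lemma line_stabilizer_trivial:
  assumes "g \<in> G" "M \<in> L" "g ` M = M"
  shows "g = \<one>\<^bsub>\<Gamma>\<^esub>"
  using rigid assms by (auto simp: rigid_type_def stabilizer_def \<Gamma>_def)

lemma mult_image: "g \<in> G \<Longrightarrow> h \<in> G \<Longrightarrow> M \<in> L \<Longrightarrow> (g \<otimes>\<^bsub>\<Gamma>\<^esub> h) ` M = g ` h ` M"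
  unfolding image_image by (intro image_cong refl mult_apply) (use lines_subset in auto)

lemma one_image: "M \<in> L \<Longrightarrow> \<one>\<^bsub>\<Gamma>\<^esub> ` M = M"
proof -
  assume "M \<in> L"
  then have "\<one>\<^bsub>\<Gamma>\<^esub> ` M = (\<lambda>x. x) ` M"
    by (intro image_cong refl one_apply) (use lines_subset in auto)
  then show ?thesis by simp
qed

definition line_orbit :: "'a set \<Rightarrow> 'a set set" where
  "line_orbit M = (\<lambda>g. g ` M) ` G"

lemma translate_eqD:
  assumes "g \<in> G" "h \<in> G" "M \<in> L" "N \<in> L" "g ` M = h ` N"
  shows "M = (inv\<^bsub>\<Gamma>\<^esub> g \<otimes>\<^bsub>\<Gamma>\<^esub> h) ` N"
proof -
  have i: "inv\<^bsub>\<Gamma>\<^esub> g \<in> G" using \<Gamma>.inv_closed assms by simp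
  have "(inv\<^bsub>\<Gamma>\<^esub> g \<otimes>\<^bsub>\<Gamma>\<^esub> h) ` N = (inv\<^bsub>\<Gamma>\<^esub> g) ` g ` M"
    using mult_image[OF i assms(2,4)] assms(5) by simp
  also have "\<dots> = (inv\<^bsub>\<Gamma>\<^esub> g \<otimes>\<^bsub>\<Gamma>\<^esub> g) ` M" using mult_image[OF i assms(1,3)] by simp
  also have "\<dots> = M" using assms one_image by simp
  finally show ?thesis by simp
qed

lemma card_line_orbit:
  assumes M: "M \<in> L"
  shows "card (line_orbit M) = card P"
proof -
  have "inj_on (\<lambda>g. g ` M) G"
  proof (rule inj_onI)
    fix g h assume gh: "g \<in> G" "h \<in> G" "g ` M = h ` M"
    have c: "inv\<^bsub>\<Gamma>\<^esub> g \<in> G" "inv\<^bsub>\<Gamma>\<^esub> g \<otimes>\<^bsub>\<Gamma>\<^esub> h \<in> G"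
      using gh \<Gamma>.inv_closed[of g] \<Gamma>.m_closed[of "inv\<^bsub>\<Gamma>\<^esub> g" h] by auto
    have "inv\<^bsub>\<Gamma>\<^esub> g \<otimes>\<^bsub>\<Gamma>\<^esub> h = \<one>\<^bsub>\<Gamma>\<^esub>"
      by (rule line_stabilizer_trivial[OF c(2) M]) (use translate_eqD[OF gh(1,2) M M gh(3)] in simp)
    then have "g \<otimes>\<^bsub>\<Gamma>\<^esub> (inv\<^bsub>\<Gamma>\<^esub> g \<otimes>\<^bsub>\<Gamma>\<^esub> h) = g" using gh by simp
    then show "g = h" using gh \<Gamma>.inv_cancel(1)[of g h] by simp
  qed
  then show ?thesis
    unfolding line_orbit_def using bij_betw_same_card[OF orbit_bij] by (simp add: card_image)
qed

lemma card_points_dvd_card_lines: "card P dvd card L"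
proof -
  have U: "\<Union> (line_orbit ` L) = L"
  proof
    show "\<Union> (line_orbit ` L) \<subseteq> L" using G_line by (auto simp: line_orbit_def)
    have "M \<in> line_orbit M" if "M \<in> L" for M
      unfolding line_orbit_def
      by (rule image_eqI[of _ _ "\<one>\<^bsub>\<Gamma>\<^esub>"]) (use one_image[OF that] \<Gamma>.one_closed in auto)
    then show "L \<subseteq> \<Union> (line_orbit ` L)" by blast
  qed
  have sub: "line_orbit M \<subseteq> line_orbit N"
    if M: "M \<in> L" and N: "N \<in> L" and K: "K \<in> line_orbit M" "K \<in> line_orbit N" for M N K
  proof -
    obtain g h where gh: "g \<in> G" "h \<in> G" "K = g ` M" "K = h ` N"
      using K by (auto simp: line_orbit_def)
    have c: "inv\<^bsub>\<Gamma>\<^esub> g \<otimes>\<^bsub>\<Gamma>\<^esub> h \<in> G"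
      using gh \<Gamma>.inv_closed[of g] \<Gamma>.m_closed[of "inv\<^bsub>\<Gamma>\<^esub> g" h] by auto
    have eq: "M = (inv\<^bsub>\<Gamma>\<^esub> g \<otimes>\<^bsub>\<Gamma>\<^esub> h) ` N"
      using translate_eqD[OF gh(1,2) M N] gh(3,4) by simp
    have "k ` M \<in> line_orbit N" if k: "k \<in> G" for k
    proof -
      have "k ` M = (k \<otimes>\<^bsub>\<Gamma>\<^esub> (inv\<^bsub>\<Gamma>\<^esub> g \<otimes>\<^bsub>\<Gamma>\<^esub> h)) ` N"
        using mult_image[OF k c N] eq by simp
      moreover have "k \<otimes>\<^bsub>\<Gamma>\<^esub> (inv\<^bsub>\<Gamma>\<^esub> g \<otimes>\<^bsub>\<Gamma>\<^esub> h) \<in> G"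
        using \<Gamma>.m_closed[of k] k c by simp
      ultimately show ?thesis unfolding line_orbit_def by blast
    qed
    then show ?thesis by (auto simp: line_orbit_def)
  qed
  have "card P dvd card (\<Union> (line_orbit ` L))"
  proof (rule dvd_partition)
    show "\<forall>C\<in>line_orbit ` L. card P dvd card C" using card_line_orbit by auto
    show "\<forall>C\<in>line_orbit ` L. \<forall>D\<in>line_orbit ` L. C \<noteq> D \<longrightarrow> C \<inter> D = {}"
      using sub by blast
  qed (simp add: U)
  then show ?thesis unfolding U .
qed

lemma line_orbit_count:
  obtains n where "card L = n * card P" "t + 1 = n * (s + 1)"
proof -
  obtain n where n: "card L = n * card P"
    using card_points_dvd_card_lines by (metis dvd_def mult.commute)
  have "card P * (n * (s + 1)) = card P * (t + 1)" using flag_count n by (simp add: algebra_simps)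
  moreover have "card P > 0" using finite_points points_nonempty by (simp add: card_gt_0_iff)
  ultimately have "t + 1 = n * (s + 1)" by (simp only: nat_mult_eq_cancel1)
  then show thesis using that n by blast
qed

lemma parameter_cases:
  assumes "\<alpha> \<ge> 2" "card P < 1000000"
  obtains n where "(int s + 1, int s - int \<alpha>, int n) \<in> set possible_params"
    "t + 1 = n * (s + 1)"
proof -
  obtain n where n: "t + 1 = n * (s + 1)" using line_orbit_count by metis
  then have tn: "int t + 1 = int n * (int s + 1)"
    by (metis of_nat_1 of_nat_add of_nat_mult)
  have n0: "n \<noteq> 0" using n by (cases n) auto
  have eig: "int n * (int s + 1) + (int s - int \<alpha>) = eig" using tn by simp
  have "(int s + 1, int s - int \<alpha>, int n) \<in> set possible_params"
  proof (rule possible_parameters[where v = "int (card P)"])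
    show "(int s + 1 - 1 - (int s - int \<alpha>)) * int (card P)
        = (int s + 1) * ((int s + 1 - 1) * int n * (int s + 1) - (int s - int \<alpha>))"
    proof -
      have "(int s + 1) * (int s * (int n * (int s + 1)) - (int s - int \<alpha>))
          = int \<alpha> * int (card P)"
        unfolding tn[symmetric] point_count by (simp add: algebra_simps)
      then show ?thesis by (simp add: ac_simps)
    qed
    show "int n * (int s + 1) + (int s - int \<alpha>) dvd
        int n * (int s + 1) * (int (card P) - (int s + 1))"
      unfolding eig unfolding tn[symmetric] using trace_condition by (simp add: algebra_simps)
    show "p dvd int (card P) \<longleftrightarrow> p dvd int n * (int s + 1) + (int s - int \<alpha>)" if p: "prime p" for p
    proof -
      obtain q where q: "p = int q" using prime_ge_0_int[OF p] nonneg_int_cases by blast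
      then show ?thesis
        using prime_dvd_card_iff[of q] p unfolding eig q by (simp add: int_dvd_int_iff)
    qed
  qed (use assms alpha_bounds n0 in auto)
  then show thesis using that n by blast
qed

text \<open>The condition on \<open>q ^ a\<close> makes 0 the class of the coefficients. Replacing \<open>N\<^sup>2\<close> by its tangent at \<open>x\<close> makes the inequality
  to be refuted linear in \<open>N\<close>.\<close>
lemma sylow_exclusion:
  fixes l x :: int
  assumes q: "prime q" "\<not> q dvd k" and v: "card P = q ^ e * k"
    and a: "int q ^ a dvd eig" "int q ^ a dvd (int s + 1) * (int t + 1)" "int q ^ a dvd l"
    and neg: "\<And>N. int t + 1 \<le> N \<Longrightarrow> N \<le> int t + int q ^ e \<Longrightarrow>
      eig * N + int \<alpha> * (int t + 1) * int q ^ e + x\<^sup>2 - 2 * x * N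
        - (2 * l + int q ^ a) * ((int s + 1) * (int t + 1) - N)
        + (int k - 1) * (l * (l + int q ^ a)) < 0"
  shows False
proof -
  obtain N where N: "int t + 1 \<le> N" "N < int t + 1 + int q ^ e"
      "int q ^ a dvd int k * N - sum T G"
      "\<And>l. int q ^ a dvd N - l \<Longrightarrow>
       0 \<le> eig * N + int \<alpha> * (int t + 1) * int q ^ e - N\<^sup>2 - (2 * l + int q ^ a) * (sum T G - N)
         + (int k - 1) * (l * (l + int q ^ a))"
    using \<Gamma>.sylow_quotient_inequality[OF q, of e a eig T "int \<alpha> * (int t + 1)" "int t + 1"]
      v a(1) T_quadratic T_01 T_one T_inv order_\<Gamma> by auto
  have "int q ^ a dvd (int k * N - sum T G) + sum T G"
    using N(3) a(2) unfolding sum_T by (rule dvd_add)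
  then have "int q ^ a dvd int k * N" by simp
  moreover have "coprime (int q ^ a) (int k)" using q by (simp add: prime_imp_coprime)
  ultimately have "int q ^ a dvd N" by (simp add: coprime_dvd_mult_right_iff)
  then have "int q ^ a dvd N - l" using a(3) by (rule dvd_diff)
  note N(4)[OF this, unfolded sum_T]
  moreover have "x\<^sup>2 - 2 * x * N \<ge> - N\<^sup>2"
    using zero_le_power2[of "N - x"] by (simp add: power2_eq_square algebra_simps)
  ultimately show False using neg[of N] N(1,2) by linarith
qed

lemma card_points_eqI:
  assumes "\<alpha> * k = (s + 1) * (s * t + \<alpha>)"
  shows "card P = k"
proof -
  have "int \<alpha> * int (card P) = int \<alpha> * int k"
    unfolding point_count using arg_cong[OF assms, of int] by (simp add: algebra_simps)
  then show ?thesis using alpha_pos by simp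
qed

text \<open>For each excluded triple the arguments are the prime \<open>q\<close>, the order of the quotient, the exponents of \<open>q\<close> in the number of points
  and in the eigenvalue difference, the multiple \<open>l\<close> of \<open>q ^ a\<close> just below the average coefficient, and a point
  \<open>x\<close> where the tangent is good enough on the whole interval.\<close>
lemma parameter_restriction:
  assumes "\<alpha> \<ge> 2" "card P < 1000000"
  shows "s = 5 \<and> t = 5 \<and> \<alpha> = 2 \<or> card P \<in> {1024, 4096, 194481}"
proof -
  obtain n where n: "(int s + 1, int s - int \<alpha>, int n) \<in> set possible_params"
    "t + 1 = n * (s + 1)" using parameter_cases[OF assms] .
  have "s = 5 \<and> \<alpha> = 2 \<and> n = 1 \<or>
      s = 11 \<and> \<alpha> = 3 \<and> n = 2 \<or>
      s = 19 \<and> \<alpha> = 4 \<and> n = 3 \<or>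
      s = 29 \<and> \<alpha> = 5 \<and> n = 4 \<or>
      s = 39 \<and> \<alpha> = 15 \<and> n = 1 \<or>
      s = 41 \<and> \<alpha> = 6 \<and> n = 5 \<or>
      s = 55 \<and> \<alpha> = 7 \<and> n = 6 \<or>
      s = 71 \<and> \<alpha> = 8 \<and> n = 7 \<or>
      s = 89 \<and> \<alpha> = 9 \<and> n = 8 \<or>
      s = 164 \<and> \<alpha> = 44 \<and> n = 2 \<or>
      s = 272 \<and> \<alpha> = 104 \<and> n = 1 \<or>
      s = 373 \<and> \<alpha> = 153 \<and> n = 2"
  proof -
    have "(s, \<alpha>, n) \<in> (\<lambda>(u, w, n). (nat (u - 1), nat (u - 1 - w), nat n)) ` set possible_params"
      by (rule image_eqI[OF _ n(1)]) simp
    then show ?thesis by (simp add: possible_params_def)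
  qed
  then consider
      "s = 5" "\<alpha> = 2" "n = 1" | "s = 11" "\<alpha> = 3" "n = 2" | "s = 19" "\<alpha> = 4" "n = 3"
    | "s = 29" "\<alpha> = 5" "n = 4" | "s = 39" "\<alpha> = 15" "n = 1" | "s = 41" "\<alpha> = 6" "n = 5"
    | "s = 55" "\<alpha> = 7" "n = 6" | "s = 71" "\<alpha> = 8" "n = 7" | "s = 89" "\<alpha> = 9" "n = 8"
    | "s = 164" "\<alpha> = 44" "n = 2" | "s = 272" "\<alpha> = 104" "n = 1" | "s = 373" "\<alpha> = 153" "n = 2"
    by (elim disjE conjE)
  then show ?thesis
  proof cases
    case 1
    then show ?thesis using n(2) by simp
  next
    case 2
    then show ?thesis using n(2) card_points_eqI[of 1024] by simp
  next
    case 3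
    then have *: "s = 19" "\<alpha> = 4" "t = 59" using n(2) by auto
    show ?thesis
      by (rule FalseE, rule sylow_exclusion[of 3 625 2 1 0 60])
         (use card_points_eqI[of 5625] in \<open>simp_all add: *\<close>)
  next
    case 4
    then have *: "s = 29" "\<alpha> = 5" "t = 119" using n(2) by auto
    show ?thesis
      by (rule FalseE, rule sylow_exclusion[of 3 256 4 2 9 120])
         (use card_points_eqI[of 20736] in \<open>simp_all add: *\<close>)
  next
    case 5
    then show ?thesis using n(2) card_points_eqI[of 4096] by simp
  next
    case 6
    then have *: "s = 41" "\<alpha> = 6" "t = 209" using n(2) by auto
    show ?thesis
      by (rule FalseE, rule sylow_exclusion[of 5 2401 2 1 0 210])
         (use card_points_eqI[of 60025] in \<open>simp_all add: *\<close>)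
  next
    case 7
    then have *: "s = 55" "\<alpha> = 7" "t = 335" using n(2) by auto
    show ?thesis
      by (rule FalseE, rule sylow_exclusion[of 3 16384 2 1 0 336])
         (use card_points_eqI[of 147456] in \<open>simp_all add: *\<close>)
  next
    case 8
    then have *: "s = 71" "\<alpha> = 8" "t = 503" using n(2) by auto
    show ?thesis
      by (rule FalseE, rule sylow_exclusion[of 7 6561 2 1 0 504])
         (use card_points_eqI[of 321489] in \<open>simp_all add: *\<close>)
  next
    case 9
    then have *: "s = 89" "\<alpha> = 9" "t = 719" using n(2) by auto
    show ?thesis
      by (rule FalseE, rule sylow_exclusion[of 5 1024 4 2 50 720])
         (use card_points_eqI[of 640000] in \<open>simp_all add: *\<close>)
  next
    case 10
    then have *: "s = 164" "\<alpha> = 44" "t = 329" using n(2) by auto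
    show ?thesis
      by (rule FalseE, rule sylow_exclusion[of 2 50625 2 1 0 330])
         (use card_points_eqI[of 202500] in \<open>simp_all add: *\<close>)
  next
    case 11
    then show ?thesis using n(2) card_points_eqI[of 194481] by simp
  next
    case 12
    then have *: "s = 373" "\<alpha> = 153" "t = 747" using n(2) by auto
    show ?thesis
      by (rule FalseE, rule sylow_exclusion[of 11 512 3 2 484 1028])
         (use card_points_eqI[of 681472] in \<open>simp_all add: *\<close>)
  qed
qed

end

section \<open>The base line of the geometry on 81 points\<close>

lemma residue_eqI:
  fixes x y :: int
  assumes "(x - y) mod 3 = 0" "x \<in> {0..<3}" "y \<in> {0..<3}"
  shows "x = y"
proof -
  have "3 dvd x - y" using assms(1) by (rule mod_0_imp_dvd)
  then show ?thesis using assms(2,3) unfolding atLeastLessThan_iff by presburger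
qed

lemma small_congruent_pair:
  fixes m n :: nat
  assumes "(int m + 2 * int n) mod 3 = 0" "m + n \<le> 6"
  shows "m = 0 \<and> n = 0 \<or> m = 6 \<or> n = 6 \<or> (m = 1 \<and> n = 1) \<or> (m = 2 \<and> n = 2) \<or>
    (m = 3 \<and> n = 3) \<or> (m = 3 \<and> n = 0) \<or> (n = 3 \<and> m = 0) \<or> (m = 4 \<and> n = 1) \<or> (n = 4 \<and> m = 1)"
proof -
  have "m \<in> {0, 1, 2, 3, 4, 5, 6}" using assms(2) by auto
  then show ?thesis using assms by (elim insertE emptyE; simp) presburger+
qed

text \<open>The base line \<open>D\<close> of the geometry, as a set of group elements. Its quotients are distinct because stabilizers are trivial and
  two points are on at most one line; \<open>coll x e\<close> says that \<open>x\<close> and \<open>e\<close> are collinear, \<open>two_coll\<close> is the condition \<open>\<alpha> = 2\<close>, and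
  \<open>coll_double\<close> holds because squaring preserves collinearity with the identity. Equations between quotients are written
  with products only.\<close>
locale van_lint_schrijver_set = finite_comm_group +
  fixes D :: "'a set"
  assumes D_carrier: "D \<subseteq> carrier G" and one_D: "\<one> \<in> D" and card_D: "card D = 6"
    and order_81: "order G = 81"
    and differences: "\<And>a b c d. \<lbrakk>a \<in> D; b \<in> D; c \<in> D; d \<in> D; a \<noteq> b; a \<otimes> d = c \<otimes> b\<rbrakk> \<Longrightarrow> a = c"
  fixes coll :: "'a \<Rightarrow> 'a \<Rightarrow> bool"
  defines "coll x e \<equiv> \<exists>a\<in>D. \<exists>b\<in>D. a \<noteq> b \<and> x \<otimes> b = e \<otimes> a"
  assumes two_coll: "\<And>x. x \<in> carrier G \<Longrightarrow> x \<notin> D \<Longrightarrow> card {e \<in> D. coll x e} = 2"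
    and coll_double: "\<And>b d y. \<lbrakk>b \<in> D; d \<in> D; b \<noteq> d; y \<in> carrier G; y \<otimes> b = d \<otimes> d\<rbrakk> \<Longrightarrow> coll y b"
begin

lemma D_closed [simp, intro]: "x \<in> D \<Longrightarrow> x \<in> carrier G"
  using D_carrier by auto

lemma finite_D: "finite D"
  using D_carrier finite_subset by blast

lemma three_coll_False:
  assumes "x \<in> carrier G" "x \<notin> D" "{a, b, c} \<subseteq> D" "coll x a" "coll x b" "coll x c"
    "a \<noteq> b" "a \<noteq> c" "b \<noteq> c"
  shows False
proof -
  have "card {a, b, c} \<le> card {e \<in> D. coll x e}"
    using assms finite_D by (intro card_mono) auto
  then show False using two_coll[OF assms(1,2)] assms by simp
qed

lemma collI: "a \<in> D \<Longrightarrow> b \<in> D \<Longrightarrow> a \<noteq> b \<Longrightarrow> x \<otimes> b = e \<otimes> a \<Longrightarrow> coll x e"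
  unfolding coll_def by blast

lemma square_inj:
  assumes "a \<in> carrier G" "b \<in> carrier G" "a \<otimes> a = b \<otimes> b"
  shows "a = b"
proof -
  have inj: "inj_on (\<lambda>x. x [^] (2::nat)) (carrier G)"
    by (rule pow_inj_on_coprime) (simp add: order_81)
  have sq: "x [^] (2::nat) = x \<otimes> x" if "x \<in> carrier G" for x
    using that by (simp add: numeral_2_eq_2)
  show ?thesis by (rule inj_onD[OF inj]) (simp_all only: sq assms)
qed

text \<open>The point \<open>y = d d b ^ (-1)\<close> is the reflection of \<open>b\<close> in \<open>d\<close>. It is collinear with \<open>d\<close>, and by doubling also with \<open>b\<close>.\<close>
lemma reflected_point_notin:
  assumes "b \<in> D" "d \<in> D" "b \<noteq> d" "y \<otimes> b = d \<otimes> d"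
  shows "y \<notin> D"
proof
  assume "y \<in> D"
  show False
  proof (cases "y = d")
    case True
    then have "b = d" using assms by simp
    then show False using assms by simp
  next
    case False
    then show False using differences[of y d d b] \<open>y \<in> D\<close> assms by simp
  qed
qed

text \<open>The two points of \<open>D\<close> collinear with the reflection \<open>y\<close> of \<open>b\<close> in \<open>d\<close> are \<open>b\<close> and \<open>d\<close>. The line joining \<open>y\<close> to \<open>b\<close> provides
  \<open>y c = b e\<close> with \<open>e\<close>, \<open>c\<close> in \<open>D\<close>. Here \<open>e\<close> is collinear with \<open>y\<close> too unless \<open>e = b\<close>, and the case \<open>e = d\<close>
  would repeat a quotient; so \<open>y\<close> is also the reflection of \<open>c\<close> in \<open>b\<close>.\<close>
lemma triple_point:
  assumes b: "b \<in> D" and d: "d \<in> D" and bd: "b \<noteq> d"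
  obtains c where "c \<in> D" "c \<otimes> (d \<otimes> d) = b \<otimes> (b \<otimes> b)"
proof -
  have [simp]: "b \<in> carrier G" "d \<in> carrier G" using b d by auto
  define y where "y = d \<otimes> d \<otimes> inv b"
  have y [simp]: "y \<in> carrier G" by (simp add: y_def)
  have yb: "y \<otimes> b = d \<otimes> d" by (simp add: y_def m_assoc)
  have yD: "y \<notin> D" using reflected_point_notin[OF b d bd yb] .
  have yd: "coll y d" by (rule collI[OF d b]) (use bd yb in auto)
  have "coll y b" by (rule coll_double[OF b d bd y yb])
  then obtain e c where e: "e \<in> D" "c \<in> D" "e \<noteq> c" "y \<otimes> c = b \<otimes> e" by (auto simp: coll_def)
  then have [simp]: "e \<in> carrier G" "c \<in> carrier G" by auto
  have "e = b"
  proof (rule ccontr)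
    assume eb: "e \<noteq> b"
    have "b \<noteq> c"
    proof
      assume "b = c"
      then have "c \<otimes> y = c \<otimes> e" using e(4) by (simp add: m_comm)
      then show False using yD e by simp
    qed
    then have "coll y e" using e b by (intro collI[of b c]) (auto simp: m_comm)
    then have "e = d" using three_coll_False[OF y yD, of b d e] b d e yd \<open>coll y b\<close> bd eb by auto
    have "y \<otimes> (c \<otimes> d) = (y \<otimes> c) \<otimes> d" by (simp add: m_assoc)
    also have "\<dots> = b \<otimes> (d \<otimes> d)" by (simp add: e(4) \<open>e = d\<close> m_assoc)
    also have "\<dots> = y \<otimes> (b \<otimes> b)" by (simp add: yb[symmetric] m_ac)
    finally have "c \<otimes> d = b \<otimes> b" by simp
    then show False using differences[of c b b d] b d e \<open>b \<noteq> c\<close> by auto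
  qed
  have "y \<otimes> (b \<otimes> (c \<otimes> (d \<otimes> d))) = (y \<otimes> c) \<otimes> (b \<otimes> (d \<otimes> d))" by (simp add: m_ac)
  also have "\<dots> = (b \<otimes> b) \<otimes> (b \<otimes> (y \<otimes> b))" by (simp only: e(4) \<open>e = b\<close> yb)
  also have "\<dots> = y \<otimes> (b \<otimes> (b \<otimes> (b \<otimes> b)))" by (simp add: m_ac)
  finally have "c \<otimes> (d \<otimes> d) = b \<otimes> (b \<otimes> b)" by simp
  then show thesis using that e by blast
qed

text \<open>Let \<open>x = b\<close>, a quotient of elements of \<open>D\<close>. By \<open>triple_point\<close> both \<open>x ^ 3\<close> and \<open>x ^ (-2)\<close> are in \<open>D\<close>, so \<open>x ^ 3\<close> occurs as the quotient of
  \<open>x ^ 3\<close> and \<open>\<one>\<close> and as that of \<open>x\<close> and \<open>x ^ (-2)\<close>. Unless \<open>x ^ 3 = \<one>\<close>, these would have to be the same pair.\<close>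
lemma cube_D:
  assumes b: "b \<in> D"
  shows "b \<otimes> (b \<otimes> b) = \<one>"
proof (cases "b = \<one>")
  case False
  have [simp]: "b \<in> carrier G" using b by auto
  obtain c where c: "c \<in> D" "c \<otimes> (\<one> \<otimes> \<one>) = b \<otimes> (b \<otimes> b)"
    using triple_point[OF b one_D False] .
  obtain c' where c': "c' \<in> D" "c' \<otimes> (b \<otimes> b) = \<one> \<otimes> (\<one> \<otimes> \<one>)"
    using triple_point[OF one_D b] False by auto
  have [simp]: "c \<in> carrier G" "c' \<in> carrier G" using c c' by auto
  have cb: "c = b \<otimes> (b \<otimes> b)" using c by simp
  have "c \<otimes> c' = b \<otimes> (c' \<otimes> (b \<otimes> b))" unfolding cb by (simp add: m_ac)
  then have cc: "c \<otimes> c' = b \<otimes> \<one>" using c' by simp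
  show ?thesis
  proof (cases "c = \<one>")
    case True
    then show ?thesis using cb by simp
  next
    case c1: False
    have "c = b" by (rule differences[OF c(1) one_D b c'(1) c1 cc])
    then have "b \<otimes> (b \<otimes> b) = b \<otimes> \<one>" using cb by simp
    then have "b \<otimes> b = \<one> \<otimes> \<one>" using Units_l_cancel[of b "b \<otimes> b" \<one>] by simp
    then have "b = \<one>" by (rule square_inj[rotated 2]) auto
    then show ?thesis using False by simp
  qed
qed simp

lemma cube:
  assumes x: "x \<in> carrier G"
  shows "x [^] (3::nat) = \<one>"
proof -
  have cube_D': "a [^] (3::nat) = \<one>" if "a \<in> D" for a
    using cube_D[OF that] that by (simp add: numeral_3_eq_3 m_assoc)
  show ?thesis
  proof (cases "x \<in> D")
    case False
    then have "{e \<in> D. coll x e} \<noteq> {}" using two_coll[OF x False] by (metis card.empty zero_neq_numeral)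
    then obtain e a b where e: "e \<in> D" "a \<in> D" "b \<in> D" "x \<otimes> b = e \<otimes> a"
      by (auto simp: coll_def)
    have "x [^] (3::nat) \<otimes> b [^] (3::nat) = (x \<otimes> b) [^] (3::nat)"
      using x e(3) by (intro nat_pow_distrib[symmetric]) auto
    also have "\<dots> = e [^] (3::nat) \<otimes> a [^] (3::nat)"
      unfolding e(4) using e by (intro nat_pow_distrib) auto
    finally show ?thesis using cube_D' e x by simp
  qed (use cube_D' in simp)
qed

text \<open>In additive notation, a relation \<open>a + a' = b + b'\<close> repeats a difference, and \<open>a1 + a2 + a3 = 0\<close> makes \<open>a1\<close> the reflection
  of \<open>a3\<close> in \<open>a2\<close>. In the cases of sizes \<open>(3, 3)\<close> and \<open>(4, 1)\<close> the point \<open>a1 + a2 - b\<close> is outside \<open>D\<close> but collinear with three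
  points of \<open>D\<close>, contrary to \<open>\<alpha> = 2\<close>.\<close>
lemma no_relation:
  assumes AB: "A \<subseteq> D" "B \<subseteq> D" "A \<inter> B = {}"
    and eq: "finprod G (\<lambda>x. x) A = finprod G (\<lambda>x. x) B"
    and card: "(card A, card B) \<in> {(1, 1), (2, 2), (3, 3), (3, 0), (4, 1)}"
  shows False
proof -
  have fA: "finite A" "finite B" using AB finite_D finite_subset by blast+
  consider "card A = 1" "card B = 1" | "card A = 2" "card B = 2" | "card A = 3" "card B = 3"
    | "card A = 3" "card B = 0" | "card A = 4" "card B = 1" using card by auto
  then show False
  proof cases
    case 1
    then obtain a b where ab: "A = {a}" "B = {b}" by (auto simp: card_1_singleton_iff)
    then have "a \<in> D" "b \<in> D" "a \<noteq> b" using AB by auto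
    then show False using eq ab by (simp add: Pi_def)
  next
    case 2
    then obtain a a' b b' where ab: "A = {a, a'}" "B = {b, b'}" "a \<noteq> a'" "b \<noteq> b'"
      by (auto simp: card_2_iff)
    then have D: "a \<in> D" "b \<in> D" "a' \<in> D" "b' \<in> D" and ne: "a \<noteq> b" "a \<noteq> b'" using AB by auto
    have "a \<otimes> a' = b' \<otimes> b" using eq ab D by (simp add: Pi_def m_comm)
    then show False using differences[of a b b' a'] D ne by simp
  next
    case 3
    then obtain a1 a2 a3 b1 b2 b3 where ab: "A = {a1, a2, a3}" "B = {b1, b2, b3}"
      "a1 \<noteq> a2" "a1 \<noteq> a3" "a2 \<noteq> a3" "b1 \<noteq> b2" "b1 \<noteq> b3" "b2 \<noteq> b3"
      by (auto simp: card_3_iff)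
    then have D: "a1 \<in> D" "a2 \<in> D" "a3 \<in> D" "b1 \<in> D" "b2 \<in> D" "b3 \<in> D"
      and ne: "a1 \<noteq> b1" "a1 \<noteq> b2" "a1 \<noteq> b3" "a2 \<noteq> b1" "a2 \<noteq> b2" "a2 \<noteq> b3" "a3 \<noteq> b2" "a3 \<noteq> b3"
      using AB by auto
    have [simp]: "a1 \<in> carrier G" "a2 \<in> carrier G" "a3 \<in> carrier G"
      "b1 \<in> carrier G" "b2 \<in> carrier G" "b3 \<in> carrier G" using D by auto
    have eq3: "a1 \<otimes> (a2 \<otimes> a3) = b1 \<otimes> (b2 \<otimes> b3)"
      using eq ab by (simp add: Pi_def)
    define x where "x = a1 \<otimes> a2 \<otimes> inv b1"
    have x [simp]: "x \<in> carrier G" by (simp add: x_def)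
    have xb: "x \<otimes> b1 = a1 \<otimes> a2" by (simp add: x_def m_assoc)
    have "b1 \<otimes> (x \<otimes> a3) = (x \<otimes> b1) \<otimes> a3" by (simp add: m_ac)
    also have "\<dots> = b1 \<otimes> (b2 \<otimes> b3)" using eq3 by (simp add: xb m_assoc)
    finally have xa: "x \<otimes> a3 = b2 \<otimes> b3" by simp
    have xD: "x \<notin> D"
    proof
      assume xD: "x \<in> D"
      show False
      proof (cases "x = a1")
        case True
        then show False using xb ne by simp
      next
        case False
        have "x = a2"
          by (rule differences[of x a1 a2 b1]) (use xD D False xb in \<open>auto simp: m_comm\<close>)
        then have "a2 \<otimes> b1 = a2 \<otimes> a1" using xb by (simp add: m_comm)
        then show False using ne by simp
      qed
    qed
    have "coll x a1" using xb D ne by (intro collI[of a2 b1]) auto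
    moreover have "coll x a2" using xb D ne by (intro collI[of a1 b1]) (auto simp: m_comm)
    moreover have "coll x b2" using xa D ne by (intro collI[of b3 a3]) auto
    ultimately show False using three_coll_False[OF x xD, of a1 a2 b2] D ne ab by auto
  next
    case 4
    then obtain a1 a2 a3 where ab: "A = {a1, a2, a3}" "B = {}" "a1 \<noteq> a2" "a1 \<noteq> a3" "a2 \<noteq> a3"
      using fA by (auto simp: card_3_iff)
    then have D: "a1 \<in> D" "a2 \<in> D" "a3 \<in> D" using AB by auto
    have [simp]: "a1 \<in> carrier G" "a2 \<in> carrier G" "a3 \<in> carrier G" using D by auto
    have "a1 \<otimes> (a2 \<otimes> a3) = \<one>" using eq ab by (simp add: Pi_def)
    then have "a2 \<otimes> (a1 \<otimes> a3) = a2 \<otimes> (a2 \<otimes> a2)" using cube_D[OF D(2)] by (simp add: m_ac)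
    then have "a1 \<otimes> a3 = a2 \<otimes> a2" by simp
    then show False using differences[of a1 a2 a2 a3] D ab by auto
  next
    case 5
    then obtain b where b: "B = {b}" by (auto simp: card_1_singleton_iff)
    obtain a4 A' where A': "A = insert a4 A'" "a4 \<notin> A'" "card A' = 3"
      using 5 card_Suc_eq[of A 3] by auto
    then obtain a1 a2 a3 where ab: "A' = {a1, a2, a3}" "a1 \<noteq> a2" "a1 \<noteq> a3" "a2 \<noteq> a3"
      by (auto simp: card_3_iff)
    have D: "a1 \<in> D" "a2 \<in> D" "a3 \<in> D" "a4 \<in> D" "b \<in> D" and
      ne: "a4 \<noteq> a1" "a4 \<noteq> a2" "a4 \<noteq> a3" "a1 \<noteq> b" "a2 \<noteq> b" using AB A' ab b by auto
    have [simp]: "a1 \<in> carrier G" "a2 \<in> carrier G" "a3 \<in> carrier G"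
      "a4 \<in> carrier G" "b \<in> carrier G" using D by auto
    have eq4: "a4 \<otimes> (a1 \<otimes> (a2 \<otimes> a3)) = b"
      using eq ab A' ne b by (simp add: Pi_def)
    define x where "x = a1 \<otimes> a2 \<otimes> inv b"
    have x [simp]: "x \<in> carrier G" by (simp add: x_def)
    have xb: "x \<otimes> b = a1 \<otimes> a2" by (simp add: x_def m_assoc)
    have "(a3 \<otimes> b) \<otimes> (x \<otimes> a4) = (x \<otimes> b) \<otimes> (a3 \<otimes> a4)" by (simp add: m_ac)
    also have "\<dots> = a4 \<otimes> (a1 \<otimes> (a2 \<otimes> a3))" unfolding xb by (simp add: m_ac)
    also have "\<dots> = b \<otimes> (a3 \<otimes> (a3 \<otimes> a3))" using eq4 cube_D[OF D(3)] by simp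
    also have "\<dots> = (a3 \<otimes> b) \<otimes> (a3 \<otimes> a3)" by (simp add: m_ac)
    finally have xa: "x \<otimes> a4 = a3 \<otimes> a3" by simp
    have xD: "x \<notin> D" by (rule reflected_point_notin[OF D(4,3) _ xa]) (use ne in simp)
    have "coll x a1" using xb D ne by (intro collI[of a2 b]) auto
    moreover have "coll x a2" using xb D ne by (intro collI[of a1 b]) (auto simp: m_comm)
    moreover have "coll x a3" using xa D ne by (intro collI[of a3 a4]) auto
    ultimately show False using three_coll_False[OF x xD, of a1 a2 a3] D ab by auto
  qed
qed

lemma int_pow_mod_3:
  assumes x: "x \<in> carrier G"
  shows "x [^] (c::int) = x [^] (c mod 3)"
proof -
  have "x [^] c = x [^] (3 * (c div 3) + c mod 3)" by simp
  also have "\<dots> = (x [^] (3::int)) [^] (c div 3) \<otimes> x [^] (c mod 3)"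
    using x by (simp only: int_pow_mult int_pow_pow)
  also have "x [^] (3::int) = \<one>"
    using cube[OF x] int_pow_int[of G x 3] by simp
  finally show ?thesis using x by simp
qed

text \<open>Modulo 3 an affine relation among the elements of \<open>D\<close> says that the product over the set \<open>A\<close> of elements with coefficient 1 equals
  the product over the set \<open>B\<close> of those with coefficient 2, where \<open>A\<close> and \<open>B\<close> have sizes congruent modulo 3. By
  \<open>no_relation\<close> this happens only when one of them is \<open>D\<close> or both are empty.\<close>
lemma exponents_all_congruent:
  fixes c :: "'a \<Rightarrow> int"
  assumes rel: "finprod G (\<lambda>x. x [^] c x) D = \<one>" and sum: "3 dvd sum c D"
  shows "\<exists>k. \<forall>x\<in>D. c x mod 3 = k"
proof -
  define A where "A = {x \<in> D. c x mod 3 = 1}"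
  define B where "B = {x \<in> D. c x mod 3 = 2}"
  have AB: "A \<subseteq> D" "B \<subseteq> D" "A \<inter> B = {}" by (auto simp: A_def B_def)
  have fin: "finite A" "finite B" using AB finite_D finite_subset by blast+
  have r: "c x mod 3 = 0 \<or> c x mod 3 = 1 \<or> c x mod 3 = 2" for x
    using pos_mod_bound[of 3 "c x"] pos_mod_sign[of 3 "c x"] by linarith
  have pw: "x [^] (0::int) = \<one>" "x [^] (1::int) = x" "x [^] (2::int) = x \<otimes> x"
    if "x \<in> carrier G" for x
    using that int_pow_int[of G x 2] by (simp_all add: numeral_2_eq_2)
  have "finprod G (\<lambda>x. x [^] c x \<otimes> (if x \<in> B then x else \<one>)) D
      = finprod G (\<lambda>x. x [^] c x) D \<otimes> finprod G (\<lambda>x. if x \<in> B then x else \<one>) D"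
    by (rule finprod_multf) auto
  then have "finprod G (\<lambda>x. if x \<in> B then x else \<one>) D
      = finprod G (\<lambda>x. x [^] c x \<otimes> (if x \<in> B then x else \<one>)) D"
    using rel by (simp add: Pi_def)
  also have "\<dots> = finprod G (\<lambda>x. if x \<in> A then x else \<one>) D"
  proof (rule finprod_cong')
    fix x assume x: "x \<in> D"
    then have xG: "x \<in> carrier G" by auto
    show "x [^] c x \<otimes> (if x \<in> B then x else \<one>) = (if x \<in> A then x else \<one>)"
      using r[of x] x xG cube_D[OF x]
      by (subst int_pow_mod_3[OF xG]) (auto simp: A_def B_def pw m_assoc)
  qed (auto simp: Pi_def)
  finally have "finprod G (\<lambda>x. if x \<in> A then x else \<one>) D = finprod G (\<lambda>x. if x \<in> B then x else \<one>) D" ..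
  moreover have "finprod G (\<lambda>x. x) C = finprod G (\<lambda>x. if x \<in> C then x else \<one>) D" if "C \<subseteq> D" for C
    by (rule finprod_mono_neutral_cong_left) (use that finite_D in auto)
  ultimately have prodAB: "finprod G (\<lambda>x. x) A = finprod G (\<lambda>x. x) B"
    using AB by simp
  have "sum (\<lambda>x. c x mod 3) D = (\<Sum>x\<in>D. (if x \<in> A then 1 else 0) + 2 * (if x \<in> B then 1 else 0))"
  proof (rule sum.cong[OF refl])
    fix x assume "x \<in> D"
    then show "c x mod 3 = (if x \<in> A then 1 else 0) + 2 * (if x \<in> B then 1 else 0)"
      using r[of x] by (auto simp: A_def B_def)
  qed
  also have "\<dots> = int (card A) + 2 * int (card B)"
  proof -
    have "D \<inter> A = A" "D \<inter> B = B" using AB by auto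
    then show ?thesis
      using finite_D unfolding sum.distrib sum_distrib_left[symmetric] by (simp add: sum.If_cases)
  qed
  finally have "int (card A) + 2 * int (card B) = sum (\<lambda>x. c x mod 3) D" ..
  moreover have "sum (\<lambda>x. c x mod 3) D mod 3 = 0"
    using sum by (simp add: mod_sum_eq)
  ultimately have mod3: "(int (card A) + 2 * int (card B)) mod 3 = 0" by simp
  have "card (A \<union> B) \<le> 6" using AB finite_D card_D card_mono[of D "A \<union> B"] by simp
  then have le: "card A + card B \<le> 6" using fin AB by (simp add: card_Un_disjoint)
  have A: "(card A, card B) \<notin> {(1, 1), (2, 2), (3, 3), (3, 0), (4, 1)}"
    using no_relation[OF AB prodAB] by blast
  have B: "(card B, card A) \<notin> {(1, 1), (2, 2), (3, 3), (3, 0), (4, 1)}"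
    using no_relation[OF AB(2,1) _ prodAB[symmetric]] AB(3) by blast
  have cases: "card A = 0 \<and> card B = 0 \<or> card A = 6 \<or> card B = 6"
    using small_congruent_pair[OF mod3 le] by (elim disjE) (use A B in simp_all)
  have full: "C = D" if "card C = 6" "C \<subseteq> D" for C
    using that card_D finite_D by (intro card_subset_eq) auto
  from cases consider "A = {}" "B = {}" | "A = D" | "B = D"
    using fin full AB by (elim disjE conjE) simp_all
  then show ?thesis
  proof cases
    case 1
    then have "\<forall>x\<in>D. c x mod 3 = 0" using r by (auto simp: A_def B_def)
    then show ?thesis by blast
  qed (auto simp: A_def B_def)
qed

definition word :: "'a \<Rightarrow> 'a \<Rightarrow> 'a \<Rightarrow> 'a \<Rightarrow> int \<times> int \<times> int \<times> int \<Rightarrow> 'a" where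
  "word a b c d = (\<lambda>(p, q, r, s). a [^] p \<otimes> (b [^] q \<otimes> (c [^] r \<otimes> d [^] s)))"

text \<open>Four of the elements of \<open>D\<close> other than the identity are independent, since a relation among them could be extended by coefficient 0 at
  the fifth; so they generate the group. The fifth is then a product of powers of them, and that relation has all coefficients
  equal.\<close>
lemma coordinates:
  obtains a b c d where "{a, b, c, d} \<subseteq> carrier G"
    "D = {\<one>, a, b, c, d, word a b c d (2, 2, 2, 2)}"
    "bij_betw (word a b c d) ({0..<3} \<times> {0..<3} \<times> {0..<3} \<times> {0..<3}) (carrier G)"
proof -
  have "card (D - {\<one>}) = 5" using one_D card_D by simp
  moreover obtain xs where xs: "set xs = D - {\<one>}" "distinct xs"
    using finite_distinct_list[of "D - {\<one>}"] finite_D by auto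
  ultimately have "length xs = Suc (Suc (Suc (Suc (Suc 0))))"
    using distinct_card[OF xs(2)] by simp
  then obtain a b c d e where abc: "xs = [a, b, c, d, e]"
    by (auto simp: length_Suc_conv)
  have D: "D = {\<one>, a, b, c, d, e}" using xs(1) one_D unfolding abc by auto
  have ne: "\<one> \<notin> {a, b, c, d, e}" using xs(1) unfolding abc by auto
  have dist: "distinct [a, b, c, d, e]" using xs(2) unfolding abc .
  have G [simp]: "a \<in> carrier G" "b \<in> carrier G" "c \<in> carrier G" "d \<in> carrier G" "e \<in> carrier G"
    using D by auto
  have rel: "p mod 3 = v mod 3 \<and> q mod 3 = v mod 3 \<and> r mod 3 = v mod 3 \<and> s mod 3 = v mod 3"
    if pqr: "word a b c d (p, q, r, s) \<otimes> e [^] v = \<one>" for p q r s v :: int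
  proof -
    define f where "f x = (if x = a then p else if x = b then q else if x = c then r
      else if x = d then s else if x = e then v else - (p + q + r + s + v))" for x
    have f: "f a = p" "f b = q" "f c = r" "f d = s" "f e = v" "f \<one> = - (p + q + r + s + v)"
      using dist ne by (auto simp: f_def)
    have "finprod G (\<lambda>x. x [^] f x) D = \<one>"
      using dist ne pqr unfolding D by (simp add: Pi_def f word_def m_assoc)
    moreover have "sum f D = 0"
      using dist ne unfolding D by (simp add: f)
    ultimately obtain k where "\<forall>x\<in>D. f x mod 3 = k" using exponents_all_congruent[of f] by auto
    then show ?thesis unfolding D by (simp add: f)
  qed
  have inj: "inj_on (word a b c d) ({0..<3} \<times> {0..<3} \<times> {0..<3} \<times> {0..<3})"
  proof (rule inj_onI)
    fix x y :: "int \<times> int \<times> int \<times> int"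
    assume xy: "x \<in> {0..<3} \<times> {0..<3} \<times> {0..<3} \<times> {0..<3}"
      "y \<in> {0..<3} \<times> {0..<3} \<times> {0..<3} \<times> {0..<3}" "word a b c d x = word a b c d y"
    obtain p q r s where x: "x = (p, q, r, s)" by (cases x)
    obtain p' q' r' s' where y: "y = (p', q', r', s')" by (cases y)
    have rng: "p \<in> {0..<3}" "q \<in> {0..<3}" "r \<in> {0..<3}" "s \<in> {0..<3}"
        "p' \<in> {0..<3}" "q' \<in> {0..<3}" "r' \<in> {0..<3}" "s' \<in> {0..<3}"
      using xy(1,2) unfolding x y by (simp_all only: mem_Sigma_iff)
    have eq: "word a b c d (p, q, r, s) = word a b c d (p', q', r', s')" using xy(3) unfolding x y .
    have mul: "word a b c d (p, q, r, s) = word a b c d (p - p', q - q', r - r', s - s') \<otimes> word a b c d (p', q', r', s')"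
    proof -
      have sp: "x [^] i = x [^] (i - j) \<otimes> x [^] j" if "x \<in> carrier G" for x and i j :: int
        using that int_pow_mult[of x "i - j" j] by simp
      show ?thesis
        unfolding word_def prod.case
        by (subst sp[of a p p'], simp, subst sp[of b q q'], simp, subst sp[of c r r'], simp,
            subst sp[of d s s'], simp) (simp add: m_ac)
    qed
    have w: "word a b c d t \<in> carrier G" for t by (cases t) (simp add: word_def)
    have "word a b c d (p - p', q - q', r - r', s - s') = \<one>"
      using mul eq w by (metis r_cancel_one')
    then have "word a b c d (p - p', q - q', r - r', s - s') \<otimes> e [^] (0::int) = \<one>" by simp
    note R = rel[OF this]
    have "p = p'" by (rule residue_eqI[OF _ rng(1,5)]) (use R in simp)
    moreover have "q = q'" by (rule residue_eqI[OF _ rng(2,6)]) (use R in simp)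
    moreover have "r = r'" by (rule residue_eqI[OF _ rng(3,7)]) (use R in simp)
    moreover have "s = s'" by (rule residue_eqI[OF _ rng(4,8)]) (use R in simp)
    ultimately show "x = y" unfolding x y by simp
  qed
  let ?Q = "{0..<3::int} \<times> {0..<3::int} \<times> {0..<3::int} \<times> {0..<3::int}"
  have sub: "word a b c d ` ?Q \<subseteq> carrier G" by (auto simp: word_def)
  have "card (word a b c d ` ?Q) = card (carrier G)"
    using card_image[OF inj] order_81 by (simp add: order_def)
  then have img: "word a b c d ` ?Q = carrier G" using sub by (intro card_subset_eq) auto
  then have bij: "bij_betw (word a b c d) ?Q (carrier G)" using inj by (simp add: bij_betw_def)
  have "e \<in> word a b c d ` ?Q" using img by simp
  then obtain p q r s where pqr: "(p, q, r, s) \<in> ?Q" "e = word a b c d (p, q, r, s)" by auto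
  have "word a b c d (p, q, r, s) \<otimes> e [^] (- 1 :: int) = \<one>"
    unfolding pqr(2)[symmetric] by (simp add: int_pow_neg)
  from rel[OF this] have "p = 2" "q = 2" "r = 2" "s = 2" using pqr(1) by auto
  then have "e = word a b c d (2, 2, 2, 2)" using pqr(2) by simp
  then show thesis using that[of a b c d] D bij G by simp
qed

end

section \<open>A field with 81 elements\<close>

text \<open>The quadruple \<open>(a, b, c, d)\<close> stands for \<open>a + b x + c x\<^sup>2 + d x\<^sup>3\<close> in the ring of integral polynomials modulo
  \<open>1 + x + x\<^sup>2 + x\<^sup>3 + x\<^sup>4\<close>, where \<open>x ^ 5 = 1\<close>. This polynomial is irreducible modulo 3, so reducing the
  coefficients modulo 3 gives the field with 81 elements.\<close>
type_synonym quad = "int \<times> int \<times> int \<times> int"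

definition quad_add :: "quad \<Rightarrow> quad \<Rightarrow> quad" where
  "quad_add = (\<lambda>(a, b, c, d) (a', b', c', d'). (a + a', b + b', c + c', d + d'))"

definition quad_mul :: "quad \<Rightarrow> quad \<Rightarrow> quad" where
  "quad_mul = (\<lambda>(a, b, c, d) (a', b', c', d').
     (a * a' - (b * d' + c * c' + d * b') + (c * d' + d * c'),
      a * b' + b * a' - (b * d' + c * c' + d * b') + d * d',
      a * c' + b * b' + c * a' - (b * d' + c * c' + d * b'),
      a * d' + b * c' + c * b' + d * a' - (b * d' + c * c' + d * b')))"

definition quad_mod :: "quad \<Rightarrow> quad" where
  "quad_mod = (\<lambda>(a, b, c, d). (a mod 3, b mod 3, c mod 3, d mod 3))"

text \<open>The automorphism with \<open>x \<mapsto> x ^ 3\<close>, which induces the Frobenius automorphism modulo 3.\<close>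
definition quad_frob :: "quad \<Rightarrow> quad" where
  "quad_frob = (\<lambda>(a, b, c, d). (a - d, c - d, - d, b - d))"

lemma quad_simps [simp]:
  "quad_add (a, b, c, d) (a', b', c', d') = (a + a', b + b', c + c', d + d')"
  "quad_mul (a, b, c, d) (a', b', c', d') =
     (a * a' - (b * d' + c * c' + d * b') + (c * d' + d * c'),
      a * b' + b * a' - (b * d' + c * c' + d * b') + d * d',
      a * c' + b * b' + c * a' - (b * d' + c * c' + d * b'),
      a * d' + b * c' + c * b' + d * a' - (b * d' + c * c' + d * b'))"
  "quad_mod (a, b, c, d) = (a mod 3, b mod 3, c mod 3, d mod 3)"
  by (simp_all add: quad_add_def quad_mul_def quad_mod_def)

text \<open>The product of the other three conjugates: multiplied by \<open>q\<close> it gives the norm of \<open>q\<close> modulo 3, so that checking that the norms of all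
  nonzero elements are 1 or 2 shows that these elements are invertible.\<close>
definition quad_conj :: "quad \<Rightarrow> quad" where
  "quad_conj q = quad_mul (quad_frob q)
     (quad_mul (quad_frob (quad_frob q)) (quad_frob (quad_frob (quad_frob q))))"

definition norm_test :: "quad \<Rightarrow> bool" where
  "norm_test q \<longleftrightarrow> quad_mod q = (0, 0, 0, 0) \<or>
     quad_mod (quad_mul q (quad_conj q)) = (1, 0, 0, 0) \<or>
     quad_mod (quad_mul q (quad_conj q)) = (2, 0, 0, 0)"

definition all_quads :: "quad list" where
  "all_quads = List.product [0, 1, 2] (List.product [0, 1, 2] (List.product [0, 1, 2] [0, 1, 2]))"

lemma norm_test_all_quads: "list_all norm_test all_quads"
  by code_simp

lemma norm_test_quad_mod: "norm_test (quad_mod q)"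
proof -
  have r: "x mod 3 \<in> set [0, 1, 2]" for x :: int
    using pos_mod_bound[of 3 x] pos_mod_sign[of 3 x] by (simp, linarith)
  have "quad_mod q \<in> set all_quads"
    by (cases q) (simp only: all_quads_def quad_simps set_product mem_Sigma_iff r simp_thms)
  then show ?thesis using norm_test_all_quads by (simp add: list_all_iff)
qed

text \<open>The elements of the field are numbered by the ternary digits of the numbers below 81.\<close>
definition encode :: "quad \<Rightarrow> nat" where
  "encode = (\<lambda>(a, b, c, d). nat (a mod 3 + 3 * (b mod 3 + 3 * (c mod 3 + 3 * (d mod 3)))))"

definition decode :: "nat \<Rightarrow> quad" where
  "decode n = (int n mod 3, int n div 3 mod 3, int n div 3 div 3 mod 3, int n div 3 div 3 div 3 mod 3)"

lemma encode_nonneg: "0 \<le> (a::int) mod 3 + 3 * (b mod 3 + 3 * (c mod 3 + 3 * (d mod 3)))"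
  by (intro add_nonneg_nonneg mult_nonneg_nonneg) simp_all

lemma encode_less: "encode q < 81"
proof (cases q)
  case (fields a b c d)
  have r: "x mod 3 \<le> 2" for x :: int using pos_mod_bound[of 3 x] by linarith
  have "x + 3 * (y + 3 * (z + 3 * u)) < 81" if "x \<le> 2" "y \<le> 2" "z \<le> 2" "u \<le> 2" for x y z u :: int
    using that by presburger
  then have "a mod 3 + 3 * (b mod 3 + 3 * (c mod 3 + 3 * (d mod 3))) < 81" using r by blast
  then show ?thesis
    unfolding fields encode_def prod.case by (simp only: nat_less_iff[OF encode_nonneg] of_nat_numeral)
qed

lemma decode_encode: "decode (encode q) = quad_mod q"
proof (cases q)
  case (fields a b c d)
  have step: "(x mod 3 + 3 * y) mod 3 = x mod 3" "(x mod 3 + 3 * y) div 3 = y" for x y :: int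
    by simp_all
  have "int (encode q) = a mod 3 + 3 * (b mod 3 + 3 * (c mod 3 + 3 * (d mod 3)))"
    unfolding fields encode_def prod.case by (rule nat_0_le[OF encode_nonneg])
  then show ?thesis by (simp only: fields decode_def step quad_simps) simp
qed

lemma encode_decode:
  assumes "n < 81"
  shows "encode (decode n) = n"
proof -
  have step: "x mod 3 + 3 * (x div 3) = x" for x :: int by simp
  have le: "3 * (x div 3) \<le> x" for x :: int
    using step[of x] pos_mod_sign[of 3 x] by linarith
  have "int n div 3 div 3 div 3 < 3"
    using assms le[of "int n"] le[of "int n div 3"] le[of "int n div 3 div 3"] by linarith
  then have "int n div 3 div 3 div 3 mod 3 = int n div 3 div 3 div 3"
    by (intro mod_pos_pos_trivial) (simp_all add: pos_imp_zdiv_nonneg_iff)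
  then have "int n mod 3 + 3 * (int n div 3 mod 3 + 3 * (int n div 3 div 3 mod 3
      + 3 * (int n div 3 div 3 div 3 mod 3))) = int n"
    by (simp only: step)
  then show ?thesis by (simp only: encode_def decode_def prod.case mod_mod_trivial nat_int)
qed

lemma encode_quad_mod: "encode (quad_mod q) = encode q"
  by (cases q) (simp add: encode_def)

lemma encode_eqI: "quad_mod p = quad_mod q \<Longrightarrow> encode p = encode q"
  by (metis encode_quad_mod)

lemma quad_mod_mul: "quad_mod (quad_mul (quad_mod p) q) = quad_mod (quad_mul p q)"
  by (cases p; cases q)
     (simp only: quad_simps prod.inject cong_def[symmetric],
      intro conjI cong_add cong_diff cong_mult cong_refl, simp_all only: cong_def mod_mod_trivial)

lemma quad_mod_add: "quad_mod (quad_add (quad_mod p) q) = quad_mod (quad_add p q)"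
  by (cases p; cases q) (simp add: mod_simps)

lemma quad_mul_commute: "quad_mul p q = quad_mul q p"
  by (cases p; cases q) (simp add: algebra_simps)

lemma quad_add_commute: "quad_add p q = quad_add q p"
  by (cases p; cases q) simp

lemma quad_mul_assoc: "quad_mul (quad_mul p q) r = quad_mul p (quad_mul q r)"
  by (cases p; cases q; cases r) (simp add: algebra_simps)

lemma quad_add_assoc: "quad_add (quad_add p q) r = quad_add p (quad_add q r)"
  by (cases p; cases q; cases r) simp

lemma quad_left_commute:
  "quad_mul p (quad_mul q r) = quad_mul q (quad_mul p r)"
  "quad_add p (quad_add q r) = quad_add q (quad_add p r)"
  by (metis quad_mul_assoc quad_mul_commute, metis quad_add_assoc quad_add_commute)

lemmas quad_ac = quad_mul_assoc quad_add_assoc quad_mul_commute quad_add_commute quad_left_commute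

lemma quad_distrib: "quad_mul (quad_add p q) r = quad_add (quad_mul p r) (quad_mul q r)"
  by (cases p; cases q; cases r) (simp add: algebra_simps)

lemma quad_units [simp]: "quad_add (0, 0, 0, 0) q = q" "quad_add q (0, 0, 0, 0) = q" "quad_mul (1, 0, 0, 0) q = q" "quad_mul q (1, 0, 0, 0) = q"
  by (cases q; simp)+

definition F81 :: "nat ring" where
  "F81 = \<lparr>carrier = {..<81}, monoid.mult = \<lambda>x y. encode (quad_mul (decode x) (decode y)),
     one = encode (1, 0, 0, 0), zero = encode (0, 0, 0, 0),
     add = \<lambda>x y. encode (quad_add (decode x) (decode y))\<rparr>"

lemma F81_simps:
  "carrier F81 = {..<81}" "\<one>\<^bsub>F81\<^esub> = encode (1, 0, 0, 0)" "\<zero>\<^bsub>F81\<^esub> = encode (0, 0, 0, 0)"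
  "encode p \<otimes>\<^bsub>F81\<^esub> encode q = encode (quad_mul p q)" "encode p \<oplus>\<^bsub>F81\<^esub> encode q = encode (quad_add p q)"
proof -
  show "encode p \<otimes>\<^bsub>F81\<^esub> encode q = encode (quad_mul p q)"
    by (simp add: F81_def decode_encode)
       (metis encode_eqI quad_mod_mul quad_mul_commute)
  show "encode p \<oplus>\<^bsub>F81\<^esub> encode q = encode (quad_add p q)"
    by (simp add: F81_def decode_encode)
       (metis encode_eqI quad_mod_add quad_add_commute)
qed (simp_all add: F81_def)

lemma F81_cases:
  assumes "x \<in> carrier F81" obtains q where "x = encode q" "quad_mod q = q"
proof -
  have "quad_mod (decode x) = decode x" by (simp add: decode_def)
  then show thesis using assms encode_decode[of x] that[of "decode x"] by (simp add: F81_simps)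
qed

lemma F81_cring: "cring F81"
proof (rule cringI)
  show "abelian_group F81"
  proof (rule abelian_groupI)
    fix x assume "x \<in> carrier F81"
    then obtain a b c d where x: "x = encode (a, b, c, d)" by (metis F81_cases prod_cases4)
    show "\<exists>y\<in>carrier F81. y \<oplus>\<^bsub>F81\<^esub> x = \<zero>\<^bsub>F81\<^esub>"
      by (rule bexI[of _ "encode (- a, - b, - c, - d)"]) (simp_all add: x F81_simps encode_less)
  qed ((elim F81_cases)?, simp add: F81_simps encode_less quad_ac)+
  show "comm_monoid F81"
    by (rule comm_monoidI)
       ((elim F81_cases)?, simp add: F81_simps encode_less quad_ac)+
qed (elim F81_cases, simp add: F81_simps quad_distrib)

lemma F81_inverse:
  assumes x: "x \<in> carrier F81" "x \<noteq> \<zero>\<^bsub>F81\<^esub>"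
  shows "\<exists>y\<in>carrier F81. x \<otimes>\<^bsub>F81\<^esub> y = \<one>\<^bsub>F81\<^esub>"
proof -
  obtain q where q: "x = encode q" "quad_mod q = q" using x(1) by (rule F81_cases)
  have "q \<noteq> (0, 0, 0, 0)" using x(2) q(1) by (auto simp: F81_simps)
  then consider "quad_mod (quad_mul q (quad_conj q)) = (1, 0, 0, 0)"
    | "quad_mod (quad_mul q (quad_conj q)) = (2, 0, 0, 0)"
    using norm_test_quad_mod[of q] q(2) by (auto simp: norm_test_def)
  then show ?thesis
  proof cases
    case 1
    then have "encode (quad_mul q (quad_conj q)) = encode (1, 0, 0, 0)" by (intro encode_eqI) simp
    then show ?thesis
      by (intro bexI[of _ "encode (quad_conj q)"]) (simp_all add: q(1) F81_simps encode_less)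
  next
    case 2
    have "quad_mul q (quad_add (quad_conj q) (quad_conj q))
        = quad_add (quad_mul q (quad_conj q)) (quad_mul q (quad_conj q))"
      by (metis quad_distrib quad_mul_commute)
    also have "quad_mod \<dots> = quad_mod (quad_add (2, 0, 0, 0) (2, 0, 0, 0))"
      by (metis 2 quad_mod_add quad_add_commute)
    also have "\<dots> = quad_mod (1, 0, 0, 0)" by simp
    finally have "encode (quad_mul q (quad_add (quad_conj q) (quad_conj q))) = encode (1, 0, 0, 0)"
      by (rule encode_eqI)
    then show ?thesis
      by (intro bexI[of _ "encode (quad_add (quad_conj q) (quad_conj q))"])
         (simp_all add: q(1) F81_simps encode_less)
  qed
qed

lemma F81_field: "field F81"
proof -
  interpret cring F81 by (rule F81_cring)
  have ne: "\<one>\<^bsub>F81\<^esub> \<noteq> \<zero>\<^bsub>F81\<^esub>" by (simp add: F81_simps encode_def)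
  have "Units F81 = carrier F81 - {\<zero>\<^bsub>F81\<^esub>}"
  proof
    show "Units F81 \<subseteq> carrier F81 - {\<zero>\<^bsub>F81\<^esub>}" using ne by (auto simp: Units_def)
    show "carrier F81 - {\<zero>\<^bsub>F81\<^esub>} \<subseteq> Units F81"
      using F81_inverse by (auto simp: Units_def m_comm)
  qed
  then show ?thesis by (rule cring_fieldI)
qed

abbreviation gamma81 :: nat where
  "gamma81 \<equiv> encode (0, 1, 0, 0)"

lemma gamma81_powers:
  "gamma81 [^]\<^bsub>F81\<^esub> (2::nat) = encode (0, 0, 1, 0)"
  "gamma81 [^]\<^bsub>F81\<^esub> (3::nat) = encode (0, 0, 0, 1)"
  "gamma81 [^]\<^bsub>F81\<^esub> (4::nat) = encode (2, 2, 2, 2)"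
  "gamma81 [^]\<^bsub>F81\<^esub> (5::nat) = \<one>\<^bsub>F81\<^esub>"
proof -
  interpret cring F81 by (rule F81_cring)
  have one: "encode (1, 0, 0, 0) \<otimes>\<^bsub>F81\<^esub> gamma81 = gamma81" by (simp add: F81_simps)
  have e: "encode (- 1, - 1, - 1, - 1) = encode (2, 2, 2, 2)" "encode (- 2, 0, 0, 0) = encode (1, 0, 0, 0)"
    by (simp_all add: encode_def)
  show "gamma81 [^]\<^bsub>F81\<^esub> (2::nat) = encode (0, 0, 1, 0)"
    "gamma81 [^]\<^bsub>F81\<^esub> (3::nat) = encode (0, 0, 0, 1)"
    "gamma81 [^]\<^bsub>F81\<^esub> (4::nat) = encode (2, 2, 2, 2)"
    "gamma81 [^]\<^bsub>F81\<^esub> (5::nat) = \<one>\<^bsub>F81\<^esub>"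
    by (simp_all add: eval_nat_numeral F81_simps e)
qed

lemma primitive_fifth_root_gamma81: "primitive_fifth_root F81 gamma81"
proof -
  interpret field F81 by (rule F81_field)
  interpret M: group "mult_of F81" by (rule field_mult_group)
  have g: "gamma81 \<in> carrier (mult_of F81)"
    by (simp add: carrier_mult_of F81_simps encode_less) (simp add: encode_def)
  have "gamma81 [^]\<^bsub>mult_of F81\<^esub> (5::nat) = \<one>\<^bsub>mult_of F81\<^esub>"
    using gamma81_powers(4) by (simp add: nat_pow_mult_of)
  then have "M.ord gamma81 dvd 5" using M.pow_eq_id[OF g] by blast
  moreover have "M.ord gamma81 \<noteq> 1"
  proof
    assume "M.ord gamma81 = 1"
    then have "gamma81 [^]\<^bsub>mult_of F81\<^esub> (1::nat) = \<one>\<^bsub>mult_of F81\<^esub>"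
      using M.pow_eq_id[OF g, of 1] by simp
    then have "gamma81 = \<one>\<^bsub>F81\<^esub>" using g M.nat_pow_Suc[of gamma81 0] by simp
    then show False by (simp add: F81_simps encode_def)
  qed
  moreover have "prime (5::nat)" by simp
  ultimately have "M.ord gamma81 = 5" by (metis prime_nat_iff)
  then show ?thesis using g by (simp add: primitive_fifth_root_def)
qed

lemma vLS_line_F81:
  "vLS_line F81 gamma81 (encode q) = (\<lambda>r. encode (quad_add q r)) `
     {(0, 0, 0, 0), (1, 0, 0, 0), (0, 1, 0, 0), (0, 0, 1, 0), (0, 0, 0, 1), (2, 2, 2, 2)}"
  by (simp add: vLS_line_def gamma81_powers F81_simps)

section \<open>Recognising the Van Lint--Schrijver geometry\<close>

text \<open>The Frobenius congruence for \<open>p = 2\<close>, with the constant determined by comparison at the identity.\<close>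
lemma (in finite_comm_group) conv_quadratic_square:
  assumes "odd (order G)" "odd m" and F: "\<And>z. z \<in> carrier G \<Longrightarrow> conv F F z = m * F z + c"
    and x: "x \<in> carrier G"
  shows "even (F (x [^] (2::nat)) - F x)"
proof -
  obtain d where d: "\<And>z. z \<in> carrier G \<Longrightarrow> conv_power F (Suc 1) z = m ^ 1 * F z + d"
    using conv_power_quadratic[OF F] by metis
  have inj: "inj_on (\<lambda>x. x [^] (2::nat)) (carrier G)"
    by (rule pow_inj_on_coprime) (use assms(1) in simp)
  have *: "even (m * F (y [^] (2::nat)) + d - F y)" if y: "y \<in> carrier G" for y
  proof -
    have "{x. x \<in> carrier G \<and> x [^] (2::nat) = y [^] (2::nat)} = {y}"
      using inj_onD[OF inj] y by auto
    then have "[conv_power F 2 (y [^] (2::nat)) = F y] (mod int 2)"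
      using conv_power_prime_cong[OF fin two_is_prime_nat, of "y [^] (2::nat)" F] y by simp
    moreover have "conv_power F 2 (y [^] (2::nat)) = m * F (y [^] (2::nat)) + d"
      using d[of "y [^] (2::nat)"] y by (simp add: numeral_2_eq_2)
    ultimately show ?thesis by (simp add: cong_iff_dvd_diff)
  qed
  from *[of \<one>] *[OF x] show ?thesis using assms(2) by simp presburger
qed

context rigid_singer_geometry
begin

declare G_closed [simp]

lemma joining_eq_1I:
  assumes "N \<in> L" "x \<in> N" "y \<in> N" "x \<noteq> y"
  shows "joining x y = 1"
proof -
  have "{M \<in> L. x \<in> M \<and> y \<in> M} \<noteq> {}" using assms by auto
  then have "joining x y \<noteq> 0" by (simp add: joining_def)
  then show ?thesis using joining_le_1[OF assms(4)] by auto
qed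

lemma joining_eq_1D:
  assumes "joining x y = 1"
  obtains N where "N \<in> L" "x \<in> N" "y \<in> N"
proof -
  have "{M \<in> L. x \<in> M \<and> y \<in> M} \<noteq> {}" using assms by (auto simp: joining_def simp del: Collect_empty_eq)
  then show thesis using that by blast
qed

lemma orbit_inj: "g \<in> G \<Longrightarrow> h \<in> G \<Longrightarrow> g o' = h o' \<longleftrightarrow> g = h"
  using orbit_bij by (auto simp: bij_betw_def inj_on_def)

text \<open>There are as many lines as points, so the lines form a single orbit, that of a line \<open>M0\<close> through the base point. The map sending \<open>1\<close> and the
  first three powers of the root of unity to the generators provided by \<open>coordinates\<close> extends to an isomorphism of the additive group
  of the field onto the Singer group, and it takes the line on 0 to \<open>M0\<close>: the fourth power of the root of unity is minus the sum of
  the smaller powers, as is the last element of the base line.\<close>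
lemma van_lint_schrijver_if_5_5_2:
  assumes s: "s = 5" and t: "t = 5" and \<alpha>: "\<alpha> = 2"
  shows "is_van_lint_schrijver P L"
proof -
  have card_P: "card P = 81" by (rule card_points_eqI) (simp add: s t \<alpha>)
  have card_L: "card L = 81" using flag_count by (simp add: s t card_P)
  obtain M0 where M0: "M0 \<in> L" "o' \<in> M0"
  proof -
    have "{M \<in> L. o' \<in> M} \<noteq> {}" using lines_on_point[OF base_point] by (metis card.empty add_is_0 one_neq_zero)
    then show thesis using that by blast
  qed
  have M0P: "M0 \<subseteq> P" using lines_subset[OF M0(1)] .
  have L_eq: "L = (\<lambda>g. g ` M0) ` G"
  proof -
    have "line_orbit M0 \<subseteq> L" using G_line M0 by (auto simp: line_orbit_def)
    then have "line_orbit M0 = L"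
      using card_line_orbit[OF M0(1)] card_P card_L by (intro card_subset_eq) auto
    then show ?thesis by (simp add: line_orbit_def)
  qed
  define D where "D = {g \<in> G. g o' \<in> M0}"
  have DG: "g \<in> G" if "g \<in> D" for g using that by (simp add: D_def)
  have D_image: "(\<lambda>g. g o') ` D = M0"
    using bij_betw_imp_surj_on[OF orbit_bij] M0P by (auto simp: D_def)
  have D_inj: "inj_on (\<lambda>g. g o') D"
    using orbit_bij by (auto simp: bij_betw_def D_def intro: inj_on_subset)
  have mG: "g \<otimes>\<^bsub>\<Gamma>\<^esub> h \<in> G" if "g \<in> G" "h \<in> G" for g h using \<Gamma>.m_closed[of g h] that by simp
  have iG: "inv\<^bsub>\<Gamma>\<^esub> g \<in> G" if "g \<in> G" for g using \<Gamma>.inv_closed[of g] that by simp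
  have app: "(g \<otimes>\<^bsub>\<Gamma>\<^esub> h) o' = g (h o')" if "g \<in> G" "h \<in> G" for g h
    using mult_apply[OF that base_point] .
  define coll where "coll x e \<longleftrightarrow> (\<exists>a\<in>D. \<exists>b\<in>D. a \<noteq> b \<and> x \<otimes>\<^bsub>\<Gamma>\<^esub> b = e \<otimes>\<^bsub>\<Gamma>\<^esub> a)" for x e
  have collI: "coll x e" if x: "x \<in> G" and e: "e \<in> G" and xe: "x \<noteq> e" and j: "joining (e o') (x o') = 1" for x e
  proof -
    obtain N where N: "N \<in> L" "e o' \<in> N" "x o' \<in> N" using joining_eq_1D[OF j] .
    obtain h where h: "h \<in> G" "N = h ` M0" using N(1) unfolding L_eq by auto
    obtain a b where ab: "a \<in> D" "b \<in> D" "e o' = h (a o')" "x o' = h (b o')"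
      using N(2,3) unfolding h(2) D_image[symmetric] by auto
    have ea: "e = h \<otimes>\<^bsub>\<Gamma>\<^esub> a" "x = h \<otimes>\<^bsub>\<Gamma>\<^esub> b"
      using ab app[OF h(1) DG] orbit_inj[OF e mG[OF h(1) DG]] orbit_inj[OF x mG[OF h(1) DG]] by auto
    have "x \<otimes>\<^bsub>\<Gamma>\<^esub> a = e \<otimes>\<^bsub>\<Gamma>\<^esub> b"
      unfolding ea using h(1) ab DG by (simp add: \<Gamma>.m_ac)
    moreover have "b \<noteq> a" using xe ea by auto
    ultimately show ?thesis unfolding coll_def using ab by blast
  qed
  have collD: "x \<noteq> e \<and> joining (x o') (e o') = 1" if x: "x \<in> G" and e: "e \<in> G" and c: "coll x e" for x e
  proof -
    obtain a b where ab: "a \<in> D" "b \<in> D" "a \<noteq> b" "x \<otimes>\<^bsub>\<Gamma>\<^esub> b = e \<otimes>\<^bsub>\<Gamma>\<^esub> a"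
      using c by (auto simp: coll_def)
    have abG: "a \<in> G" "b \<in> G" using ab DG by auto
    have xe: "x \<noteq> e" using ab(3,4) abG x e by auto
    define h where "h = e \<otimes>\<^bsub>\<Gamma>\<^esub> inv\<^bsub>\<Gamma>\<^esub> b"
    have hG: "h \<in> G" unfolding h_def using mG iG e abG by blast
    have "h \<otimes>\<^bsub>\<Gamma>\<^esub> b = e" unfolding h_def using e abG by (simp add: \<Gamma>.m_assoc)
    moreover have "h \<otimes>\<^bsub>\<Gamma>\<^esub> a = x"
    proof -
      have "h \<otimes>\<^bsub>\<Gamma>\<^esub> a = (e \<otimes>\<^bsub>\<Gamma>\<^esub> a) \<otimes>\<^bsub>\<Gamma>\<^esub> inv\<^bsub>\<Gamma>\<^esub> b"
        unfolding h_def using e abG by (simp add: \<Gamma>.m_ac)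
      also have "\<dots> = x" unfolding ab(4)[symmetric] using x abG by (simp add: \<Gamma>.m_assoc)
      finally show ?thesis .
    qed
    ultimately have "e o' = h (b o')" "x o' = h (a o')" using app[OF hG] abG by auto
    then have "e o' \<in> h ` M0" "x o' \<in> h ` M0" using ab by (auto simp: D_def)
    then show ?thesis
      using joining_eq_1I[OF G_line[OF hG M0(1)]] xe orbit_inj[OF x e] by auto
  qed
  have odd: "odd (Coset.order \<Gamma>)" by (simp add: order_\<Gamma> card_P)
  have eig9: "eig = 9" by (simp add: s t \<alpha>)
  have T_square: "T (g [^]\<^bsub>\<Gamma>\<^esub> (2::nat)) = T g" if g: "g \<in> G" "g \<noteq> \<one>\<^bsub>\<Gamma>\<^esub>" for g
  proof -
    have "even (T (g [^]\<^bsub>\<Gamma>\<^esub> (2::nat)) - T g)"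
      by (rule \<Gamma>.conv_quadratic_square[OF odd, where m = 9 and c = "int \<alpha> * (int t + 1)"])
         (use T_quadratic[unfolded eig9] g in simp_all)
    moreover have "g [^]\<^bsub>\<Gamma>\<^esub> (2::nat) \<noteq> \<one>\<^bsub>\<Gamma>\<^esub>"
      using inj_onD[OF \<Gamma>.pow_inj_on_coprime[of 2], of g "\<one>\<^bsub>\<Gamma>\<^esub>"] odd g \<Gamma>.one_closed by auto
    then have "T (g [^]\<^bsub>\<Gamma>\<^esub> (2::nat)) \<in> {0, 1}" using T_01 g \<Gamma>.nat_pow_closed[of g 2] by simp
    moreover have "T g \<in> {0, 1}" using T_01 g by simp
    ultimately show ?thesis by auto
  qed
  have "van_lint_schrijver_set \<Gamma> D"
  proof unfold_locales
    show "D \<subseteq> carrier \<Gamma>" using DG by auto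
    show "\<one>\<^bsub>\<Gamma>\<^esub> \<in> D" using \<Gamma>.one_closed M0 base_point by (simp add: D_def one_apply)
    show "card D = 6" using card_image[OF D_inj] D_image points_on_line[OF M0(1)] by (simp add: s)
    show "Coset.order \<Gamma> = 81" by (simp add: order_\<Gamma> card_P)
  next
    fix a b c d
    assume D: "a \<in> D" "b \<in> D" "c \<in> D" "d \<in> D" and ne: "a \<noteq> b"
      and eq: "a \<otimes>\<^bsub>\<Gamma>\<^esub> d = c \<otimes>\<^bsub>\<Gamma>\<^esub> b"
    have G: "a \<in> G" "b \<in> G" "c \<in> G" "d \<in> G" using D DG by auto
    define g where "g = c \<otimes>\<^bsub>\<Gamma>\<^esub> inv\<^bsub>\<Gamma>\<^esub> a"
    have gG: "g \<in> G" unfolding g_def using mG iG G by blast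
    have ga: "g \<otimes>\<^bsub>\<Gamma>\<^esub> a = c" unfolding g_def using G by (simp add: \<Gamma>.m_assoc)
    have gb: "g \<otimes>\<^bsub>\<Gamma>\<^esub> b = d"
    proof -
      have "g \<otimes>\<^bsub>\<Gamma>\<^esub> b = inv\<^bsub>\<Gamma>\<^esub> a \<otimes>\<^bsub>\<Gamma>\<^esub> (c \<otimes>\<^bsub>\<Gamma>\<^esub> b)"
        unfolding g_def using G by (simp add: \<Gamma>.m_ac)
      then show ?thesis using G unfolding eq[symmetric] by (simp add: \<Gamma>.inv_cancel)
    qed
    have cd: "c \<noteq> d"
    proof
      assume "c = d"
      then show False using ga gb ne G gG by auto
    qed
    have "g ` M0 = M0"
    proof (rule ccontr)
      assume "g ` M0 \<noteq> M0"
      then have "card (g ` M0 \<inter> M0) \<le> 1" using lines_meet[OF G_line[OF gG M0(1)] M0(1)] by blast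
      moreover have "{c o', d o'} \<subseteq> g ` M0 \<inter> M0"
        using D app[OF gG, of a] app[OF gG, of b] G unfolding ga gb by (auto simp: D_def)
      then have "card {c o', d o'} \<le> card (g ` M0 \<inter> M0)"
        using finite_line[OF M0(1)] by (intro card_mono) auto
      ultimately show False using cd orbit_inj[OF G(3,4)] by simp
    qed
    then have "g = \<one>\<^bsub>\<Gamma>\<^esub>" by (rule line_stabilizer_trivial[OF gG M0(1)])
    then show "a = c" using ga G by simp
  next
    fix x assume x: "x \<in> carrier \<Gamma>" "x \<notin> D"
    then have xG: "x \<in> G" and xM: "x o' \<notin> M0" by (auto simp: D_def)
    have "int (card {e \<in> D. coll x e}) = (\<Sum>e\<in>D. joining (x o') (e o'))"
    proof -
      have "(\<Sum>e\<in>D. joining (x o') (e o')) = (\<Sum>e\<in>D. if coll x e then 1 else 0)"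
      proof (rule sum.cong[OF refl])
        fix e assume e: "e \<in> D"
        then have xe: "x \<noteq> e" using x(2) by auto
        then have "joining (x o') (e o') \<in> {0, 1}"
          using joining_le_1 orbit_inj[OF xG DG[OF e]] by blast
        then show "joining (x o') (e o') = (if coll x e then 1 else 0)"
          using collI[OF xG DG[OF e] xe] collD[OF xG DG[OF e]] joining_sym[of "x o'" "e o'"] by auto
      qed
      moreover have "finite D" using finite_G DG by (meson finite_subset subsetI)
      ultimately show ?thesis by (simp add: sum.If_cases Int_def)
    qed
    also have "\<dots> = (\<Sum>y\<in>M0. joining (x o') y)"
      using sum.reindex[OF D_inj, of "joining (x o')"] unfolding D_image by simp
    also have "\<dots> = 2"
      using sum_joining_line[OF M0(1) G_point[OF xG base_point]] xM by (simp add: \<alpha>)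
    finally have "card {e \<in> D. coll x e} = 2" by simp
    then show "card {e \<in> D. \<exists>a\<in>D. \<exists>b\<in>D. a \<noteq> b \<and> x \<otimes>\<^bsub>\<Gamma>\<^esub> b = e \<otimes>\<^bsub>\<Gamma>\<^esub> a} = 2"
      by (simp add: coll_def)
  next
    fix b d y
    assume D: "b \<in> D" "d \<in> D" "b \<noteq> d" and y: "y \<in> carrier \<Gamma>" and yb: "y \<otimes>\<^bsub>\<Gamma>\<^esub> b = d \<otimes>\<^bsub>\<Gamma>\<^esub> d"
    have G: "b \<in> G" "d \<in> G" "y \<in> G" using D DG y by auto
    define g where "g = inv\<^bsub>\<Gamma>\<^esub> b \<otimes>\<^bsub>\<Gamma>\<^esub> d"
    have gG: "g \<in> G" unfolding g_def using mG iG G by blast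
    have sq: "x [^]\<^bsub>\<Gamma>\<^esub> (2::nat) = x \<otimes>\<^bsub>\<Gamma>\<^esub> x" if "x \<in> G" for x
      using that by (simp add: numeral_2_eq_2)
    have bg: "b \<otimes>\<^bsub>\<Gamma>\<^esub> g = d" unfolding g_def using G by (simp add: \<Gamma>.inv_cancel)
    have g1: "g \<noteq> \<one>\<^bsub>\<Gamma>\<^esub>" using bg D(3) G by auto
    have g2: "g [^]\<^bsub>\<Gamma>\<^esub> (2::nat) = inv\<^bsub>\<Gamma>\<^esub> b \<otimes>\<^bsub>\<Gamma>\<^esub> y"
    proof -
      have "b \<otimes>\<^bsub>\<Gamma>\<^esub> (b \<otimes>\<^bsub>\<Gamma>\<^esub> (g \<otimes>\<^bsub>\<Gamma>\<^esub> g)) = (b \<otimes>\<^bsub>\<Gamma>\<^esub> g) \<otimes>\<^bsub>\<Gamma>\<^esub> (b \<otimes>\<^bsub>\<Gamma>\<^esub> g)"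
        using G gG by (simp add: \<Gamma>.m_ac)
      also have "\<dots> = b \<otimes>\<^bsub>\<Gamma>\<^esub> y" unfolding bg yb[symmetric] using G by (simp add: \<Gamma>.m_comm)
      finally have "b \<otimes>\<^bsub>\<Gamma>\<^esub> (g \<otimes>\<^bsub>\<Gamma>\<^esub> g) = y" using G gG mG by simp
      then show ?thesis using G gG sq \<Gamma>.inv_cancel(2)[of b "g \<otimes>\<^bsub>\<Gamma>\<^esub> g"] mG by auto
    qed
    have "joining (b o') (d o') = 1"
      by (rule joining_eq_1I[OF M0(1)]) (use D orbit_inj[OF G(1,2)] in \<open>auto simp: D_def\<close>)
    then have "T g = 1" unfolding g_def using T_translate[OF G(1,2)] by simp
    then have "T (inv\<^bsub>\<Gamma>\<^esub> b \<otimes>\<^bsub>\<Gamma>\<^esub> y) = 1" using T_square[OF gG g1] g2 by simp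
    then have j: "joining (b o') (y o') = 1" using T_translate[OF G(1,3)] by simp
    have "y \<noteq> b"
    proof
      assume "y = b"
      then have "joining (b o') (b o') = 1" using j by simp
      then show False using joining_self[OF G_point[OF G(1) base_point]] t by simp
    qed
    then have "coll y b" by (rule collI[OF G(3,1) _ j])
    then show "\<exists>a\<in>D. \<exists>c\<in>D. a \<noteq> c \<and> y \<otimes>\<^bsub>\<Gamma>\<^esub> c = b \<otimes>\<^bsub>\<Gamma>\<^esub> a" by (simp add: coll_def)
  qed
  then interpret V: van_lint_schrijver_set \<Gamma> D "\<lambda>x e. \<exists>a\<in>D. \<exists>b\<in>D. a \<noteq> b \<and> x \<otimes>\<^bsub>\<Gamma>\<^esub> b = e \<otimes>\<^bsub>\<Gamma>\<^esub> a"
    by simp_all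
  obtain a b c d where abcd: "{a, b, c, d} \<subseteq> carrier \<Gamma>"
    "D = {\<one>\<^bsub>\<Gamma>\<^esub>, a, b, c, d, V.word a b c d (2, 2, 2, 2)}"
    "bij_betw (V.word a b c d) ({0..<3} \<times> {0..<3} \<times> {0..<3} \<times> {0..<3}) (carrier \<Gamma>)"
    by (rule V.coordinates)
  define W where "W = V.word a b c d"
  have abcdG: "a \<in> carrier \<Gamma>" "b \<in> carrier \<Gamma>" "c \<in> carrier \<Gamma>" "d \<in> carrier \<Gamma>" using abcd(1) by auto
  have W_add: "W (quad_add p q) = W p \<otimes>\<^bsub>\<Gamma>\<^esub> W q" for p q
  proof (cases p; cases q)
    fix p1 p2 p3 p4 q1 q2 q3 q4 :: int
    assume pq: "p = (p1, p2, p3, p4)" "q = (q1, q2, q3, q4)"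
    show ?thesis unfolding pq W_def V.word_def quad_simps prod.case
      using abcdG by (simp add: \<Gamma>.int_pow_mult \<Gamma>.m_ac del: carrier_\<Gamma>)
  qed
  have W_mod: "W (quad_mod q) = W q" for q
  proof (cases q)
    case (fields q1 q2 q3 q4)
    show ?thesis unfolding fields W_def V.word_def quad_simps prod.case
      by (simp only: V.int_pow_mod_3[OF abcdG(1), of q1] V.int_pow_mod_3[OF abcdG(2), of q2]
          V.int_pow_mod_3[OF abcdG(3), of q3] V.int_pow_mod_3[OF abcdG(4), of q4])
  qed
  have WG: "W q \<in> G" for q
  proof -
    have "W q \<in> carrier \<Gamma>"
      using abcdG by (cases q) (simp add: W_def V.word_def del: carrier_\<Gamma>)
    then show ?thesis by simp
  qed
  have W_D: "W ` {(0, 0, 0, 0), (1, 0, 0, 0), (0, 1, 0, 0), (0, 0, 1, 0), (0, 0, 0, 1), (2, 2, 2, 2)} = D"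
  proof -
    have "W (0, 0, 0, 0) = \<one>\<^bsub>\<Gamma>\<^esub>" "W (1, 0, 0, 0) = a" "W (0, 1, 0, 0) = b" "W (0, 0, 1, 0) = c"
      "W (0, 0, 0, 1) = d"
      unfolding W_def V.word_def prod.case using abcdG by (simp_all del: carrier_\<Gamma>)
    then show ?thesis unfolding abcd(2) W_def[symmetric] by simp
  qed
  let ?Q = "{0..<3::int} \<times> {0..<3::int} \<times> {0..<3::int} \<times> {0..<3::int}"
  have bij_decode: "bij_betw decode {..<81} ?Q"
  proof (rule bij_betwI[where g = encode])
    show "decode \<in> {..<81} \<rightarrow> ?Q" by (auto simp: decode_def)
    show "encode \<in> ?Q \<rightarrow> {..<81}" using encode_less by auto
    show "encode (decode n) = n" if "n \<in> {..<81}" for n using that encode_decode by simp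
    show "decode (encode q) = q" if "q \<in> ?Q" for q
      using that unfolding decode_encode by (cases q) auto
  qed
  define \<psi> where "\<psi> n = W (decode n)" for n
  have bij_\<psi>: "bij_betw \<psi> {..<81} G"
    using bij_betw_trans[OF bij_decode abcd(3)] by (simp add: \<psi>_def[abs_def] W_def comp_def)
  define \<Phi> where "\<Phi> n = \<psi> n o'" for n
  have bij_\<Phi>: "bij_betw \<Phi> {..<81} P"
    using bij_betw_trans[OF bij_\<psi> orbit_bij] by (simp add: \<Phi>_def[abs_def] comp_def)
  have line: "\<Phi> ` vLS_line F81 gamma81 (encode q) = W q ` M0" for q
  proof -
    have "\<Phi> (encode (quad_add q r)) = W q (W r o')" for r
      unfolding \<Phi>_def \<psi>_def decode_encode W_mod W_add by (rule app[OF WG WG])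
    then have "\<Phi> ` vLS_line F81 gamma81 (encode q) = (\<lambda>g. W q (g o')) ` W `
        {(0, 0, 0, 0), (1, 0, 0, 0), (0, 1, 0, 0), (0, 0, 1, 0), (0, 0, 0, 1), (2, 2, 2, 2)}"
      unfolding vLS_line_F81 image_image by simp
    also have "\<dots> = W q ` (\<lambda>g. g o') ` D" unfolding W_D image_image ..
    finally show ?thesis unfolding D_image .
  qed
  have lines: "(\<lambda>N. \<Phi> ` N) ` vLS_lines F81 gamma81 = L"
  proof -
    have "\<Phi> ` vLS_line F81 gamma81 n = \<psi> n ` M0" if "n \<in> {..<81}" for n
      using line[of "decode n"] encode_decode that by (simp add: \<psi>_def)
    then have "(\<lambda>N. \<Phi> ` N) ` vLS_lines F81 gamma81 = (\<lambda>n. \<psi> n ` M0) ` {..<81}"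
      unfolding vLS_lines_def image_image F81_simps(1) by (intro image_cong refl)
    also have "\<dots> = (\<lambda>g. g ` M0) ` \<psi> ` {..<81}" unfolding image_image ..
    also have "\<psi> ` {..<81} = G" using bij_\<psi> by (rule bij_betw_imp_surj_on)
    finally show ?thesis unfolding L_eq .
  qed
  define f where "f = inv_into {..<81} \<Phi>"
  have "f \<in> geometry_iso P L (carrier F81) (vLS_lines F81 gamma81)"
    unfolding geometry_iso_def mem_Collect_eq
  proof
    show "bij_betw f P (carrier F81)"
      unfolding f_def F81_simps(1) by (rule bij_betw_inv_into[OF bij_\<Phi>])
    have "f ` \<Phi> ` N = N" if N: "N \<in> vLS_lines F81 gamma81" for N
    proof -
      have "N \<subseteq> {..<81}"
      proof -
        obtain n where n: "n < 81" "N = vLS_line F81 gamma81 n"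
          using N by (auto simp: vLS_lines_def F81_simps(1))
        have "N = vLS_line F81 gamma81 (encode (decode n))" using n encode_decode by simp
        then show ?thesis unfolding vLS_line_F81 using encode_less by auto
      qed
      then show ?thesis
        unfolding f_def using bij_\<Phi> by (intro inv_into_image_cancel) (auto simp: bij_betw_def)
    qed
    then have "(\<lambda>M. f ` M) ` (\<lambda>N. \<Phi> ` N) ` vLS_lines F81 gamma81 = vLS_lines F81 gamma81"
      unfolding image_image by simp
    then show "(\<lambda>M. f ` M) ` L = vLS_lines F81 gamma81" unfolding lines .
  qed
  then show ?thesis
    unfolding is_van_lint_schrijver_def
    using F81_field primitive_fifth_root_gamma81
    by (intro exI[of _ F81] exI[of _ gamma81]) (auto simp: Coset.order_def F81_simps(1))
qed

end

theorem mainTheorem2: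
  fixes P :: "'a set" and L :: "'a set set" and s t \<alpha> :: nat and G :: "('a \<Rightarrow> 'a) set"
  assumes "proper_partial_geometry P L s t \<alpha>"
    and "\<alpha> \<ge> 2"
    and "abelian_singer_group P L G"
    and "rigid_type P L G"
    and "card P < 1000000"
  shows "is_van_lint_schrijver P L \<or> card P \<in> {1024, 4096, 194481}"
proof -
  interpret proper_partial_geometry P L s t \<alpha> by fact
  obtain x where x: "x \<in> P" using points_nonempty by blast
  interpret rigid_singer_geometry P L s t \<alpha> G x
    by (intro rigid_singer_geometry.intro singer_geometry.intro singer_geometry_axioms.intro
        rigid_singer_geometry_axioms.intro) (use assms x in auto)
  show ?thesis
    using parameter_restriction[OF assms(2,5)] van_lint_schrijver_if_5_5_2 by blast
qed

end
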